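(* There exist a flux $A(x,u)$ satisfying assumptions (A-1)--(A-3) and (B-1)--(B-4) listed in the context, constants $C_2>C_1>0$ with $\partial_{uu}A(x,u)\in[C_1,C_2]$ for all $x,u$, and an initial datum $u_0\in BV(\mathbb{R})$ such that the corresponding adapted entropy solution $u$ of $u_t+A(x,u)_x=0$, $u(0,\cdot)=u_0$, has total variation blow-up at some finite time $T_0>0$, i.e. $TV(u(T_0,\cdot))=\infty$.
   Context: $BV(\mathbb{R})$ denotes functions on $\mathbb{R}$ of finite total variation $TV$. Assumptions on $A:\mathbb{R}\times\mathbb{R}\to\mathbb{R}$: (A-1) $A$ is continuous on $(\mathbb{R}\setminus\Omega)\times\mathbb{R}$, where $\Omega\subset\mathbb{R}$ is a closed set of measure zero. (A-2) There is a locally bounded $q:\mathbb{R}\to\mathbb{R}$ such that $|A(x,u)-A(x,v)|\le q(R)|u-v|$ for a.e. $x\in\mathbb{R}$ and all $u,v\in[-R,R]$, $R>0$. (A-3) There are functions $u_M^\pm:\mathbb{R}\to\mathbb{R}$, continuous on $\mathbb{R}\setminus\Omega$, with $u_M^-(x)\le u_M^+(x)$ for $x\in\mathbb{R}\setminus\Omega$, such that $A(x,\cdot)$ is decreasing on $(-\infty,u_M^-(x)]$, increasing on $[u_M^+(x),\infty)$, and $A(x,z)=0$ for all $u_M^-(x)\le z\le u_M^+(x)$; here $[u_M^-(x),u_M^+(x)]$ is exactly the zero set of $A(x,\cdot)$. (B-1) There are a continuous function $\eta:\mathbb{R}\to\mathbb{R}$ and a function $a\in BV(\mathbb{R})$ such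 that $|A(x,u)-A(y,u)|\le\eta(u)|a(x)-a(y)|$ for all $x,y,u\in\mathbb{R}$. (B-2) $u\mapsto A(x,u)$ is convex for each $x\in\mathbb{R}$. (B-3) There are non-negative convex functions $B_1,B_2$ with $B_1(u)\le|A(x,u)|\le B_2(u)$ for all $x,u$, and $\lim_{|u|\to\infty}B_1(u)=\infty$. (B-4) With $u_M:=(u_M^-+u_M^+)/2$, one has $u_M\in BV(\mathbb{R})$ and $u_M^+-u_M^-\in BV(\mathbb{R})$. Stationary states: for $\alpha\ge0$, $k_\alpha^-(x)\le u_M^-(x)$ and $k_\alpha^+(x)\ge u_M^+(x)$ are defined by $A(x,k_\alpha^\pm(x))=\alpha$. For $\alpha>0$ let $\mathscr S_\alpha=\{k_\alpha^+,k_\alpha^-\}$; let $\mathscr S_0$ be the set of all (measurable) functions $k$ with $u_M^-(x)\le k(x)\le u_M^+(x)$ for all $x$. Adapted entropy solution with initial data $u_0$: a function $u\in L^\infty((0,\infty)\times\mathbb{R})$, with $u\in C([0,T];L^1_{loc}(\mathbb{R}))$ for all $T>0$, such that for all $\alpha\ge0$, all $k_\alpha\in\mathscr S_\alpha$ and all $0\le\phi\in C_c^\infty([0,\infty)\times\mathbb{R})$, $$\int_0^\infty\!\!\int_{\mathbb{R}}|u-k_\alpha(x)|\phi_t+\operatorname{sgn}(u-k_\alpha(x))\,(A(x,u)-\alpha)\,\phi_x\,dx\,dt+\int_{\mathbb{R}}|u_0(x)-k_\alpha(x)|\phi(0,x)\,dx\ge0.$$ *)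

theory Defs
  imports "HOL-Analysis.Analysis"
begin

section \<open>Total variation\<close>

text \<open>The variation of a function defined at every point of the line. A nondecreasing sequence
  of nodes suffices: repeated nodes contribute nothing.\<close>

definition total_variation :: "(real \<Rightarrow> real) \<Rightarrow> ennreal" where
  "total_variation f =
     (SUP (n, s) \<in> UNIV \<times> {s :: nat \<Rightarrow> real. mono s}. \<Sum>i<n. ennreal \<bar>f (s (Suc i)) - f (s i)\<bar>)"

definition BV :: "(real \<Rightarrow> real) set" where
  "BV = {f. total_variation f < \<infinity>}"

text \<open>A time slice of a solution is only an almost-everywhere class, for which the variation is
  the infimum over all representatives. Thus it is infinite iff every representative has infinite
  variation; the pointwise variation could be made infinite by changing the slice on a null set.\<close>

definition ess_total_variation :: "(real \<Rightarrow> real) \<Rightarrow> ennreal" where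
  "ess_total_variation f = (INF g \<in> {g. AE x in lebesgue. g x = f x}. total_variation g)"


section \<open>Assumptions on the flux\<close>

text \<open>In what follows \<open>A x u\<close> is the flux, \<open>\<Omega>\<close> its exceptional set, and \<open>um\<close>, \<open>up\<close> are the
  endpoints of the zero set of \<open>A x\<close>.\<close>

definition flux_A1 :: "(real \<Rightarrow> real \<Rightarrow> real) \<Rightarrow> real set \<Rightarrow> bool" where
  "flux_A1 A \<Omega> \<longleftrightarrow>
     closed \<Omega> \<and> \<Omega> \<in> null_sets lebesgue \<and> continuous_on ((- \<Omega>) \<times> UNIV) (\<lambda>(x, u). A x u)"

definition flux_A2 :: "(real \<Rightarrow> real \<Rightarrow> real) \<Rightarrow> bool" where
  "flux_A2 A \<longleftrightarrow>
     (\<exists>q :: real \<Rightarrow> real. (\<forall>K. compact K \<longrightarrow> bounded (q ` K)) \<and>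
        (AE x in lebesgue. \<forall>R>0. \<forall>u\<in>{-R..R}. \<forall>v\<in>{-R..R}. \<bar>A x u - A x v\<bar> \<le> q R * \<bar>u - v\<bar>))"

definition flux_A3 ::
  "(real \<Rightarrow> real \<Rightarrow> real) \<Rightarrow> real set \<Rightarrow> (real \<Rightarrow> real) \<Rightarrow> (real \<Rightarrow> real) \<Rightarrow> bool" where
  "flux_A3 A \<Omega> um up \<longleftrightarrow>
     continuous_on (- \<Omega>) um \<and> continuous_on (- \<Omega>) up \<and>
     (\<forall>x\<in>- \<Omega>. um x \<le> up x) \<and>
     (\<forall>x. strict_antimono_on {..um x} (A x)) \<and>
     (\<forall>x. strict_mono_on {up x..} (A x)) \<and>
     (\<forall>x. {z. A x z = 0} = {um x..up x})"

definition flux_B1 :: "(real \<Rightarrow> real \<Rightarrow> real) \<Rightarrow> bool" where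
  "flux_B1 A \<longleftrightarrow>
     (\<exists>\<eta> a. continuous_on UNIV \<eta> \<and> a \<in> BV \<and> (\<forall>x y u. \<bar>A x u - A y u\<bar> \<le> \<eta> u * \<bar>a x - a y\<bar>))"

definition flux_B2 :: "(real \<Rightarrow> real \<Rightarrow> real) \<Rightarrow> bool" where
  "flux_B2 A \<longleftrightarrow> (\<forall>x. convex_on UNIV (A x))"

definition flux_B3 :: "(real \<Rightarrow> real \<Rightarrow> real) \<Rightarrow> bool" where
  "flux_B3 A \<longleftrightarrow>
     (\<exists>B1 B2. convex_on UNIV B1 \<and> convex_on UNIV B2 \<and> (\<forall>u. 0 \<le> B1 u) \<and> (\<forall>u. 0 \<le> B2 u) \<and>
        (\<forall>x u. B1 u \<le> \<bar>A x u\<bar> \<and> \<bar>A x u\<bar> \<le> B2 u) \<and> filterlim B1 at_top at_infinity)"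

definition flux_B4 :: "(real \<Rightarrow> real) \<Rightarrow> (real \<Rightarrow> real) \<Rightarrow> bool" where
  "flux_B4 um up \<longleftrightarrow> (\<lambda>x. (um x + up x) / 2) \<in> BV \<and> (\<lambda>x. up x - um x) \<in> BV"

definition flux_uu_in :: "(real \<Rightarrow> real \<Rightarrow> real) \<Rightarrow> real \<Rightarrow> real \<Rightarrow> bool" where
  "flux_uu_in A C1 C2 \<longleftrightarrow>
     (\<exists>Au Auu. \<forall>x u. (A x has_real_derivative Au x u) (at u) \<and>
        (Au x has_real_derivative Auu x u) (at u) \<and> Auu x u \<in> {C1..C2})"


section \<open>Adapted entropy solutions\<close>

text \<open>For \<open>\<alpha> > 0\<close> strict monotonicity leaves at most one function in each of the two sets of the
  union, namely the upper and the lower stationary state.\<close>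

definition stationary_states ::
  "(real \<Rightarrow> real \<Rightarrow> real) \<Rightarrow> (real \<Rightarrow> real) \<Rightarrow> (real \<Rightarrow> real) \<Rightarrow> real \<Rightarrow> (real \<Rightarrow> real) set" where
  "stationary_states A um up \<alpha> =
     (if \<alpha> = 0 then {k \<in> borel_measurable lebesgue. \<forall>x. um x \<le> k x \<and> k x \<le> up x}
      else {k. \<forall>x. up x \<le> k x \<and> A x (k x) = \<alpha>} \<union> {k. \<forall>x. k x \<le> um x \<and> A x (k x) = \<alpha>})"

primrec Ck :: "nat \<Rightarrow> ('a :: euclidean_space \<Rightarrow> real) \<Rightarrow> bool" where
  "Ck 0 f \<longleftrightarrow> continuous_on UNIV f"
| "Ck (Suc k) f \<longleftrightarrow>
     (\<exists>f'. (\<forall>x. (f has_derivative f' x) (at x)) \<and> (\<forall>b\<in>Basis. Ck k (\<lambda>x. f' x b)))"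

text \<open>Smooth compactly supported functions on the closed half-plane \<open>t \<ge> 0\<close> are taken to be the
  restrictions of those on the whole plane; points are pairs \<open>(t, x)\<close>.\<close>

definition test_functions :: "(real \<times> real \<Rightarrow> real) set" where
  "test_functions =
     {\<phi>. (\<forall>k. Ck k \<phi>) \<and> compact (closure {p. \<phi> p \<noteq> 0}) \<and> (\<forall>t\<ge>0. \<forall>x. 0 \<le> \<phi> (t, x))}"

definition continuous_in_L1loc :: "(real \<Rightarrow> real \<Rightarrow> real) \<Rightarrow> real \<Rightarrow> bool" where
  "continuous_in_L1loc u T \<longleftrightarrow>
     (\<forall>K. compact K \<longrightarrow>
        (\<forall>t\<in>{0..T}. set_integrable lebesgue K (u t) \<and>
           ((\<lambda>s. LINT x:K|lebesgue. \<bar>u s x - u t x\<bar>) \<longlongrightarrow> 0) (at t within {0..T})))"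

text \<open>Values \<open>u t x\<close> with \<open>t < 0\<close> are irrelevant. For a flux satisfying the assumptions above and
  \<open>u0\<close> of bounded variation all integrands below are integrable, so the convention that the
  integral of a non-integrable function is zero plays no role.\<close>

definition adapted_entropy_solution ::
  "(real \<Rightarrow> real \<Rightarrow> real) \<Rightarrow> (real \<Rightarrow> real) \<Rightarrow> (real \<Rightarrow> real) \<Rightarrow> (real \<Rightarrow> real) \<Rightarrow>
     (real \<Rightarrow> real \<Rightarrow> real) \<Rightarrow> bool" where
  "adapted_entropy_solution A um up u0 u \<longleftrightarrow>
     (\<lambda>(t, x). u t x) \<in> borel_measurable (lebesgue_on ({0<..} \<times> UNIV)) \<and>
     (\<exists>M. AE (t, x) in lebesgue_on ({0<..} \<times> UNIV). \<bar>u t x\<bar> \<le> M) \<and>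
     (\<forall>T>0. continuous_in_L1loc u T) \<and>
     (\<forall>\<alpha>\<ge>0. \<forall>k\<in>stationary_states A um up \<alpha>. \<forall>\<phi>\<in>test_functions.
        0 \<le> (LINT (t, x):({0<..} \<times> UNIV)|lebesgue.
                \<bar>u t x - k x\<bar> * deriv (\<lambda>s. \<phi> (s, x)) t
                + sgn (u t x - k x) * (A x (u t x) - \<alpha>) * deriv (\<lambda>y. \<phi> (t, y)) x)
            + (LINT x|lebesgue. \<bar>u0 x - k x\<bar> * \<phi> (0, x)))"

end

theory Submission
  imports Defs
begin

text \<open>In the time variable \<open>s = 1 / (1 + t)\<close> put \<open>v = x\<^sup>2 s / 2 + h(s) e(x)\<close> with
  \<open>e(x) = \<epsilon> x\<^sup>3 (cos (1/x) - 1)\<close>, a perturbation of the potential of the Burgers rarefaction \<open>x / (1 + t)\<close>.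
  For fixed \<open>x > 0\<close> the function \<open>v\<^sub>x\<close> is strictly monotone in time, so \<open>A(x, v\<^sub>x) = - v\<^sub>t\<close> defines a flux on
  \<open>x > 0\<close>, for which \<open>v\<^sub>x\<close> is a solution by construction; for \<open>x \<le> 0\<close> the flux is \<open>u\<^sup>2 / 2\<close> and the solution \<open>0\<close>.
  Since \<open>\<epsilon>\<close> is small, \<open>A(x, \<cdot>)\<close> is uniformly convex, and its dependence on \<open>x\<close> is dominated by \<open>arctan\<close>.
  As \<open>h(1) = 0\<close>, the initial value is \<open>x\<close>, but for \<open>t > 0\<close> the summand \<open>h(s) e'(x)\<close>
  oscillates like \<open>x sin (1/x)\<close> and has infinite variation near \<open>0\<close>. Truncation at the flux level \<open>1\<close>
  makes the solution bounded.

  For uniqueness no doubling of variables is needed: the level sets of the flux along the explicit solution are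
  characteristics, and by convexity of the flux each upper stationary state \<open>k\<^sub>\<alpha>\<close> bounds
  every solution from above where the level is below \<open>\<alpha>\<close>, and from below where it is above \<open>\<alpha>\<close>.\<close>

section \<open>Smooth functions\<close>

text \<open>The obstacle sits at \<open>x = 0\<close>. Infinite variation of \<open>v_x\<close>
  forces \<open>e''\<close> to be non-integrable there, whereas \<open>flux_B1\<close> wants the
  variation of the flux in \<open>x\<close>, at fixed \<open>u\<close>, to be finite. That variation
  contains the term \<open>A_u * h(s) * e''(x)\<close>. Since \<open>A_u\<close> is close to
  \<open>x s\<close> and \<open>e''\<close> is of size \<open>1/x\<close>, the product stays
  bounded: the characteristic speed degenerates at the minimum of the flux and absorbs the
  singularity. The level \<open>- v_t\<close> of the flux along the solution involves only
  \<open>e\<close> and not \<open>e'\<close>, so it remains increasing in \<open>x\<close> while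
  \<open>v_x\<close> oscillates. A potential yields a solution for free, because
  \<open>(v_x)_t = (v_t)_x\<close>. The price is that the flux it induces must be admissible for
  every real \<open>u\<close>, hence for every real \<open>s\<close> and not only for the values in
  \<open>(0, 1]\<close> that are actual times. This is why \<open>h\<close> is a profile on the
  whole line. The variable \<open>s\<close> satisfies \<open>ds/dt = - s^2\<close>. Without the
  perturbation one has \<open>u = x s\<close> and flux \<open>u^2 / 2\<close>, independent of
  \<open>x\<close>, so every error term carries the small factor \<open>eps\<close>.\<close>

lemma frechet_derivative_worksI:
  "f differentiable (at x) \<Longrightarrow> (f has_derivative frechet_derivative f (at x)) (at x)"
  using frechet_derivative_works by blast

text \<open>\<open>Ck\<close> hides its derivative behind an existential quantifier. Fixing it to be
  \<open>frechet_derivative\<close> lets the closure properties be proved by plain induction on the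
  order, and the set argument allows functions that are smooth only on an open piece.\<close>

primrec Ck_on :: "nat \<Rightarrow> 'a set \<Rightarrow> ('a :: euclidean_space \<Rightarrow> real) \<Rightarrow> bool" where
  "Ck_on 0 S f \<longleftrightarrow> continuous_on S f"
| "Ck_on (Suc k) S f \<longleftrightarrow> (\<forall>x\<in>S. f differentiable (at x)) \<and>
     (\<forall>b\<in>Basis. Ck_on k S (\<lambda>x. frechet_derivative f (at x) b))"

lemma Ck_on_UNIV: "Ck_on k UNIV f \<Longrightarrow> Ck k f"
proof (induction k arbitrary: f)
  case (Suc k)
  then show ?case
    unfolding Ck.simps Ck_on.simps
    by (intro exI[of _ "\<lambda>x. frechet_derivative f (at x)"])
       (simp add: frechet_derivative_worksI)
qed simp

lemma Ck_on_cong: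
  assumes "open S" "\<And>x. x \<in> S \<Longrightarrow> f x = g x" "Ck_on k S f"
  shows "Ck_on k S g"
  using assms(2,3)
proof (induction k arbitrary: f g)
  case 0
  then show ?case using continuous_on_cong[of S S f g] by simp
next
  case (Suc k)
  have D: "(g has_derivative frechet_derivative f (at x)) (at x)" if "x \<in> S" for x
  proof (rule has_derivative_transform_within_open[OF _ assms(1) that])
    show "(f has_derivative frechet_derivative f (at x)) (at x)"
      using Suc.prems that by (auto simp: frechet_derivative_worksI)
  qed (use Suc.prems in auto)
  have E: "frechet_derivative g (at x) = frechet_derivative f (at x)" if "x \<in> S" for x
    using frechet_derivative_at[OF D[OF that]] by simp
  have "Ck_on k S (\<lambda>x. frechet_derivative g (at x) b)" if "b \<in> Basis" for b
    by (rule Suc.IH[of "\<lambda>x. frechet_derivative f (at x) b"]) (use E Suc.prems that in auto)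
  moreover have "g differentiable at x" if "x \<in> S" for x
    using D[OF that] unfolding differentiable_def by blast
  ultimately show ?case by simp
qed

lemma Ck_on_subset: "Ck_on k S f \<Longrightarrow> T \<subseteq> S \<Longrightarrow> Ck_on k T f"
  by (induction k arbitrary: f) (auto intro: continuous_on_subset)

text \<open>Differentiability at a point depends on a neighbourhood only, and
  \<open>frechet_derivative\<close> has the same value on every piece, so overlapping open pieces
  glue without any compatibility condition. Cutoffs defined by cases are shown smooth in this
  way.\<close>

lemma Ck_on_local:
  assumes "\<And>x. x \<in> S \<Longrightarrow> \<exists>T. open T \<and> x \<in> T \<and> Ck_on k T f"
  shows "Ck_on k S f"
  using assms
proof (induction k arbitrary: f)
  case 0
  have "isCont f x" if "x \<in> S" for x
    using 0[OF that] continuous_on_eq_continuous_at by auto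
  then show ?case by (simp add: continuous_at_imp_continuous_on)
next
  case (Suc k)
  have "f differentiable at x" if "x \<in> S" for x
    using Suc.prems[OF that] by auto
  moreover have "Ck_on k S (\<lambda>x. frechet_derivative f (at x) b)" if "b \<in> Basis" for b
    using Suc.IH[of "\<lambda>x. frechet_derivative f (at x) b"] Suc.prems that by fastforce
  ultimately show ?case by simp
qed

lemma Ck_on_SucI:
  assumes "open S" "\<And>x. x \<in> S \<Longrightarrow> (f has_derivative f' x) (at x)"
    "\<And>b. b \<in> Basis \<Longrightarrow> Ck_on k S (\<lambda>x. f' x b)"
  shows "Ck_on (Suc k) S f"
proof -
  have E: "frechet_derivative f (at x) = f' x" if "x \<in> S" for x
    using frechet_derivative_at[OF assms(2)[OF that]] by simp
  have "Ck_on k S (\<lambda>x. frechet_derivative f (at x) b)" if "b \<in> Basis" for b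
    by (rule Ck_on_cong[OF assms(1) _ assms(3)[OF that]]) (use E in auto)
  moreover have "f differentiable at x" if "x \<in> S" for x
    using assms(2)[OF that] unfolding differentiable_def by blast
  ultimately show ?thesis by simp
qed

lemma Ck_on_continuous: "Ck_on k S f \<Longrightarrow> open S \<Longrightarrow> continuous_on S f"
  by (cases k) (auto intro!: continuous_at_imp_continuous_on differentiable_imp_continuous_within)

lemma Ck_on_Suc_imp: "open S \<Longrightarrow> Ck_on (Suc k) S f \<Longrightarrow> Ck_on k S f"
proof (induction k arbitrary: f)
  case 0
  then show ?case by (metis Ck_on_continuous Ck_on.simps(1))
next
  case (Suc k)
  then show ?case by (auto)
qed

lemma Ck_on_const: "Ck_on k S (\<lambda>_. c)"
  by (induction k arbitrary: c) auto

lemma Ck_on_linear: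
  assumes "open S" "bounded_linear f" shows "Ck_on k S f"
proof (cases k)
  case 0
  then show ?thesis
    using assms linear_continuous_on by auto
next
  case (Suc j)
  show ?thesis unfolding Suc
    by (rule Ck_on_SucI[OF assms(1), of _ "\<lambda>_. f"])
       (auto intro: bounded_linear_imp_has_derivative assms Ck_on_const)
qed

lemma Ck_on_add:
  assumes "open S" "Ck_on k S f" "Ck_on k S g"
  shows "Ck_on k S (\<lambda>x. f x + g x)"
  using assms(2,3)
proof (induction k arbitrary: f g)
  case 0
  then show ?case by (auto intro: continuous_intros)
next
  case (Suc k)
  show ?case
    by (rule Ck_on_SucI[OF assms(1),
          of _ "\<lambda>x b. frechet_derivative f (at x) b + frechet_derivative g (at x) b"])
       (use Suc in \<open>auto intro!: has_derivative_add simp: frechet_derivative_worksI\<close>)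
qed

lemma Ck_on_mult:
  assumes "open S" "Ck_on k S f" "Ck_on k S g"
  shows "Ck_on k S (\<lambda>x. f x * g x)"
  using assms(2,3)
proof (induction k arbitrary: f g)
  case 0
  then show ?case by (auto intro: continuous_intros)
next
  case (Suc k)
  \<comment> \<open>The product rule contains the undifferentiated factors, so these must be
    available at order \<open>k\<close> as well.\<close>
  have "Ck_on k S f" "Ck_on k S g"
    using Suc.prems Ck_on_Suc_imp[OF assms(1)] by blast+
  show ?case
  proof (rule Ck_on_SucI[OF assms(1),
          of _ "\<lambda>x b. f x * frechet_derivative g (at x) b + frechet_derivative f (at x) b * g x"])
    fix x assume "x \<in> S"
    then show "((\<lambda>x. f x * g x) has_derivative
        (\<lambda>b. f x * frechet_derivative g (at x) b + frechet_derivative f (at x) b * g x)) (at x)"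
      using Suc.prems by (intro has_derivative_mult) (auto simp: frechet_derivative_worksI)
  next
    fix b :: 'a assume "b \<in> Basis"
    then show "Ck_on k S
        (\<lambda>x. f x * frechet_derivative g (at x) b + frechet_derivative f (at x) b * g x)"
      using Suc.prems \<open>Ck_on k S f\<close> \<open>Ck_on k S g\<close>
      by (intro Ck_on_add[OF assms(1)] Suc.IH) auto
  qed
qed

lemma Ck_on_real_SucI:
  fixes f :: "real \<Rightarrow> real"
  assumes "open S" "\<And>x. x \<in> S \<Longrightarrow> (f has_real_derivative f' x) (at x)" "Ck_on k S f'"
  shows "Ck_on (Suc k) S f"
  by (rule Ck_on_SucI[OF assms(1), of _ "\<lambda>x. (*) (f' x)"])
     (use assms in \<open>auto simp: has_field_derivative_def\<close>)

lemma Ck_on_compose: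
  fixes g :: "real \<Rightarrow> real"
  assumes "open S" "open T" "Ck_on k S f" "Ck_on k T g" "f ` S \<subseteq> T"
  shows "Ck_on k S (\<lambda>x. g (f x))"
  using assms(3,4)
proof (induction k arbitrary: g)
  case 0
  then show ?case using assms(5) by (auto intro: continuous_on_compose2)
next
  case (Suc k)
  define g' where "g' y = frechet_derivative g (at y) 1" for y
  have g: "(g has_derivative frechet_derivative g (at y)) (at y)" if "y \<in> T" for y
    using Suc.prems that by (auto simp: frechet_derivative_worksI)
  have g': "frechet_derivative g (at y) z = z * g' y" if "y \<in> T" for y z
    using linear_cmul[OF has_derivative_linear[OF g[OF that]], of z 1] by (simp add: g'_def)
  have f: "(f has_derivative frechet_derivative f (at x)) (at x)" if "x \<in> S" for x
    using Suc.prems that by (auto simp: frechet_derivative_worksI)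
  show ?case
  proof (rule Ck_on_SucI[OF assms(1), of _ "\<lambda>x b. frechet_derivative f (at x) b * g' (f x)"])
    fix x assume x: "x \<in> S"
    then have fx: "f x \<in> T" using assms(5) by auto
    show "((\<lambda>x. g (f x)) has_derivative (\<lambda>b. frechet_derivative f (at x) b * g' (f x))) (at x)"
      using has_derivative_compose[OF f[OF x] g[OF fx]] by (simp add: g'[OF fx])
  next
    fix b :: 'a assume "b \<in> Basis"
    then have "Ck_on k S (\<lambda>x. frechet_derivative f (at x) b)"
      using Suc.prems(1) by simp
    moreover have "Ck_on k T g'"
      using Suc.prems(2) unfolding g'_def by simp
    ultimately show "Ck_on k S (\<lambda>x. frechet_derivative f (at x) b * g' (f x))"
      by (rule Ck_on_mult[OF assms(1) _ Suc.IH[OF Ck_on_Suc_imp[OF assms(1) Suc.prems(1)]]])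
  qed
qed

definition smooth_on :: "'a set \<Rightarrow> ('a :: euclidean_space \<Rightarrow> real) \<Rightarrow> bool" where
  "smooth_on S f \<longleftrightarrow> open S \<and> (\<forall>k. Ck_on k S f)"

lemma smooth_on_open: "smooth_on S f \<Longrightarrow> open S"
  by (simp add: smooth_on_def)

lemma smooth_on_const: "open S \<Longrightarrow> smooth_on S (\<lambda>_. c)"
  by (simp add: smooth_on_def Ck_on_const)

lemma smooth_on_linear: "open S \<Longrightarrow> bounded_linear f \<Longrightarrow> smooth_on S f"
  by (simp add: smooth_on_def Ck_on_linear)

lemma smooth_on_add: "smooth_on S f \<Longrightarrow> smooth_on S g \<Longrightarrow> smooth_on S (\<lambda>x. f x + g x)"
  by (simp add: smooth_on_def Ck_on_add)

lemma smooth_on_mult: "smooth_on S f \<Longrightarrow> smooth_on S g \<Longrightarrow> smooth_on S (\<lambda>x. f x * g x)"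
  by (simp add: smooth_on_def Ck_on_mult)

lemma smooth_on_diff: "smooth_on S f \<Longrightarrow> smooth_on S g \<Longrightarrow> smooth_on S (\<lambda>x. f x - g x)"
  using smooth_on_add[of S f "\<lambda>x. - 1 * g x"] smooth_on_mult[of S "\<lambda>_. - 1" g]
    smooth_on_const[of S "- 1"]
  by (simp add: smooth_on_open)

lemma smooth_on_power: "smooth_on S f \<Longrightarrow> smooth_on S (\<lambda>x. f x ^ n)"
  by (induction n) (auto intro: smooth_on_const smooth_on_mult smooth_on_open)

lemma smooth_on_compose:
  fixes g :: "real \<Rightarrow> real"
  shows "smooth_on T g \<Longrightarrow> smooth_on S f \<Longrightarrow> (\<And>x. x \<in> S \<Longrightarrow> f x \<in> T) \<Longrightarrow> smooth_on S (\<lambda>x. g (f x))"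
  unfolding smooth_on_def using Ck_on_compose[of S T _ f g] by blast

lemma smooth_on_subset: "smooth_on S f \<Longrightarrow> open T \<Longrightarrow> T \<subseteq> S \<Longrightarrow> smooth_on T f"
  unfolding smooth_on_def using Ck_on_subset by blast

lemma smooth_on_cong:
  "smooth_on S f \<Longrightarrow> (\<And>x. x \<in> S \<Longrightarrow> f x = g x) \<Longrightarrow> smooth_on S g"
  unfolding smooth_on_def using Ck_on_cong by blast

lemma smooth_on_Un:
  assumes "smooth_on S f" "smooth_on T f"
  shows "smooth_on (S \<union> T) f"
proof -
  have "Ck_on k (S \<union> T) f" for k
    by (rule Ck_on_local) (use assms in \<open>auto simp: smooth_on_def\<close>)
  then show ?thesis using assms by (auto simp: smooth_on_def)
qed

lemma smooth_on_exp: "smooth_on UNIV (exp :: real \<Rightarrow> real)"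
proof -
  have "Ck_on k UNIV (exp :: real \<Rightarrow> real)" for k
  proof (induction k)
    case (Suc k)
    then show ?case by (intro Ck_on_real_SucI[of _ _ exp]) (auto intro!: derivative_eq_intros)
  qed (auto intro: continuous_intros)
  then show ?thesis by (simp add: smooth_on_def)
qed

lemma smooth_on_inverse: "smooth_on (- {0}) (inverse :: real \<Rightarrow> real)"
proof -
  have o: "open (- {0 :: real})" by auto
  have "Ck_on k (- {0}) (inverse :: real \<Rightarrow> real)" for k
  proof (induction k)
    case (Suc k)
    have "Ck_on k (- {0}) (\<lambda>x::real. (- 1) * (inverse x * inverse x))"
      by (intro Ck_on_mult[OF o] Suc Ck_on_const)
    then show ?case
      by (intro Ck_on_real_SucI[OF o, of _ "\<lambda>x. (- 1) * (inverse x * inverse x)"])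
         (auto intro!: derivative_eq_intros)
  qed (auto intro: continuous_intros)
  then show ?thesis using o by (simp add: smooth_on_def)
qed

lemma smooth_on_cos: "smooth_on UNIV (cos :: real \<Rightarrow> real)"
proof -
  have "Ck_on k UNIV (cos :: real \<Rightarrow> real) \<and> Ck_on k UNIV (sin :: real \<Rightarrow> real)" for k
  proof (induction k)
    case (Suc k)
    have "Ck_on k UNIV (\<lambda>x::real. (- 1) * sin x)"
      by (rule Ck_on_mult) (use Suc in \<open>auto intro: Ck_on_const\<close>)
    then have "Ck_on (Suc k) UNIV (cos :: real \<Rightarrow> real)"
      by (intro Ck_on_real_SucI[of _ _ "\<lambda>x. (- 1) * sin x"]) (auto intro!: derivative_eq_intros)
    moreover have "Ck_on (Suc k) UNIV (sin :: real \<Rightarrow> real)"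
      by (intro Ck_on_real_SucI[of _ _ cos]) (use Suc in \<open>auto intro!: derivative_eq_intros\<close>)
    ultimately show ?case by blast
  qed (auto intro: continuous_intros)
  then show ?thesis by (simp add: smooth_on_def)
qed

section \<open>Flat functions, the building blocks of all cutoffs\<close>

definition flat :: "nat \<Rightarrow> real \<Rightarrow> real" where
  "flat n x = (if x > 0 then inverse x ^ n * exp (- inverse x) else 0)"

abbreviation f0 :: "real \<Rightarrow> real" where "f0 \<equiv> flat 0"

lemma flat_tendsto_0: "(flat n \<longlongrightarrow> 0) (at 0)"
proof -
  have "((\<lambda>y::real. y ^ n / exp y) \<longlongrightarrow> 0) at_top"
    by (rule tendsto_power_div_exp_0)
  then have "((\<lambda>x::real. inverse x ^ n / exp (inverse x)) \<longlongrightarrow> 0) (at_right 0)"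
    by (rule filterlim_compose) (rule filterlim_inverse_at_top_right)
  then have "(flat n \<longlongrightarrow> 0) (at_right 0)"
    by (rule Lim_transform_eventually)
       (auto simp: flat_def eventually_at_filter exp_minus field_simps)
  moreover have "(flat n \<longlongrightarrow> 0) (at_left 0)"
    by (rule Lim_transform_eventually[OF tendsto_const[of 0]])
       (auto simp: flat_def eventually_at_filter)
  ultimately show ?thesis by (simp add: filterlim_split_at)
qed

text \<open>\<open>flat 0\<close> is the classical \<open>exp (- 1/x)\<close>. The powers of
  \<open>1/x\<close> are carried along because they close the family under differentiation, so that
  smoothness follows by an induction over all \<open>n\<close> at once.\<close>

lemma flat_has_derivative:
  "(flat n has_real_derivative - real n * flat (Suc n) x + flat (Suc (Suc n)) x) (at x)"
proof -
  consider "x > 0" | "x < 0" | "x = 0" by linarith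
  then show ?thesis
  proof cases
    case 1
    have "((\<lambda>x. inverse x ^ n * exp (- inverse x)) has_real_derivative
        - real n * flat (Suc n) x + flat (Suc (Suc n)) x) (at x)"
    proof -
      have "((\<lambda>x. inverse x ^ n) has_real_derivative - real n * inverse x ^ Suc n) (at x)"
      proof (cases n)
        case (Suc m)
        then show ?thesis
          using 1 by (intro DERIV_cong[OF DERIV_power[OF DERIV_inverse[of x], of n]])
            (simp_all add: algebra_simps)
      qed simp
      moreover have "((\<lambda>x. exp (- inverse x)) has_real_derivative inverse x ^ 2 * exp (- inverse x)) (at x)"
        using 1 by (auto intro!: derivative_eq_intros simp: power2_eq_square)
      ultimately show ?thesis
        using 1 by (rule_tac DERIV_cong[OF DERIV_mult])
          (auto simp: flat_def algebra_simps power2_eq_square)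
    qed
    then show ?thesis
      by (rule has_field_derivative_transform_within_open[where S = "{0<..}"])
         (use 1 in \<open>auto simp: flat_def\<close>)
  next
    case 2
    have "((\<lambda>x. 0) has_real_derivative - real n * flat (Suc n) x + flat (Suc (Suc n)) x) (at x)"
      using 2 by (simp add: flat_def)
    then show ?thesis
      by (rule has_field_derivative_transform_within_open[where S = "{..<0}"])
         (use 2 in \<open>auto simp: flat_def\<close>)
  next
    case 3
    \<comment> \<open>The difference quotient of \<open>flat n\<close> at 0 is
      \<open>flat (Suc n)\<close>.\<close>
    have "((\<lambda>y. (flat n y - flat n 0) / (y - 0)) \<longlongrightarrow> 0) (at 0)"
      by (rule Lim_transform_eventually[OF flat_tendsto_0[of "Suc n"]])
         (auto simp: eventually_at_filter flat_def field_simps)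
    then show ?thesis
      using 3 by (simp add: has_field_derivative_iff flat_def)
  qed
qed

lemma smooth_on_flat: "smooth_on UNIV (flat n)"
proof -
  have "Ck_on k UNIV (flat n)" for k
  proof (induction k arbitrary: n)
    case 0
    have "isCont (flat n) x" for x using flat_has_derivative DERIV_isCont by blast
    then show ?case by (simp add: continuous_at_imp_continuous_on)
  next
    case (Suc k)
    have "Ck_on k UNIV (\<lambda>x. - real n * flat (Suc n) x + flat (Suc (Suc n)) x)"
      by (intro Ck_on_add Ck_on_mult Ck_on_const Suc open_UNIV)
    then show ?case
      by (intro Ck_on_real_SucI[OF _ flat_has_derivative]) auto
  qed
  then show ?thesis by (simp add: smooth_on_def)
qed

lemma flat_nonneg: "0 \<le> flat n x"
  by (simp add: flat_def)

lemma flat_pos_iff: "0 < flat n x \<longleftrightarrow> 0 < x"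
  by (simp add: flat_def)

lemma flat_zero_iff: "flat n x = 0 \<longleftrightarrow> x \<le> 0"
  by (auto simp: flat_def)

lemma f0_has_derivative: "(f0 has_real_derivative flat 2 x) (at x)"
  using flat_has_derivative[of 0 x] by (simp add: numeral_2_eq_2)

lemma f0_less: "x < y \<Longrightarrow> 0 < y \<Longrightarrow> f0 x < f0 y"
  using less_imp_inverse_less[of x y] by (auto simp: flat_def)

lemma f0_mono: "x \<le> y \<Longrightarrow> f0 x \<le> f0 y"
  using f0_less[of x y] flat_zero_iff[of 0 x] flat_nonneg[of 0 y]
  by (cases "x = y"; cases "0 < y") auto

section \<open>The flux\<close>

text \<open>The size is dictated by crude constants: a bound 50000 for the family of
  \<open>h\<close>, multiplied by a bound \<open>4 * eps\<close> for \<open>sg\<close> or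
  \<open>dl\<close>, gives 1/500 in \<open>small_prod\<close>. This leaves ample room for the
  curvature bounds 1/2 and 2.\<close>

definition eps :: real where "eps = 1 / 10 ^ 8"

text \<open>The double zero of \<open>h\<close> at \<open>0\<close> and its decay at infinity confine the perturbation of the flux to
  values \<open>u\<close> comparable to \<open>x\<close>; the zero at \<open>1\<close> makes it invisible at the initial time.\<close>

definition h :: "real \<Rightarrow> real" where "h s = (s^2 - s^3) * exp (- (s^2))"
definition h1 :: "real \<Rightarrow> real" where "h1 s = (2 * s - 3 * s^2 - 2 * s^3 + 2 * s^4) * exp (- (s^2))"
definition h2 :: "real \<Rightarrow> real" where
  "h2 s = (2 - 6 * s - 10 * s^2 + 14 * s^3 + 4 * s^4 - 4 * s^5) * exp (- (s^2))"
definition h3 :: "real \<Rightarrow> real" where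
  "h3 s = (- 6 - 24 * s + 54 * s^2 + 36 * s^3 - 48 * s^4 - 8 * s^5 + 8 * s^6) * exp (- (s^2))"

lemma h_deriv: "(h has_real_derivative h1 s) (at s)"
  unfolding h_def h1_def
  by (rule derivative_eq_intros refl | simp)+ (simp add: algebra_simps power_numeral_reduce)

lemma h1_deriv: "(h1 has_real_derivative h2 s) (at s)"
  unfolding h1_def h2_def
  by (rule derivative_eq_intros refl | simp)+ (simp add: algebra_simps power_numeral_reduce)

lemma h2_deriv: "(h2 has_real_derivative h3 s) (at s)"
  unfolding h2_def h3_def
  by (rule derivative_eq_intros refl | simp)+ (simp add: algebra_simps power_numeral_reduce)

text \<open>The inequality \<open>y \<le> exp y\<close> at \<open>y = s^2 / 4\<close>, raised to the
  fourth power, gives \<open>s^8 \<le> 4^4 * exp (s^2)\<close>, whence 256. The power 8 is the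
  highest one that occurs in the weighted derivatives of \<open>h\<close>.\<close>

lemma gauss_bound:
  fixes s :: real
  assumes "n \<le> 8"
  shows "\<bar>s ^ n * exp (- (s^2))\<bar> \<le> 256"
proof (cases "\<bar>s\<bar> \<le> 1")
  case True
  then have "\<bar>s\<bar> ^ n \<le> 1" by (simp add: power_le_one)
  moreover have "exp (- (s^2)) \<le> 1" by simp
  ultimately have "\<bar>s\<bar> ^ n * exp (- (s^2)) \<le> 1 * 1" by (intro mult_mono) auto
  then show ?thesis by (simp add: abs_mult power_abs)
next
  case False
  then have "\<bar>s\<bar> ^ n \<le> \<bar>s\<bar> ^ 8" using assms by (intro power_increasing) auto
  also have "\<bar>s\<bar> ^ 8 = 256 * (s^2 / 4) ^ 4" by (simp add: power_divide flip: power_mult)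
  also have "\<dots> \<le> 256 * exp (s^2 / 4) ^ 4"
    using exp_ge_add_one_self[of "s^2 / 4"] by (intro mult_left_mono power_mono order_trans[OF _ exp_ge_add_one_self]) auto
  also have "\<dots> = 256 * exp (s^2)"
    by (simp flip: exp_of_nat_mult)
  finally have "\<bar>s\<bar> ^ n * exp (- (s^2)) \<le> 256"
    by (simp add: exp_minus field_simps)
  then show ?thesis by (simp add: abs_mult power_abs)
qed

text \<open>Each expression is a polynomial in \<open>s\<close> times the Gaussian, hence a linear
  combination of terms at most 256 in modulus. The largest sum of coefficients is 184, for
  \<open>s^2 * h3 s\<close>, and 184 * 256 = 47104 is rounded up to 50000. The bounds with a factor
  \<open>s\<close> or \<open>s^2\<close> on the right record the zero of \<open>h\<close> at
  0.\<close>

lemma h_bounds: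
  "\<bar>h s\<bar> \<le> 50000 * s^2" "\<bar>h s\<bar> \<le> 50000 * \<bar>s\<bar>" "\<bar>s * h s\<bar> \<le> 50000"
  "\<bar>h1 s\<bar> \<le> 50000 * \<bar>s\<bar>" "\<bar>h1 s\<bar> \<le> 50000" "\<bar>s^2 * h1 s\<bar> \<le> 50000"
  "\<bar>h2 s\<bar> \<le> 50000" "\<bar>s * h2 s\<bar> \<le> 50000" "\<bar>s^3 * h2 s\<bar> \<le> 50000" "\<bar>s^2 * h3 s\<bar> \<le> 50000"
proof -
  define y where "y n = s ^ n * exp (- (s^2))" for n
  have y: "y n \<le> 256 \<and> - 256 \<le> y n" if "n \<le> 8" for n
    using gauss_bound[OF that, of s] unfolding y_def abs_le_iff by linarith
  have Y: "y n \<le> 256" "- 256 \<le> y n" if "n \<in> {0, 1, 2, 3, 4, 5, 6, 7, 8}" for n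
    using y[of n] that by auto
  note Y = Y[of 0, simplified] Y[of 1, simplified] Y[of 2, simplified] Y[of 3, simplified]
    Y[of 4, simplified] Y[of 5, simplified] Y[of 6, simplified] Y[of 7, simplified] Y[of 8, simplified]
  have M: "\<bar>a * b\<bar> \<le> 50000 * \<bar>a\<bar>" if "\<bar>b\<bar> \<le> 50000" for a b :: real
    using mult_left_mono[OF that, of "\<bar>a\<bar>"] by (simp add: abs_mult mult.commute)
  have "\<bar>y 0 - y 1\<bar> \<le> 50000" "\<bar>y 1 - y 2\<bar> \<le> 50000"
    "\<bar>2 * y 0 - 3 * y 1 - 2 * y 2 + 2 * y 3\<bar> \<le> 50000"
    unfolding One_nat_def by (rule abs_leI; insert Y; linarith)+
  note M[OF this(1), of "s^2"] M[OF this(2), of s] M[OF this(3), of s]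
  moreover have "h s = s^2 * (y 0 - y 1)"
    by (simp add: h_def y_def algebra_simps power_numeral_reduce)
  moreover have "h s = s * (y 1 - y 2)"
    by (simp add: h_def y_def algebra_simps power_numeral_reduce)
  moreover have "h1 s = s * (2 * y 0 - 3 * y 1 - 2 * y 2 + 2 * y 3)"
    by (simp add: h1_def y_def algebra_simps power_numeral_reduce)
  ultimately show "\<bar>h s\<bar> \<le> 50000 * s^2" "\<bar>h s\<bar> \<le> 50000 * \<bar>s\<bar>" "\<bar>h1 s\<bar> \<le> 50000 * \<bar>s\<bar>"
    by (metis abs_power2)+
  have "s * h s = y 3 - y 4" "h1 s = 2 * y 1 - 3 * y 2 - 2 * y 3 + 2 * y 4"
    "s^2 * h1 s = 2 * y 3 - 3 * y 4 - 2 * y 5 + 2 * y 6"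
    "h2 s = 2 * y 0 - 6 * y 1 - 10 * y 2 + 14 * y 3 + 4 * y 4 - 4 * y 5"
    "s * h2 s = 2 * y 1 - 6 * y 2 - 10 * y 3 + 14 * y 4 + 4 * y 5 - 4 * y 6"
    "s^3 * h2 s = 2 * y 3 - 6 * y 4 - 10 * y 5 + 14 * y 6 + 4 * y 7 - 4 * y 8"
    "s^2 * h3 s = - 6 * y 2 - 24 * y 3 + 54 * y 4 + 36 * y 5 - 48 * y 6 - 8 * y 7 + 8 * y 8"
    unfolding h_def h1_def h2_def h3_def y_def
    by (simp_all add: algebra_simps power_numeral_reduce)
  then show "\<bar>s * h s\<bar> \<le> 50000" "\<bar>h1 s\<bar> \<le> 50000" "\<bar>s^2 * h1 s\<bar> \<le> 50000"
  "\<bar>h2 s\<bar> \<le> 50000" "\<bar>s * h2 s\<bar> \<le> 50000" "\<bar>s^3 * h2 s\<bar> \<le> 50000" "\<bar>s^2 * h3 s\<bar> \<le> 50000"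
    unfolding One_nat_def by (simp_all only:) (rule abs_leI; insert Y; linarith)+
qed

text \<open>With \<open>e\<close> as above, \<open>e = x\<^sup>2 sg\<close>, \<open>e' = x dl\<close> and \<open>e'' = kap\<close>.\<close>

definition sg :: "real \<Rightarrow> real" where "sg x = eps * (x * (cos (1/x) - 1))"
definition dl :: "real \<Rightarrow> real" where "dl x = eps * (3 * (x * (cos (1/x) - 1)) + sin (1/x))"
definition kap :: "real \<Rightarrow> real" where
  "kap x = eps * (6 * (x * (cos (1/x) - 1)) + 4 * sin (1/x) - cos (1/x) / x)"

lemma one_minus_cos_le: "\<bar>cos y - 1\<bar> \<le> \<bar>y\<bar>" for y :: real
proof -
  have "norm (cos y - cos 0) \<le> 1 * norm (y - 0)"
    by (rule field_differentiable_bound[of UNIV _ "\<lambda>x. - sin x"])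
       (auto intro!: derivative_eq_intros)
  then show ?thesis by simp
qed

text \<open>This is the reason for subtracting 1 from the cosine in \<open>e\<close>:
  \<open>x cos (1/x)\<close> alone grows linearly at infinity, whereas
  \<open>\<bar>cos y - 1\<bar> \<le> \<bar>y\<bar>\<close> at \<open>y = 1/x\<close> gives a bound
  uniform in \<open>x\<close>.\<close>

lemma x_cos_bound: "\<bar>x * (cos (1/x) - 1)\<bar> \<le> 1" for x :: real
proof (cases "x = 0")
  case False
  have "\<bar>x\<bar> * \<bar>cos (1/x) - 1\<bar> \<le> \<bar>x\<bar> * \<bar>1/x\<bar>"
    by (intro mult_left_mono one_minus_cos_le) auto
  then show ?thesis using False by (simp add: abs_mult)
qed simp

lemma sg_bound: "\<bar>sg x\<bar> \<le> 1 / 10^8"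
  using x_cos_bound[of x] unfolding sg_def eps_def by (simp add: abs_mult)

lemma dl_bound: "\<bar>dl x\<bar> \<le> 4 / 10^8"
proof -
  have "\<bar>3 * (x * (cos (1/x) - 1)) + sin (1/x)\<bar> \<le> 4"
    using x_cos_bound[of x] abs_sin_le_one[of "1/x"] by linarith
  then show ?thesis unfolding dl_def eps_def by (simp add: abs_mult)
qed

text \<open>Near 0 the function \<open>kap\<close> behaves like
  \<open>- eps * cos (1/x) / x\<close>; this non-integrable singularity is the source of the
  infinite variation. The weight \<open>x\<close> that tames it will be supplied by the
  characteristic speed.\<close>

lemma kap_bound: "x > 0 \<Longrightarrow> x * \<bar>kap x\<bar> \<le> 11 / 10^8 * (1 + x)"
proof -
  assume x: "x > 0"
  have "\<bar>6 * (x * (cos (1/x) - 1)) + 4 * sin (1/x) - cos (1/x) / x\<bar>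
     \<le> 10 + \<bar>cos (1/x) / x\<bar>"
    using x_cos_bound[of x] abs_sin_le_one[of "1/x"] by linarith
  also have "\<dots> \<le> 10 + 1 / x" using x by (simp add: divide_right_mono)
  finally have "x * \<bar>kap x\<bar> \<le> x * (eps * (10 + 1 / x))"
    using x unfolding kap_def eps_def abs_mult by (intro mult_left_mono) auto
  also have "\<dots> = eps * (10 * x + 1)" using x by (simp add: field_simps)
  also have "\<dots> \<le> eps * (11 * (1 + x))" using x by (simp add: eps_def)
  finally show ?thesis by (simp add: eps_def)
qed

definition ee :: "real \<Rightarrow> real" where "ee x = x^2 * sg x"
definition dd :: "real \<Rightarrow> real" where "dd x = x * dl x"

lemma ee_deriv:
  assumes "x > 0"
  shows "(ee has_real_derivative dd x) (at x)"
  unfolding sg_def dl_def ee_def dd_def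
  using assms by (auto intro!: derivative_eq_intros simp: power2_eq_square) (simp add: field_simps)

lemma dd_deriv:
  assumes "x > 0"
  shows "(dd has_real_derivative kap x) (at x)"
  unfolding kap_def dl_def dd_def
  using assms by (auto intro!: derivative_eq_intros simp: power2_eq_square) (simp add: field_simps)

text \<open>\<open>Us\<close> is \<open>v\<^sub>x\<close> and \<open>al\<close> is \<open>- v\<^sub>t\<close>. Their \<open>s\<close>-derivatives are \<open>x pp\<close> and \<open>x\<^sup>2 nn\<close>, so that
  \<open>spd\<close> is the characteristic speed \<open>A\<^sub>u\<close> and \<open>curv\<close> is \<open>A\<^sub>u\<^sub>u\<close>.\<close>

definition Us :: "real \<Rightarrow> real \<Rightarrow> real" where "Us s x = x * s + h s * dd x"
definition al :: "real \<Rightarrow> real \<Rightarrow> real" where "al s x = s^2 * (x^2 / 2 + h1 s * ee x)"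
definition pp :: "real \<Rightarrow> real \<Rightarrow> real" where "pp s x = 1 + h1 s * dl x"
definition nn :: "real \<Rightarrow> real \<Rightarrow> real" where
  "nn s x = s + 2 * s * h1 s * sg x + s^2 * h2 s * sg x"
definition spd :: "real \<Rightarrow> real \<Rightarrow> real" where "spd s x = x * nn s x / pp s x"
definition Ux :: "real \<Rightarrow> real \<Rightarrow> real" where "Ux s x = s + h s * kap x"
definition curv :: "real \<Rightarrow> real \<Rightarrow> real" where
  "curv s x = ((1 + 2 * h1 s * sg x + 4 * (s * h2 s) * sg x + s^2 * h3 s * sg x) * pp s x
     - nn s x * h2 s * dl x) / pp s x ^ 3"

lemma small_prod: "\<bar>a\<bar> \<le> 50000 \<Longrightarrow> \<bar>b\<bar> \<le> 4 / 10^8 \<Longrightarrow> \<bar>a * b\<bar> \<le> 1 / 500" for a b :: real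
  using mult_mono[of "\<bar>a\<bar>" 50000 "\<bar>b\<bar>" "4/10^8"] by (simp add: abs_mult)

lemma sg_bound': "\<bar>sg x\<bar> \<le> 4 / 10^8"
  using sg_bound[of x] by simp

lemma pp_bounds: "\<bar>pp s x - 1\<bar> \<le> 1 / 500"
  unfolding pp_def using small_prod[OF h_bounds(5) dl_bound] by simp

lemma pp_pos: "pp s x > 0"
  using pp_bounds[of s x] by linarith

lemma nn_eq: "nn s x = s * (1 + 2 * (h1 s * sg x) + (s * h2 s) * sg x)"
  by (simp add: nn_def algebra_simps power2_eq_square)

lemma nn_factor: "\<bar>2 * (h1 s * sg x) + (s * h2 s) * sg x\<bar> \<le> 3 / 500"
  using small_prod[OF h_bounds(5) sg_bound', of s x] small_prod[OF h_bounds(8) sg_bound', of s x]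
  by linarith

lemma curv_bounds: "1/2 \<le> curv s x" "curv s x \<le> 2"
proof -
  define z where "z = 2 * h1 s * sg x + 4 * (s * h2 s) * sg x + s^2 * h3 s * sg x"
  have z: "\<bar>z\<bar> \<le> 7 / 500"
    using small_prod[OF h_bounds(5) sg_bound', of s x] small_prod[OF h_bounds(8) sg_bound', of s x]
      small_prod[OF h_bounds(10) sg_bound', of s x]
    unfolding z_def mult.assoc by linarith
  define w where "w = nn s x * h2 s * dl x"
  \<comment> \<open>\<open>nn\<close> grows like \<open>s\<close>; its factor \<open>s\<close> is
    moved to \<open>h2\<close>, since \<open>s * h2 s\<close> is bounded.\<close>
  have "w = (1 + (2 * (h1 s * sg x) + (s * h2 s) * sg x)) * ((s * h2 s) * dl x)"
    by (simp add: w_def nn_eq)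
  also have "\<bar>\<dots>\<bar> \<le> 2 * (1 / 500)"
    unfolding abs_mult[of "1 + _"]
    by (intro mult_mono small_prod h_bounds dl_bound) (use nn_factor[of s x] in linarith)+
  finally have w: "\<bar>w\<bar> \<le> 1 / 250" by simp
  define p where "p = pp s x"
  have p: "499 / 500 \<le> p" "p \<le> 501 / 500" using pp_bounds[of s x] unfolding p_def by linarith+
  have c: "curv s x = ((1 + z) * p - w) / p ^ 3"
    by (simp add: curv_def z_def w_def p_def algebra_simps)
  have "(1 + z) * p \<le> (507 / 500) * (501 / 500)" "(493 / 500) * (499 / 500) \<le> (1 + z) * p"
    using z p by (intro mult_mono; linarith)+
  moreover have "p ^ 3 \<le> (501 / 500) ^ 3" "(499 / 500) ^ 3 \<le> p ^ 3"
    using p by (auto intro!: power_mono)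
  ultimately have "1 / 2 * p ^ 3 \<le> (1 + z) * p - w" "(1 + z) * p - w \<le> 2 * p ^ 3"
    using w by (simp_all add: power3_eq_cube)
  moreover have "p ^ 3 > 0" using p by simp
  ultimately show "1/2 \<le> curv s x" "curv s x \<le> 2"
    unfolding c by (simp_all add: pos_le_divide_eq pos_divide_le_eq)
qed

lemma Us_ds: "((\<lambda>s. Us s x) has_real_derivative x * pp s x) (at s)"
  unfolding Us_def pp_def dd_def
  by (auto intro!: derivative_eq_intros h_deriv simp: algebra_simps)

lemma Us_strict_mono: "x > 0 \<Longrightarrow> s < s' \<Longrightarrow> Us s x < Us s' x"
  by (rule DERIV_pos_imp_increasing[of s s' "\<lambda>s. Us s x"])
     (auto intro!: exI Us_ds simp: pp_pos)

lemma Us_eq: "Us s x = x * (s + h s * dl x)"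
  by (simp add: Us_def dd_def algebra_simps)

lemma h_dl: "\<bar>h s * dl x\<bar> \<le> \<bar>s\<bar> / 500"
proof -
  have "\<bar>h s * dl x\<bar> \<le> (50000 * \<bar>s\<bar>) * (4 / 10^8)"
    unfolding abs_mult by (intro mult_mono h_bounds dl_bound) auto
  then show ?thesis by simp
qed

lemma Us_surj:
  assumes "x > 0" shows "\<exists>s. Us s x = u"
proof -
  \<comment> \<open>The perturbation in \<open>Us\<close> is at most
    \<open>\<bar>s\<bar> / 500\<close> relative to \<open>x\<close>, so at \<open>s = m\<close> and
    \<open>s = - m\<close> the value of \<open>Us\<close> lies beyond
    \<open>x * m / 2 = \<bar>u\<bar>\<close> and its negative.\<close>
  define m where "m = 2 * \<bar>u\<bar> / x"
  have m: "m \<ge> 0" using assms by (simp add: m_def)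
  have "\<bar>u\<bar> = x * (m / 2)" using assms by (simp add: m_def)
  moreover have "m / 2 \<le> m + h m * dl x" "- m + h (- m) * dl x \<le> - (m / 2)"
    using h_dl[of m x] h_dl[of "-m" x] m by linarith+
  then have "x * (m / 2) \<le> Us m x" "Us (- m) x \<le> x * - (m / 2)"
    unfolding Us_eq using assms by (blast intro: mult_left_mono less_imp_le)+
  ultimately have "Us (-m) x \<le> u" "u \<le> Us m x" by auto
  moreover have "continuous_on {-m..m} (\<lambda>s. Us s x)"
    using Us_ds by (meson DERIV_isCont continuous_at_imp_continuous_on)
  ultimately show ?thesis
    using IVT'[of "\<lambda>s. Us s x" "-m" u m] m by auto
qed

section \<open>The flux, by inverting \<open>Us\<close> in the time variable\<close>

definition S :: "real \<Rightarrow> real \<Rightarrow> real" where "S x u = (THE s. Us s x = u)"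

lemma S_Us: "x > 0 \<Longrightarrow> S x (Us s x) = s"
  unfolding S_def using Us_strict_mono[of x] by (intro the_equality refl) (metis less_irrefl neqE)

lemma Us_S: "x > 0 \<Longrightarrow> Us (S x u) x = u"
  using Us_surj[of x u] S_Us by auto

text \<open>\<open>S\<close> takes all real values: only \<open>s\<close> in \<open>(0, 1]\<close>
  corresponds to a time \<open>t \<ge> 0\<close>, but the flux has to be defined for every
  \<open>u\<close>, negative values included.\<close>

definition A :: "real \<Rightarrow> real \<Rightarrow> real" where
  "A x u = (if x \<le> 0 then u^2 / 2 else al (S x u) x)"

lemma A_Us: "x > 0 \<Longrightarrow> A x (Us s x) = al s x"
  by (simp add: A_def S_Us)

lemma Us_has_derivative:
  assumes "x > 0"
  shows "((\<lambda>p. Us (fst p) (snd p)) has_derivative (\<lambda>v. x * pp s x * fst v + Ux s x * snd v)) (at (s, x))"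
proof -
  have "((\<lambda>p. h (fst p)) has_derivative (\<lambda>v. fst v * h1 (fst (s, x)))) (at (s, x))"
    by (rule DERIV_compose_FDERIV[OF h_deriv bounded_linear_imp_has_derivative[OF bounded_linear_fst]])
  moreover have "((\<lambda>p. dd (snd p)) has_derivative (\<lambda>v. snd v * kap (snd (s, x)))) (at (s, x))"
    by (rule DERIV_compose_FDERIV[OF dd_deriv bounded_linear_imp_has_derivative[OF bounded_linear_snd]])
       (use assms in simp)
  ultimately have "((\<lambda>p. snd p * fst p + h (fst p) * dd (snd p)) has_derivative
      (\<lambda>v. (x * fst v + snd v * s) + (h s * (snd v * kap x) + fst v * h1 s * dd x))) (at (s, x))"
    by (auto intro!: has_derivative_add has_derivative_mult[THEN has_derivative_eq_rhs] derivative_eq_intros)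
  then show ?thesis
    unfolding Us_def
    by (rule has_derivative_eq_rhs) (simp add: Ux_def pp_def dd_def fun_eq_iff algebra_simps)
qed

lemma al_has_derivative:
  assumes "x > 0"
  shows "((\<lambda>p. al (fst p) (snd p)) has_derivative
     (\<lambda>v. x^2 * nn s x * fst v + s^2 * x * pp s x * snd v)) (at (s, x))"
proof -
  have "((\<lambda>p. h1 (fst p)) has_derivative (\<lambda>v. fst v * h2 (fst (s, x)))) (at (s, x))"
    by (rule DERIV_compose_FDERIV[OF h1_deriv bounded_linear_imp_has_derivative[OF bounded_linear_fst]])
  moreover have "((\<lambda>p. ee (snd p)) has_derivative (\<lambda>v. snd v * dd (snd (s, x)))) (at (s, x))"
    by (rule DERIV_compose_FDERIV[OF ee_deriv bounded_linear_imp_has_derivative[OF bounded_linear_snd]])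
       (use assms in simp)
  ultimately have "((\<lambda>p. (fst p)^2 * ((snd p)^2 / 2 + h1 (fst p) * ee (snd p))) has_derivative
      (\<lambda>v. s^2 * (x * snd v + (h1 s * (snd v * dd x) + fst v * h2 s * ee x))
         + 2 * s * fst v * (x^2 / 2 + h1 s * ee x))) (at (s, x))"
    by (auto intro!: has_derivative_add has_derivative_mult[THEN has_derivative_eq_rhs] derivative_eq_intros)
  then show ?thesis
    unfolding al_def
    by (rule has_derivative_eq_rhs)
       (simp add: nn_def pp_def dd_def ee_def fun_eq_iff algebra_simps power2_eq_square)
qed

text \<open>The planar map sending \<open>(s, x)\<close> to \<open>(Us s x, x)\<close> is a
  bijection of the half-plane \<open>x > 0\<close> onto itself with invertible derivative. Inverting
  it as a whole, and not separately for each \<open>x\<close>, yields both partial derivatives of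
  \<open>S\<close> together.\<close>

lemma S_has_derivative:
  assumes "x > 0"
  shows "((\<lambda>p. (S (snd p) (fst p), snd p)) has_derivative
     (\<lambda>v. ((fst v - Ux (S x u) x * snd v) / (x * pp (S x u) x), snd v))) (at (u, x))"
proof -
  define s where "s = S x u"
  define f where "f p = (Us (fst p) (snd p), snd p)" for p
  have f: "(f has_derivative (\<lambda>v. (x * pp s x * fst v + Ux s x * snd v, snd v))) (at (s, x))"
    if "x > 0" for s x
    unfolding f_def using Us_has_derivative[OF that]
    by (intro has_derivative_Pair) (auto intro: has_derivative_snd has_derivative_ident)
  have "((\<lambda>p. (S (snd p) (fst p), snd p)) has_derivative
     (\<lambda>v. ((fst v - Ux s x * snd v) / (x * pp s x), snd v))) (at (f (s, x)))"
  proof (rule has_derivative_inverse_strong[where f = f and x = "(s, x)"])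
    show "open ((UNIV :: real set) \<times> {0::real<..})" by (intro open_Times) auto
    have "isCont f p" if "p \<in> (UNIV :: real set) \<times> {0::real<..}" for p
      using f[of "snd p" "fst p"] that has_derivative_continuous by auto
    then show "continuous_on ((UNIV :: real set) \<times> {0::real<..}) f"
      by (simp add: continuous_at_imp_continuous_on)
    show "(f has_derivative (\<lambda>v. (x * pp s x * fst v + Ux s x * snd v, snd v))) (at (s, x))"
      using f[OF assms] .
  qed (use assms pp_pos[of s x] in \<open>auto simp: f_def S_Us fun_eq_iff\<close>)
  moreover have "f (s, x) = (u, x)" using assms by (simp add: f_def s_def Us_S)
  ultimately show ?thesis by (simp add: s_def)
qed

text \<open>The \<open>x\<close>-derivative of the flux at fixed \<open>u\<close>, written in terms
  of \<open>s = S x u\<close>. The first summand is the \<open>x\<close>-derivative of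
  \<open>al\<close> at fixed \<open>s\<close>; the second one comes from the change of
  \<open>s\<close> that keeps \<open>u\<close> fixed, and it contains the singular
  \<open>kap\<close>.\<close>

definition Ax :: "real \<Rightarrow> real \<Rightarrow> real" where
  "Ax s x = s^2 * x * pp s x - spd s x * Ux s x"

lemma A_has_derivative:
  assumes "x > 0"
  shows "((\<lambda>p. A (snd p) (fst p)) has_derivative
     (\<lambda>v. spd (S x u) x * fst v + Ax (S x u) x * snd v)) (at (u, x))"
proof -
  define s where "s = S x u"
  have 1: "((\<lambda>p. al (fst p) (snd p)) has_derivative
     (\<lambda>v. x^2 * nn s x * fst v + s^2 * x * pp s x * snd v)) (at ((\<lambda>p. (S (snd p) (fst p), snd p)) (u, x)))"
    using al_has_derivative[OF assms] by (simp add: s_def)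
  have "((\<lambda>p. al (S (snd p) (fst p)) (snd p)) has_derivative
     (\<lambda>v. spd s x * fst v + Ax s x * snd v)) (at (u, x))"
    using has_derivative_compose[OF S_has_derivative[OF assms] 1] unfolding fst_conv snd_conv
    by (rule has_derivative_eq_rhs)
       (use assms pp_pos[of s x] in \<open>auto simp: fun_eq_iff s_def[symmetric] spd_def Ax_def field_simps power2_eq_square\<close>)
  then show ?thesis unfolding s_def
    by (rule has_derivative_transform_within_open[where s = "UNIV \<times> {0<..}"])
       (use assms in \<open>auto simp: A_def open_Times\<close>)
qed

lemma A_du:
  assumes "x > 0"
  shows "(A x has_real_derivative spd (S x u) x) (at u)"
proof -
  have "((\<lambda>u. (u, x)) has_derivative (\<lambda>v. (v, 0))) (at u)"
    by (auto intro!: derivative_eq_intros)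
  from has_derivative_compose[OF this A_has_derivative[OF assms, of u]]
  show ?thesis by (simp add: has_field_derivative_def)
qed

lemma A_dx:
  assumes "x > 0"
  shows "((\<lambda>x. A x u) has_real_derivative Ax (S x u) x) (at x)"
proof -
  have "((\<lambda>x. (u, x)) has_derivative (\<lambda>v. (0, v))) (at x)"
    by (auto intro!: derivative_eq_intros)
  from has_derivative_compose[OF this A_has_derivative[OF assms, of u]]
  show ?thesis by (simp add: has_field_derivative_def)
qed

lemma S_du:
  assumes "x > 0"
  shows "(S x has_real_derivative 1 / (x * pp (S x u) x)) (at u)"
proof -
  have "((\<lambda>u. (u, x)) has_derivative (\<lambda>v. (v, 0))) (at u)"
    by (auto intro!: derivative_eq_intros)
  from has_derivative_compose[OF this S_has_derivative[OF assms, of u]]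
  have "((\<lambda>u. fst (S x u, x)) has_derivative (\<lambda>v. fst (v / (x * pp (S x u) x), 0::real))) (at u)"
    by (intro has_derivative_fst) simp
  then show ?thesis by (simp add: has_field_derivative_def mult_commute_abs divide_inverse)
qed

lemma spd_ds:
  assumes "x > 0"
  shows "((\<lambda>s. spd s x) has_real_derivative curv s x * (x * pp s x)) (at s)"
proof -
  have "((\<lambda>s. pp s x) has_real_derivative h2 s * dl x) (at s)"
    unfolding pp_def by (auto intro!: derivative_eq_intros h1_deriv)
  moreover have "((\<lambda>s. nn s x) has_real_derivative
      1 + 2 * h1 s * sg x + 4 * (s * h2 s) * sg x + s^2 * h3 s * sg x) (at s)"
    unfolding nn_def by (auto intro!: derivative_eq_intros h1_deriv h2_deriv simp: algebra_simps)
  ultimately have "((\<lambda>s. spd s x) has_real_derivative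
      (x * (1 + 2 * h1 s * sg x + 4 * (s * h2 s) * sg x + s^2 * h3 s * sg x) * pp s x
       - x * nn s x * (h2 s * dl x)) / (pp s x * pp s x)) (at s)"
    unfolding spd_def using pp_pos[of s x]
    by (auto intro!: derivative_eq_intros simp: algebra_simps)
  then show ?thesis
    using pp_pos[of s x]
    by (elim DERIV_cong) (simp add: curv_def field_simps power3_eq_cube)
qed

definition Au :: "real \<Rightarrow> real \<Rightarrow> real" where
  "Au x u = (if x \<le> 0 then u else spd (S x u) x)"
definition Auu :: "real \<Rightarrow> real \<Rightarrow> real" where
  "Auu x u = (if x \<le> 0 then 1 else curv (S x u) x)"

lemma A_deriv: "(A x has_real_derivative Au x u) (at u)"
proof (cases "x \<le> 0")
  case True
  then show ?thesis by (auto simp: A_def[abs_def] Au_def intro!: derivative_eq_intros)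
next
  case False
  then show ?thesis using A_du[of x u] by (simp add: Au_def)
qed

lemma Au_deriv: "(Au x has_real_derivative Auu x u) (at u)"
proof (cases "x \<le> 0")
  case True
  then show ?thesis by (auto simp: Au_def[abs_def] Auu_def intro!: derivative_eq_intros)
next
  case False
  have "((\<lambda>u. spd (S x u) x) has_real_derivative curv (S x u) x * (x * pp (S x u) x) * (1 / (x * pp (S x u) x))) (at u)"
    by (rule DERIV_chain2[OF spd_ds S_du]) (use False in auto)
  then show ?thesis using False pp_pos[of "S x u" x] by (simp add: Au_def[abs_def] Auu_def)
qed

lemma Auu_bounds: "1/2 \<le> Auu x u" "Auu x u \<le> 2"
  using curv_bounds by (auto simp: Auu_def)

lemma S_zero: "x > 0 \<Longrightarrow> S x 0 = 0"
  using S_Us[of x 0] by (simp add: Us_def h_def)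

lemma A_zero: "A x 0 = 0" "Au x 0 = 0"
  by (auto simp: A_def Au_def S_zero al_def spd_def nn_def)

section \<open>Uniform convexity, growth and monotone branches of the flux\<close>

lemma MVT_weak:
  fixes f :: "real \<Rightarrow> real"
  assumes "\<And>z. (f has_real_derivative f' z) (at z)" "a \<le> b"
  shows "\<exists>z. a \<le> z \<and> z \<le> b \<and> f b - f a = (b - a) * f' z"
proof (cases "a = b")
  case False
  then show ?thesis using MVT2[of a b f f'] assms by (metis less_imp_le order_less_le)
qed auto

lemma Au_diff:
  assumes "u \<le> v"
  shows "(v - u) / 2 \<le> Au x v - Au x u" "Au x v - Au x u \<le> 2 * (v - u)"
proof -
  obtain z where "Au x v - Au x u = (v - u) * Auu x z"
    using MVT_weak[OF Au_deriv assms] by blast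
  then show "(v - u) / 2 \<le> Au x v - Au x u" "Au x v - Au x u \<le> 2 * (v - u)"
    using mult_left_mono[OF Auu_bounds(1)[of x z], of "v - u"]
      mult_left_mono[OF Auu_bounds(2)[of x z], of "v - u"] assms by (auto simp: mult.commute)
qed

lemma Au_bounds: "0 \<le> u \<Longrightarrow> u / 2 \<le> Au x u" "0 \<le> u \<Longrightarrow> Au x u \<le> 2 * u"
  "u \<le> 0 \<Longrightarrow> 2 * u \<le> Au x u" "u \<le> 0 \<Longrightarrow> Au x u \<le> u / 2"
  using Au_diff[of 0 u x] Au_diff[of u 0 x] by (auto simp: A_zero)

lemma Au_abs: "\<bar>Au x u\<bar> \<le> 2 * \<bar>u\<bar>"
  using Au_bounds[of u x] by (cases "u \<ge> 0") auto

lemma A_tangent: "A x v + Au x v * (u - v) \<le> A x u"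
proof -
  have *: "\<exists>z. a \<le> z \<and> z \<le> b \<and> A x b - A x a = (b - a) * Au x z" if "a \<le> b" for a b
    using MVT_weak[OF A_deriv that] .
  show ?thesis
  proof (cases "v \<le> u")
    case True
    then obtain z where "v \<le> z" "A x u - A x v = (u - v) * Au x z" using *[of v u] by auto
    moreover have "(u - v) * Au x v \<le> (u - v) * Au x z"
      using Au_diff(1)[of v z x] True \<open>v \<le> z\<close> by (intro mult_left_mono) auto
    ultimately show ?thesis by (simp add: mult.commute)
  next
    case False
    then obtain z where "z \<le> v" "A x v - A x u = (v - u) * Au x z" using *[of u v] by auto
    moreover have "(v - u) * Au x z \<le> (v - u) * Au x v"
      using Au_diff(1)[of z v x] False \<open>z \<le> v\<close> by (intro mult_left_mono) auto
    ultimately show ?thesis by (simp add: algebra_simps)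
  qed
qed

lemma A_Lipschitz:
  assumes "\<bar>u\<bar> \<le> R" "\<bar>v\<bar> \<le> R"
  shows "\<bar>A x u - A x v\<bar> \<le> 2 * R * \<bar>u - v\<bar>"
proof -
  have "norm (A x u - A x v) \<le> 2 * R * norm (u - v)"
  proof (rule field_differentiable_bound[of "{-R..R}" _ "Au x"])
    fix z assume "z \<in> {-R..R}"
    then show "norm (Au x z) \<le> 2 * R" using Au_abs[of x z] by auto
  qed (use assms A_deriv in \<open>auto intro: has_field_derivative_at_within\<close>)
  then show ?thesis by simp
qed

lemma convex_min_nonneg:
  fixes f :: "real \<Rightarrow> real"
  assumes "\<And>z. (f has_real_derivative f' z) (at z)" "f 0 = 0" "\<And>z. 0 \<le> f' z * z"
  shows "0 \<le> f u"
proof (cases "0 \<le> u")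
  case True
  show ?thesis
  proof (cases "u = 0")
    case False
    then obtain z where "0 < z" "f u = u * f' z" using MVT2[of 0 u f f'] assms(1,2) True by auto
    then show ?thesis using True assms(3)[of z] by (auto simp: zero_le_mult_iff)
  qed (simp add: assms(2))
next
  case False
  then obtain z where z: "u < z" "z < 0" "0 - f u = - u * f' z"
    using MVT2[of u 0 f f'] assms(1,2) by auto
  then show ?thesis using False assms(3)[of z] by (auto simp: zero_le_mult_iff mult_le_0_iff)
qed

lemma A_lower: "u^2 / 4 \<le> A x u"
proof -
  have D: "((\<lambda>u. A x u - u^2 / 4) has_real_derivative Au x z - z / 2) (at z)" for z
    by (auto intro!: derivative_eq_intros A_deriv)
  have "0 \<le> (Au x z - z / 2) * z" for z
    using Au_bounds(1,4)[of z x] by (cases "0 \<le> z") (auto simp: zero_le_mult_iff)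
  from convex_min_nonneg[OF D _ this, of u] show ?thesis by (simp add: A_zero)
qed

lemma A_upper: "A x u \<le> u^2"
proof -
  have D: "((\<lambda>u. u^2 - A x u) has_real_derivative 2 * z - Au x z) (at z)" for z
    by (auto intro!: derivative_eq_intros A_deriv)
  have "0 \<le> (2 * z - Au x z) * z" for z
    using Au_bounds(2,3)[of z x] by (cases "0 \<le> z") (auto simp: zero_le_mult_iff)
  from convex_min_nonneg[OF D _ this, of u] show ?thesis by (simp add: A_zero)
qed

lemma A_nonneg: "0 \<le> A x u"
  using A_lower[of u x] zero_le_power2[of u] by linarith

lemma A_continuous_u: "continuous_on T (A x)"
  by (intro continuous_at_imp_continuous_on ballI DERIV_isCont[OF A_deriv])

lemma A_strict_mono:
  assumes "0 \<le> u" "u < v" shows "A x u < A x v"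
proof -
  obtain z where z: "u < z" "A x v - A x u = (v - u) * Au x z"
    using MVT2[OF assms(2), of "A x" "Au x"] A_deriv by auto
  then have "0 < Au x z" using Au_bounds(1)[of z x] assms by linarith
  with assms z mult_pos_pos[of "v - u" "Au x z"] show ?thesis by linarith
qed

lemma A_strict_antimono:
  assumes "v \<le> 0" "u < v" shows "A x v < A x u"
proof -
  obtain z where z: "z < v" "A x v - A x u = (v - u) * Au x z"
    using MVT2[OF assms(2), of "A x" "Au x"] A_deriv by auto
  then have "Au x z < 0" using Au_bounds(4)[of z x] assms by linarith
  with assms z mult_pos_neg[of "v - u" "Au x z"] show ?thesis by linarith
qed

lemma A_continuous: "continuous_on ((- {0}) \<times> UNIV) (\<lambda>(x, u). A x u)"
proof -
  have "isCont (\<lambda>p. A (fst p) (snd p)) (x, u)" if "x > 0" for x u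
  proof -
    have "isCont (\<lambda>q::real \<times> real. (snd q, fst q)) (x, u)"
      by (intro continuous_intros)
    moreover have "isCont (\<lambda>p. A (snd p) (fst p)) (snd (x, u), fst (x, u))"
      using has_derivative_continuous[OF A_has_derivative[OF that]] by simp
    ultimately show ?thesis
      using isCont_o2[of "(x, u)" "\<lambda>q. (snd q, fst q)" "\<lambda>p. A (snd p) (fst p)"] by simp
  qed
  then have "continuous_on ({0<..} \<times> UNIV) (\<lambda>(x, u). A x u)"
    unfolding case_prod_beta by (intro continuous_at_imp_continuous_on) auto
  moreover have "continuous_on ({..<0} \<times> UNIV) (\<lambda>(x, u). A x u)"
  proof -
    have "continuous_on ({..<0::real} \<times> (UNIV::real set)) (\<lambda>p. (snd p)^2 / 2)"
      by (auto intro!: continuous_intros)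
    then show ?thesis
      by (rule continuous_on_eq) (auto simp: A_def)
  qed
  moreover have "(- {0::real}) \<times> (UNIV::real set) = {0<..} \<times> UNIV \<union> {..<0} \<times> UNIV"
    by auto
  ultimately show ?thesis
    by (simp only:) (intro continuous_on_open_Un open_Times open_UNIV open_greaterThan open_lessThan)
qed

section \<open>Dependence of the flux on the space variable\<close>

lemma Ax_bound_aux:
  assumes x: "x > 0" and T: "\<bar>s^2 * h1 s\<bar> \<le> 50000 * T" "\<bar>s^3 * h2 s\<bar> \<le> 50000 * T" "\<bar>s * h s\<bar> \<le> 50000 * T"
  shows "\<bar>Ax s x\<bar> \<le> T * (1 + x)"
proof -
  have T0: "T \<ge> 0" using T(1) abs_ge_zero[of "s^2 * h1 s"] by linarith
  define \<nu> where "\<nu> = 2 * (h1 s * sg x) + (s * h2 s) * sg x"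
  have \<nu>: "\<bar>\<nu>\<bar> \<le> 1" using nn_factor[of s x] by (simp add: \<nu>_def)
  have prod: "\<bar>a * b\<bar> \<le> T / 500" if "\<bar>a\<bar> \<le> 50000 * T" "\<bar>b\<bar> \<le> 4 / 10^8" for a b
  proof -
    have "\<bar>a\<bar> * \<bar>b\<bar> \<le> (50000 * T) * (4 / 10^8)" using that T0 by (intro mult_mono) auto
    then show ?thesis by (simp add: abs_mult)
  qed
  have "Ax s x * pp s x = x * (s^2 * (pp s x)^2 - nn s x * Ux s x)"
    using pp_pos[of s x] by (simp add: Ax_def spd_def field_simps power2_eq_square)
  \<comment> \<open>The unperturbed terms \<open>s^2\<close> cancel, as the Burgers flux does not
    depend on \<open>x\<close>. Every remaining term has a factor \<open>dl\<close>,
    \<open>sg\<close> or \<open>kap\<close>, and \<open>kap\<close> will only meet the factor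
    \<open>x\<close> in front.\<close>
  also have "s^2 * (pp s x)^2 - nn s x * Ux s x =
      ((s^2 * h1 s) * dl x) * (1 + pp s x) - 2 * ((s^2 * h1 s) * sg x) - (s^3 * h2 s) * sg x
        - (s * h s) * kap x * (1 + \<nu>)"
    by (simp add: nn_eq pp_def Ux_def \<nu>_def algebra_simps power2_eq_square power3_eq_cube)
  finally have E: "Ax s x * pp s x = x * (((s^2 * h1 s) * dl x) * (1 + pp s x)
     - 2 * ((s^2 * h1 s) * sg x) - (s^3 * h2 s) * sg x) - (s * h s) * (x * kap x) * (1 + \<nu>)"
    by (simp add: algebra_simps)
  have "\<bar>((s^2 * h1 s) * dl x) * (1 + pp s x)\<bar> \<le> T / 500 * 3"
    unfolding abs_mult[of _ "1 + pp s x"] using pp_bounds[of s x] T0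
    by (intro mult_mono prod T dl_bound; linarith)
  moreover have "\<bar>(s^2 * h1 s) * sg x\<bar> \<le> T / 500" "\<bar>(s^3 * h2 s) * sg x\<bar> \<le> T / 500"
    by (intro prod T sg_bound')+
  ultimately have 1: "\<bar>((s^2 * h1 s) * dl x) * (1 + pp s x)
     - 2 * ((s^2 * h1 s) * sg x) - (s^3 * h2 s) * sg x\<bar> \<le> T / 50"
    using T0 by linarith
  have "\<bar>(s * h s) * (x * kap x)\<bar> \<le> (50000 * T) * (11 / 10^8 * (1 + x))"
    unfolding abs_mult[of "s * h s"] using T0 kap_bound[OF x] x
    by (intro mult_mono T) (auto simp: abs_mult)
  then have "\<bar>(s * h s) * (x * kap x) * (1 + \<nu>)\<bar> \<le> (50000 * T) * (11 / 10^8 * (1 + x)) * 2"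
    unfolding abs_mult[of _ "1 + \<nu>"] using \<nu> T0 x by (intro mult_mono) auto
  moreover have "\<bar>x * (((s^2 * h1 s) * dl x) * (1 + pp s x)
     - 2 * ((s^2 * h1 s) * sg x) - (s^3 * h2 s) * sg x)\<bar> \<le> x * (T / 50)"
    unfolding abs_mult[of x] using x 1 by (intro mult_mono) auto
  ultimately have "\<bar>Ax s x * pp s x\<bar> \<le> x * (T / 50) + (50000 * T) * (11 / 10^8 * (1 + x)) * 2"
    unfolding E by linarith
  also have "\<dots> \<le> T * (1 + x) * (1 / 2)"
  proof -
    have "0 \<le> T * x" using T0 x by simp
    then show ?thesis using T0 by (simp add: algebra_simps add_divide_distrib)
  qed
  also have "\<dots> \<le> T * (1 + x) * pp s x"
    using pp_bounds[of s x] T0 x by (intro mult_left_mono) (linarith, simp)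
  finally show ?thesis
    using pp_pos[of s x] by (simp add: abs_mult)
qed

lemma Us_lower: "x > 0 \<Longrightarrow> x * \<bar>s\<bar> \<le> 2 * \<bar>Us s x\<bar>"
proof -
  assume x: "x > 0"
  have "\<bar>s\<bar> \<le> \<bar>s + h s * dl x\<bar> + \<bar>h s * dl x\<bar>" by linarith
  moreover have "r \<le> 2 * a" if "r \<le> a + b" "b \<le> r / 500" "0 \<le> a" for a b r :: real
    using that by linarith
  ultimately have "\<bar>s\<bar> \<le> 2 * \<bar>s + h s * dl x\<bar>"
    using h_dl[of s x] abs_ge_zero by blast
  then have "x * \<bar>s\<bar> \<le> x * (2 * \<bar>s + h s * dl x\<bar>)" using x by (intro mult_left_mono) auto
  then show ?thesis using x by (simp add: Us_eq abs_mult)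
qed

text \<open>The target \<open>inverse (1 + x^2)\<close> is the derivative of \<open>arctan\<close>.
  For \<open>x \<le> 1\<close> a constant bound is enough, with \<open>T = 1\<close>. For
  \<open>x > 1\<close> the choice \<open>T = \<bar>s\<bar> ^ 3\<close> is available because of the
  double zero of \<open>h\<close>, and \<open>x * \<bar>s\<bar> \<le> 2 * \<bar>u\<bar>\<close>
  turns \<open>\<bar>s\<bar> ^ 3 * (1 + x)\<close> into a multiple of
  \<open>\<bar>u\<bar> ^ 3 / x^2\<close>.\<close>

lemma Ax_bound:
  assumes x: "x > 0"
  shows "\<bar>Ax (S x u) x\<bar> \<le> 32 * (1 + \<bar>u\<bar> ^ 3) * inverse (1 + x^2)"
proof -
  define s where "s = S x u"
  have su: "x * \<bar>s\<bar> \<le> 2 * \<bar>u\<bar>" using Us_lower[OF x, of s] x by (simp add: s_def Us_S)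
  have "0 \<le> \<bar>u\<bar> ^ 3" by simp
  have "\<bar>Ax s x\<bar> * (1 + x^2) \<le> 32 * (1 + \<bar>u\<bar> ^ 3)"
  proof (cases "x \<le> 1")
    case True
    have "\<bar>Ax s x\<bar> \<le> 1 * (1 + x)" by (rule Ax_bound_aux[OF x]) (use h_bounds in simp_all)
    then have "\<bar>Ax s x\<bar> * (1 + x^2) \<le> 2 * 2"
      using True x by (intro mult_mono) (auto simp: power_le_one)
    also have "\<dots> \<le> 32 * (1 + \<bar>u\<bar> ^ 3)" using \<open>0 \<le> \<bar>u\<bar> ^ 3\<close> by simp
    finally show ?thesis .
  next
    case False
    have "\<bar>Ax s x\<bar> \<le> \<bar>s\<bar> ^ 3 * (1 + x)"
    proof (rule Ax_bound_aux[OF x])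
      have "\<bar>s^2 * h1 s\<bar> \<le> \<bar>s\<bar>^2 * (50000 * \<bar>s\<bar>)" "\<bar>s^3 * h2 s\<bar> \<le> \<bar>s\<bar>^3 * 50000" "\<bar>s * h s\<bar> \<le> \<bar>s\<bar> * (50000 * s^2)"
        unfolding abs_mult power_abs by (intro mult_left_mono h_bounds; simp)+
      then show "\<bar>s^2 * h1 s\<bar> \<le> 50000 * \<bar>s\<bar>^3" "\<bar>s^3 * h2 s\<bar> \<le> 50000 * \<bar>s\<bar>^3" "\<bar>s * h s\<bar> \<le> 50000 * \<bar>s\<bar>^3"
        by (simp_all add: power2_eq_square power3_eq_cube abs_mult algebra_simps)
    qed
    then have "\<bar>Ax s x\<bar> * (1 + x^2) \<le> (\<bar>s\<bar> ^ 3 * (2 * x)) * (2 * x^2)"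
      using False x by (intro mult_mono) (auto intro!: mult_left_mono order_trans[OF _ mult_left_mono[of _ "2 * x"]])
    also have "\<dots> = 4 * (x * \<bar>s\<bar>) ^ 3" by (simp add: power2_eq_square power3_eq_cube)
    also have "\<dots> \<le> 4 * (2 * \<bar>u\<bar>) ^ 3" using su x by (intro mult_left_mono power_mono) auto
    also have "\<dots> = 32 * \<bar>u\<bar> ^ 3" by (simp add: power3_eq_cube)
    finally show ?thesis by simp
  qed
  moreover have "0 < 1 + x^2" by (simp add: add_pos_nonneg)
  ultimately show ?thesis by (simp add: s_def field_simps)
qed

text \<open>With \<open>u = Us s x\<close>, both \<open>al s x\<close> and \<open>u^2 / 2\<close>
  have the leading term \<open>s^2 * x^2 / 2\<close>; the rest is \<open>x^2\<close> times bounded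
  products. For each fixed \<open>u\<close> this glues the flux on \<open>x > 0\<close> continuously
  to the Burgers flux.\<close>

lemma A_near_0:
  assumes "x > 0"
  shows "\<bar>A x u - u^2 / 2\<bar> \<le> x^2"
proof -
  define s where "s = S x u"
  have u: "u = Us s x" and A: "A x u = al s x" using assms by (simp_all add: s_def Us_S A_def)
  \<comment> \<open>One factor \<open>h\<close> is traded for \<open>50000 * \<bar>s\<bar>\<close>,
    which leaves the bounded product \<open>s * h s\<close>.\<close>
  have "\<bar>h s * h s\<bar> \<le> \<bar>h s\<bar> * (50000 * \<bar>s\<bar>)"
    unfolding abs_mult by (intro mult_left_mono h_bounds) auto
  also have "\<dots> = 50000 * \<bar>s * h s\<bar>" by (simp add: abs_mult)
  also have "\<dots> \<le> 50000 * 50000" by (intro mult_left_mono h_bounds) auto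
  finally have "\<bar>h s * h s\<bar> * \<bar>dl x * dl x\<bar> \<le> (50000 * 50000) * (4 / 10^8 * (4 / 10^8))"
    unfolding abs_mult[of "dl x"] by (intro mult_mono dl_bound) auto
  then have "\<bar>(h s * h s) * (dl x * dl x)\<bar> \<le> 1 / 2" by (simp add: abs_mult)
  moreover have "\<bar>(s^2 * h1 s) * sg x\<bar> \<le> 1 / 500" "\<bar>(s * h s) * dl x\<bar> \<le> 1 / 500"
    by (intro small_prod h_bounds sg_bound' dl_bound)+
  ultimately have "\<bar>(s^2 * h1 s) * sg x - (s * h s) * dl x - ((h s * h s) * (dl x * dl x)) / 2\<bar> \<le> 1"
    by linarith
  moreover have "A x u - u^2 / 2 = x^2 * ((s^2 * h1 s) * sg x - (s * h s) * dl x - ((h s * h s) * (dl x * dl x)) / 2)"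
    unfolding A unfolding u al_def Us_def ee_def dd_def by (simp add: field_simps power2_eq_square)
  ultimately show ?thesis by (simp add: abs_mult mult_left_le)
qed

lemma A_continuous_x: "continuous_on {0..} (\<lambda>x. A x u)"
proof -
  have "continuous (at x within {0..}) (\<lambda>x. A x u)" if "x \<ge> 0" for x
  proof (cases "x = 0")
    case True
    have "((\<lambda>x. A x u - u^2 / 2) \<longlongrightarrow> 0) (at 0 within {0..})"
    proof (rule Lim_null_comparison)
      show "\<forall>\<^sub>F x in at 0 within {0..}. norm (A x u - u^2 / 2) \<le> x^2"
        using A_near_0 by (auto simp: eventually_at_filter)
      have "((\<lambda>x::real. x^2) \<longlongrightarrow> 0^2) (at 0 within {0..})" by (intro tendsto_intros)
      then show "((\<lambda>x::real. x^2) \<longlongrightarrow> 0) (at 0 within {0..})" by simp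
    qed
    then have "((\<lambda>x. A x u) \<longlongrightarrow> u^2 / 2) (at 0 within {0..})" by (simp add: LIM_zero_cancel)
    then show ?thesis using True by (simp add: continuous_within A_def)
  next
    case False
    then show ?thesis
      using A_dx[of x u] that by (simp add: DERIV_isCont continuous_at_imp_continuous_within)
  qed
  then show ?thesis by (simp add: continuous_on_eq_continuous_within)
qed

definition aa :: "real \<Rightarrow> real" where "aa x = arctan (max 0 x)"

text \<open>Both \<open>c * arctan - A\<close> and \<open>c * arctan + A\<close> increase in
  \<open>x\<close>. Their derivatives are taken in the open interval only, so the endpoint 0 enters
  through continuity. On \<open>x \<le> 0\<close> the flux is independent of \<open>x\<close>, and
  \<open>aa\<close> is frozen there accordingly.\<close>

lemma A_variation: "\<bar>A x u - A y u\<bar> \<le> 32 * (1 + \<bar>u\<bar> ^ 3) * \<bar>aa x - aa y\<bar>"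
proof -
  define c where "c = 32 * (1 + \<bar>u\<bar> ^ 3)"
  have *: "\<bar>A x u - A y u\<bar> \<le> c * (arctan y - arctan x)" if "0 \<le> x" "x \<le> y" for x y
  proof -
    have cont: "continuous_on {x..y} (\<lambda>x. A x u)"
      by (rule continuous_on_subset[OF A_continuous_x]) (use that in auto)
    have b: "\<bar>Ax (S z u) z\<bar> \<le> c * inverse (1 + z^2)" if "x < z" for z
      using Ax_bound[of z u] that \<open>0 \<le> x\<close> by (simp add: c_def)
    have D: "((\<lambda>z. c * arctan z) has_real_derivative c * inverse (1 + z^2)) (at z)" for z
      by (auto intro!: derivative_eq_intros)
    have "c * arctan x - A x u \<le> c * arctan y - A y u"
    proof (rule DERIV_nonneg_imp_increasing_open[OF \<open>x \<le> y\<close>])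
      fix z assume z: "x < z" "z < y"
      show "\<exists>d. ((\<lambda>z. c * arctan z - A z u) has_real_derivative d) (at z) \<and> 0 \<le> d"
        using b[OF z(1)] that z
        by (intro exI[of _ "c * inverse (1 + z^2) - Ax (S z u) z"] conjI DERIV_diff D A_dx) auto
    qed (auto intro!: continuous_intros cont)
    moreover have "c * arctan x + A x u \<le> c * arctan y + A y u"
    proof (rule DERIV_nonneg_imp_increasing_open[OF \<open>x \<le> y\<close>])
      fix z assume z: "x < z" "z < y"
      show "\<exists>d. ((\<lambda>z. c * arctan z + A z u) has_real_derivative d) (at z) \<and> 0 \<le> d"
        using b[OF z(1)] that z
        by (intro exI[of _ "c * inverse (1 + z^2) + Ax (S z u) z"] conjI DERIV_add D A_dx) auto
    qed (auto intro!: continuous_intros cont)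
    ultimately show ?thesis unfolding right_diff_distrib by linarith
  qed
  have A0: "A x u = A (max 0 x) u" for x by (simp add: A_def max_def)
  have "\<bar>A x u - A y u\<bar> \<le> c * \<bar>aa x - aa y\<bar>" if "x \<le> y" for x y
  proof -
    have "max 0 x \<le> max 0 y" using that by auto
    then have "\<bar>A x u - A y u\<bar> \<le> c * (aa y - aa x)" "aa x \<le> aa y"
      using *[of "max 0 x" "max 0 y"] A0[of x] A0[of y] by (simp_all add: aa_def arctan_le_iff)
    then show ?thesis by (simp add: abs_minus_commute)
  qed
  from this[of x y] this[of y x] show ?thesis
    unfolding c_def[symmetric] abs_minus_commute[of "aa y"] abs_minus_commute[of "A y u"]
    by (cases "x \<le> y") simp_all
qed

section \<open>Bounded variation and the structural assumptions\<close>

lemma BV_dominated: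
  assumes "mono a" "\<And>x. \<bar>a x\<bar> \<le> M" "\<And>x y. \<bar>f x - f y\<bar> \<le> \<bar>a x - a y\<bar>"
  shows "f \<in> BV"
proof -
  have "(\<Sum>i<n. ennreal \<bar>f (s (Suc i)) - f (s i)\<bar>) \<le> ennreal (2 * M)" if "mono s" for n and s :: "nat \<Rightarrow> real"
  proof -
    have "(\<Sum>i<n. \<bar>f (s (Suc i)) - f (s i)\<bar>) \<le> (\<Sum>i<n. a (s (Suc i)) - a (s i))"
      using assms(3) assms(1) that by (intro sum_mono) (metis abs_of_nonneg diff_ge_0_iff_ge le_Suc_eq monoD order_refl)
    also have "\<dots> = a (s n) - a (s 0)" by (rule sum_lessThan_telescope)
    also have "\<dots> \<le> 2 * M" using assms(2)[of "s n"] assms(2)[of "s 0"] by linarith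
    finally show ?thesis by (simp add: ennreal_leI)
  qed
  then have "total_variation f \<le> ennreal (2 * M)"
    unfolding total_variation_def by (intro SUP_least) auto
  then show ?thesis unfolding BV_def by (simp add: le_less_trans[OF _ ennreal_less_top])
qed

lemma aa_mono: "mono aa"
  by (auto simp: mono_def aa_def arctan_le_iff)

lemma aa_bound: "\<bar>aa x\<bar> \<le> 2"
  unfolding aa_def using arctan_lbound[of "max 0 x"] arctan_ubound[of "max 0 x"] pi_half_less_two
  by (simp add: abs_le_iff)

text \<open>For every \<open>x\<close> the flux vanishes at \<open>u = 0\<close> only, so both
  endpoints of its zero set are the constant 0. The point 0, where the two formulas for the flux
  meet, is taken as the exceptional set.\<close>

lemma flux_conditions:
  "flux_A1 A {0}" "flux_A2 A" "flux_A3 A {0} (\<lambda>_. 0) (\<lambda>_. 0)" "flux_B1 A" "flux_B2 A" "flux_B3 A"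
  "flux_B4 (\<lambda>_. 0) (\<lambda>_. 0)" "flux_uu_in A (1/2) 2"
proof -
  show "flux_A1 A {0}" unfolding flux_A1_def using A_continuous by simp
  show "flux_A2 A" unfolding flux_A2_def
    by (rule exI[of _ "\<lambda>R. 2 * R"])
       (auto intro!: AE_I2 A_Lipschitz bounded_linear_image bounded_linear_mult_right
          intro: compact_imp_bounded)
  show "flux_A3 A {0} (\<lambda>_. 0) (\<lambda>_. 0)" unfolding flux_A3_def
    using A_strict_mono A_strict_antimono A_zero(1) A_strict_mono[of 0] A_strict_antimono[of 0]
    by (auto simp: monotone_on_def) (metis less_irrefl linorder_neqE_linordered_idom order_refl)+
  show "flux_B1 A" unfolding flux_B1_def
    using BV_dominated[OF aa_mono aa_bound, of aa] A_variation
    by (intro exI[of _ "\<lambda>u. 32 * (1 + \<bar>u\<bar> ^ 3)"] exI[of _ aa]) (auto intro!: continuous_intros)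
  show "flux_B2 A" unfolding flux_B2_def
    using Auu_bounds(1) by (auto intro!: f''_ge0_imp_convex A_deriv Au_deriv order_trans[OF _ Auu_bounds(1)])
  have c: "convex_on UNIV (\<lambda>u::real. u^2)" by (rule convex_power2)
  have "filterlim (\<lambda>r::real. 1 / 4 * r^2) at_top at_top"
    by (rule filterlim_tendsto_pos_mult_at_top[OF tendsto_const])
       (auto intro!: filterlim_pow_at_top filterlim_ident)
  from filterlim_compose[OF this filterlim_norm_at_top[where ?'a = real]]
  have "filterlim (\<lambda>u::real. u^2 / 4) at_top at_infinity"
    by simp
  then show "flux_B3 A" unfolding flux_B3_def
    using A_lower A_upper A_nonneg c convex_on_cdiv[OF _ c, of 4]
    by (intro exI[of _ "\<lambda>u. u^2 / 4"] exI[of _ "\<lambda>u. u^2"]) auto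
  show "flux_B4 (\<lambda>_. 0) (\<lambda>_. 0)" unfolding flux_B4_def
    using BV_dominated[OF aa_mono aa_bound, of "\<lambda>_. 0"] by simp
  show "flux_uu_in A (1/2) 2" unfolding flux_uu_in_def
    using A_deriv Au_deriv Auu_bounds by (intro exI[of _ Au] exI[of _ Auu]) auto
qed

section \<open>The solution\<close>

abbreviation dt :: "(real \<times> real \<Rightarrow> real) \<Rightarrow> real \<Rightarrow> real \<Rightarrow> real" where
  "dt \<phi> t x \<equiv> deriv (\<lambda>s. \<phi> (s, x)) t"
abbreviation dx :: "(real \<times> real \<Rightarrow> real) \<Rightarrow> real \<Rightarrow> real \<Rightarrow> real" where
  "dx \<phi> t x \<equiv> deriv (\<lambda>y. \<phi> (t, y)) x"

lemma test_function_basic: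
  assumes "\<phi> \<in> test_functions"
  shows "continuous_on UNIV \<phi>"
    "((\<lambda>s. \<phi> (s, x)) has_real_derivative dt \<phi> t x) (at t)"
    "((\<lambda>y. \<phi> (t, y)) has_real_derivative dx \<phi> t x) (at x)"
    "continuous_on UNIV (\<lambda>(t, x). dt \<phi> t x)"
    "continuous_on UNIV (\<lambda>(t, x). dx \<phi> t x)"
proof -
  have "Ck 0 \<phi>" "Ck (Suc 0) \<phi>" using assms by (auto simp: test_functions_def simp del: Ck.simps)
  then obtain f' where f': "\<And>p. (\<phi> has_derivative f' p) (at p)"
    and c: "\<And>b. b \<in> Basis \<Longrightarrow> continuous_on UNIV (\<lambda>p. f' p b)" by auto
  show "continuous_on UNIV \<phi>" using \<open>Ck 0 \<phi>\<close> by simp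
  have lin: "f' p (v * b, v * c) = v * f' p (b, c)" for p v b c
    using linear_cmul[OF has_derivative_linear[OF f'[of p]], of v "(b, c)"] by simp
  have lin1: "f' p (v, 0) = f' p (1, 0) * v" "f' p (0, v) = f' p (0, 1) * v" for p v
    unfolding mult.commute[of _ v] lin[symmetric] by simp_all
  have lin0: "(\<lambda>v. f' p (v, 0)) = (*) (f' p (1, 0))" "(\<lambda>v. f' p (0, v)) = (*) (f' p (0, 1))" for p
    by (rule ext, rule lin1)+
  have t: "((\<lambda>s. \<phi> (s, x)) has_real_derivative f' (t, x) (1, 0)) (at t)" for t x
  proof -
    have "((\<lambda>s. (s, x)) has_derivative (\<lambda>v. (v, 0))) (at t)"
      by (auto intro!: derivative_eq_intros)
    from has_derivative_compose[OF this f'] show ?thesis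
      unfolding has_field_derivative_def lin0 .
  qed
  have x: "((\<lambda>y. \<phi> (t, y)) has_real_derivative f' (t, x) (0, 1)) (at x)" for t x
  proof -
    have "((\<lambda>y. (t, y)) has_derivative (\<lambda>v. (0, v))) (at x)"
      by (auto intro!: derivative_eq_intros)
    from has_derivative_compose[OF this f'] show ?thesis
      unfolding has_field_derivative_def lin0 .
  qed
  show "((\<lambda>s. \<phi> (s, x)) has_real_derivative dt \<phi> t x) (at t)"
    "((\<lambda>y. \<phi> (t, y)) has_real_derivative dx \<phi> t x) (at x)"
    using DERIV_imp_deriv[OF t] DERIV_imp_deriv[OF x] t x by simp_all
  have "(1, 0) \<in> (Basis :: (real \<times> real) set)" "(0, 1) \<in> (Basis :: (real \<times> real) set)"
    by (auto simp: Basis_prod_def)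
  from c[OF this(1)] c[OF this(2)]
  show "continuous_on UNIV (\<lambda>(t, x). dt \<phi> t x)"
    "continuous_on UNIV (\<lambda>(t, x). dx \<phi> t x)"
    using DERIV_imp_deriv[OF t] DERIV_imp_deriv[OF x] by (simp_all add: case_prod_beta)
qed

lemma test_function_support:
  assumes "\<phi> \<in> test_functions"
  obtains R B where "0 < R" "0 \<le> B"
    "\<And>t x. \<bar>t\<bar> > R \<or> \<bar>x\<bar> > R \<Longrightarrow>
      \<phi> (t, x) = 0 \<and> dt \<phi> t x = 0 \<and> dx \<phi> t x = 0"
    "\<And>t x. \<bar>\<phi> (t, x)\<bar> \<le> B \<and> \<bar>dt \<phi> t x\<bar> \<le> B \<and> \<bar>dx \<phi> t x\<bar> \<le> B"
proof -
  note basic = test_function_basic[OF assms]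
  define N where "N = - closure {p. \<phi> p \<noteq> 0}"
  have oN: "open N" by (simp add: N_def open_Compl)
  have z: "\<phi> p = 0" if "p \<in> N" for p
    using that closure_subset[of "{p. \<phi> p \<noteq> 0}"] by (auto simp: N_def)
  obtain R where R: "0 < R" "\<And>p. p \<notin> N \<Longrightarrow> norm p \<le> R"
  proof -
    have "bounded (closure {p. \<phi> p \<noteq> 0})"
      using assms compact_imp_bounded by (auto simp: test_functions_def)
    then show ?thesis using that unfolding bounded_pos N_def by auto
  qed
  have out: "\<phi> (t, x) = 0 \<and> dt \<phi> t x = 0 \<and> dx \<phi> t x = 0"
    if "\<bar>t\<bar> > R \<or> \<bar>x\<bar> > R" for t x
  proof -
    have N: "(t, x) \<in> N"
      using R(2)[of "(t, x)"] that norm_fst_le[of t x] norm_snd_le[of x t] by fastforce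
    obtain S T where ST0: "open S" "open T" "(t, x) \<in> S \<times> T" "S \<times> T \<subseteq> N"
      using open_prod_elim[OF oN N] .
    have ST: "open S" "open T" "t \<in> S" "x \<in> T"
      using ST0(1-3) by simp_all
    have z0: "\<phi> (s, y) = 0" if "s \<in> S" "y \<in> T" for s y
      using ST0(4) that by (intro z) blast
    have "((\<lambda>s. \<phi> (s, x)) has_real_derivative 0) (at t)"
      by (rule has_field_derivative_transform_within_open[OF DERIV_const ST(1,3)]) (simp add: z0 ST)
    moreover have "((\<lambda>y. \<phi> (t, y)) has_real_derivative 0) (at x)"
      by (rule has_field_derivative_transform_within_open[OF DERIV_const ST(2,4)]) (simp add: z0 ST)
    ultimately show ?thesis using z[OF N] by (simp add: DERIV_imp_deriv)
  qed
  have bd: "\<exists>B. 0 \<le> B \<and> (\<forall>p. \<bar>f p\<bar> \<le> B)"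
    if "continuous_on UNIV f" "\<And>t x. \<bar>t\<bar> > R \<or> \<bar>x\<bar> > R \<Longrightarrow> f (t, x) = 0" for f :: "real \<times> real \<Rightarrow> real"
  proof -
    have "compact (f ` ({-R..R} \<times> {-R..R}))"
      by (intro compact_continuous_image continuous_on_subset[OF that(1)] compact_Times) auto
    then obtain B where B: "\<And>p. p \<in> {-R..R} \<times> {-R..R} \<Longrightarrow> norm (f p) \<le> B"
      using compact_imp_bounded bounded_iff by (metis imageI)
    have "\<bar>f (t, x)\<bar> \<le> max 0 B" for t x
      using B[of "(t, x)"] that(2)[of t x] by (cases "\<bar>t\<bar> > R \<or> \<bar>x\<bar> > R") (force simp: abs_le_iff)+
    then show ?thesis by (metis max.cobounded1 surj_pair)
  qed
  obtain B1 where B1: "0 \<le> B1" "\<forall>p. \<bar>\<phi> p\<bar> \<le> B1" using bd[OF basic(1)] out by blast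
  obtain B2 where B2: "0 \<le> B2" "\<forall>p. \<bar>(\<lambda>(t, x). dt \<phi> t x) p\<bar> \<le> B2"
    using bd[OF basic(4)] out by auto
  obtain B3 where B3: "0 \<le> B3" "\<forall>p. \<bar>(\<lambda>(t, x). dx \<phi> t x) p\<bar> \<le> B3"
    using bd[OF basic(5)] out by auto
  show ?thesis
  proof (rule that[OF R(1) _ out, of "B1 + B2 + B3"])
    fix t x
    show "\<bar>\<phi> (t, x)\<bar> \<le> B1 + B2 + B3 \<and> \<bar>dt \<phi> t x\<bar> \<le> B1 + B2 + B3 \<and>
        \<bar>dx \<phi> t x\<bar> \<le> B1 + B2 + B3"
      using B1(2)[rule_format, of "(t, x)"] B2(2)[rule_format, of "(t, x)"]
        B3(2)[rule_format, of "(t, x)"] B1(1) B2(1) B3(1) by simp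
  qed (use B1(1) B2(1) B3(1) in auto)
qed

lemma test_function_measurable:
  assumes "\<phi> \<in> test_functions"
  shows "\<phi> \<in> borel_measurable borel"
    "(\<lambda>(t, x). dt \<phi> t x) \<in> borel_measurable borel"
    "(\<lambda>(t, x). dx \<phi> t x) \<in> borel_measurable borel"
  using test_function_basic[OF assms] by (auto intro: borel_measurable_continuous_onI)

lemma integrable_bounded_support:
  fixes f :: "real \<times> real \<Rightarrow> real"
  assumes "f \<in> borel_measurable M" "M = lborel \<or> M = lebesgue"
    "AE p in M. \<bar>f p\<bar> \<le> C" "\<And>t x. \<bar>t\<bar> > R \<or> \<bar>x\<bar> > R \<Longrightarrow> f (t, x) = 0"
  shows "integrable M f"
proof (rule Bochner_Integration.integrable_bound[where f = "\<lambda>p. C * indicator (cbox (-R, -R) (R, R)) p"])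
  have "integrable lborel (\<lambda>p::real\<times>real. C * indicator (cbox (-R, -R) (R, R)) p)"
    by (intro integrable_mult_right integrable_real_indicator)
       (auto simp: emeasure_lborel_cbox_eq)
  then show "integrable M (\<lambda>p::real\<times>real. C * indicator (cbox (-R, -R) (R, R)) p)"
    using assms(2) by (auto simp: integrable_completion)
  show "AE p in M. norm (f p) \<le> norm (C * indicator (cbox (-R, -R) (R, R)) p)"
    using assms(3)
  proof eventually_elim
    case (elim p)
    obtain t x where p: "p = (t, x)" by (cases p)
    show ?case
    proof (cases "\<bar>t\<bar> > R \<or> \<bar>x\<bar> > R")
      case True
      then show ?thesis using assms(4) p by simp
    next
      case False
      then have "p \<in> cbox (-R, -R) (R, R)" by (auto simp: p cbox_Pair_eq)
      then show ?thesis using elim by simp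
    qed
  qed
qed (use assms in auto)

text \<open>Kinks of \<open>w\<close> on a finite set are harmless because \<open>w\<close> is
  continuous: the fundamental theorem for the gauge integral allows a finite exceptional set. The
  bound on \<open>g\<close> gives Lebesgue integrability, so that the two integrals agree.\<close>

lemma ibp_1d:
  fixes w g \<psi> \<psi>' :: "real \<Rightarrow> real"
  assumes "a \<le> b" "continuous_on {a..b} w" "finite X"
    "\<And>t. t \<in> {a<..<b} - X \<Longrightarrow> (w has_real_derivative g t) (at t)"
    "\<And>t. (\<psi> has_real_derivative \<psi>' t) (at t)" "continuous_on UNIV \<psi>'"
    "g \<in> borel_measurable borel" "\<And>t. t \<in> {a<..b} \<Longrightarrow> \<bar>g t\<bar> \<le> B"
  shows "(LBINT t:{a..b}. w t * \<psi>' t + g t * \<psi> t) = w b * \<psi> b - w a * \<psi> a"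
proof -
  have c\<psi>: "continuous_on T \<psi>" for T
    using assms(5) by (meson DERIV_isCont continuous_at_imp_continuous_on)
  have "((\<lambda>t. w t * \<psi>' t + g t * \<psi> t) has_integral (w b * \<psi> b - w a * \<psi> a)) {a..b}"
  proof (rule fundamental_theorem_of_calculus_interior_strong[OF assms(3,1)])
    fix t assume "t \<in> {a<..<b} - X"
    from DERIV_mult[OF assms(4)[OF this] assms(5)[of t]]
    show "((\<lambda>t. w t * \<psi> t) has_vector_derivative w t * \<psi>' t + g t * \<psi> t) (at t)"
      by (simp add: has_real_derivative_iff_has_vector_derivative algebra_simps)
  qed (intro continuous_intros assms(2) c\<psi>)
  moreover have "set_integrable lborel {a..b} (\<lambda>t. w t * \<psi>' t + g t * \<psi> t)"
  proof (rule set_integral_add(1))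
    show "set_integrable lborel {a..b} (\<lambda>t. w t * \<psi>' t)"
      by (intro borel_integrable_compact[unfolded set_integrable_def[symmetric]] compact_Icc continuous_intros assms(2)
            continuous_on_subset[OF assms(6)]) auto
    \<comment> \<open>The bound \<open>B\<close> covers the half-open interval only, hence the extra
      \<open>\<bar>g a\<bar>\<close>.\<close>
    have "continuous_on {a..b} (\<lambda>t. max \<bar>B\<bar> \<bar>g a\<bar> * \<psi> t)"
      by (intro continuous_intros c\<psi>)
    then have i: "set_integrable lborel {a..b} (\<lambda>t. max \<bar>B\<bar> \<bar>g a\<bar> * \<psi> t)"
      unfolding set_integrable_def by (rule borel_integrable_compact[OF compact_Icc])
    show "set_integrable lborel {a..b} (\<lambda>t. g t * \<psi> t)"
    proof (rule set_integrable_bound[OF i])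
      have "\<psi> \<in> borel_measurable borel" by (intro borel_measurable_continuous_onI c\<psi>)
      then show "set_borel_measurable lborel {a..b} (\<lambda>t. g t * \<psi> t)"
        using assms(7) unfolding set_borel_measurable_def by measurable
      show "AE t in lborel. t \<in> {a..b} \<longrightarrow> norm (g t * \<psi> t) \<le> norm (max \<bar>B\<bar> \<bar>g a\<bar> * \<psi> t)"
      proof (intro AE_I2 impI)
        fix t assume "t \<in> {a..b}"
        then have "\<bar>g t\<bar> \<le> max \<bar>B\<bar> \<bar>g a\<bar>"
          using assms(8)[of t] by (cases "t = a") (auto simp: max_def)
        then show "norm (g t * \<psi> t) \<le> norm (max \<bar>B\<bar> \<bar>g a\<bar> * \<psi> t)"
          by (auto simp: abs_mult intro!: mult_right_mono)
      qed
    qed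
  qed
  ultimately show ?thesis
    using set_borel_integral_eq_integral(2) integral_unique by metis
qed

lemma integral_lebesgue_plane:
  fixes f :: "real \<times> real \<Rightarrow> real"
  assumes "f \<in> borel_measurable borel" "integrable lborel f"
  shows "integral\<^sup>L lebesgue f = (LBINT t. LBINT x. f (t, x))"
    "integral\<^sup>L lebesgue f = (LBINT x. LBINT t. f (t, x))"
proof -
  have i: "integrable (lborel \<Otimes>\<^sub>M lborel) (\<lambda>(t, x). f (t, x))"
    using assms(2) by (simp add: lborel_prod)
  have "integral\<^sup>L lebesgue f = integral\<^sup>L lborel f"
    using assms(1) by (simp add: integral_completion)
  also have "\<dots> = integral\<^sup>L (lborel \<Otimes>\<^sub>M lborel) (\<lambda>(t, x). f (t, x))"
    by (simp add: lborel_prod)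
  finally have *: "integral\<^sup>L lebesgue f = integral\<^sup>L (lborel \<Otimes>\<^sub>M lborel) (\<lambda>(t, x). f (t, x))" .
  show "integral\<^sup>L lebesgue f = (LBINT t. LBINT x. f (t, x))"
    using lborel_pair.integral_fst[OF i] * by simp
  show "integral\<^sup>L lebesgue f = (LBINT x. LBINT t. f (t, x))"
    using lborel_pair.integral_snd[OF i] * by simp
qed

text \<open>On each line, \<open>W_t = - G\<close> and \<open>F_x = G\<close> off finitely many
  points. After \<open>G * \<phi>\<close> is subtracted from one summand and added to the other, the
  first is integrated in \<open>t\<close> first and the second in \<open>x\<close> first. Thus
  integration by parts in one variable and Fubini suffice, although the kinks of \<open>W\<close>
  and \<open>F\<close> form curves in the plane.\<close>

lemma conservation:
  fixes W F G :: "real \<Rightarrow> real \<Rightarrow> real"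
  assumes \<phi>: "\<phi> \<in> test_functions"
    and meas: "(\<lambda>(t, x). W t x) \<in> borel_measurable borel" "(\<lambda>(t, x). F t x) \<in> borel_measurable borel"
      "(\<lambda>(t, x). G t x) \<in> borel_measurable borel"
    and bound: "\<And>t x. \<bar>W t x\<bar> \<le> B" "\<And>t x. \<bar>F t x\<bar> \<le> B" "\<And>t x. \<bar>G t x\<bar> \<le> B"
    and W: "\<And>x. continuous_on {0..} (\<lambda>t. W t x)"
      "\<And>x. \<exists>X. finite X \<and> (\<forall>t. 0 < t \<and> t \<notin> X \<longrightarrow> ((\<lambda>t. W t x) has_real_derivative - G t x) (at t))"
    and F: "\<And>t. 0 < t \<Longrightarrow> continuous_on UNIV (\<lambda>x. F t x)"
      "\<And>t. 0 < t \<Longrightarrow> \<exists>X. finite X \<and> (\<forall>x. x \<notin> X \<longrightarrow> ((\<lambda>x. F t x) has_real_derivative G t x) (at x))"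
  shows "(LINT (t, x):({0<..} \<times> UNIV)|lebesgue.
      W t x * dt \<phi> t x + F t x * dx \<phi> t x)
    + (LINT x|lebesgue. W 0 x * \<phi> (0, x)) = 0"
proof -
  define pt where "pt = (\<lambda>(t, x). dt \<phi> t x)"
  define px where "px = (\<lambda>(t, x). dx \<phi> t x)"
  note basic = test_function_basic[OF \<phi>]
  note [measurable] = meas test_function_measurable[OF \<phi>, folded pt_def px_def]
  from \<phi> obtain R C where R: "0 < R" "0 \<le> C"
    "\<And>t x. \<bar>t\<bar> > R \<or> \<bar>x\<bar> > R \<Longrightarrow> \<phi> (t, x) = 0 \<and> pt (t, x) = 0 \<and> px (t, x) = 0"
    "\<And>t x. \<bar>\<phi> (t, x)\<bar> \<le> C \<and> \<bar>pt (t, x)\<bar> \<le> C \<and> \<bar>px (t, x)\<bar> \<le> C"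
    unfolding pt_def px_def by (rule test_function_support) auto
  have B: "0 \<le> B" using bound(1)[of 0 0] by linarith
  define I where "I = (\<lambda>(t::real, x::real). indicator {0<..} t :: real)"
  have [measurable]: "I \<in> borel_measurable borel" unfolding I_def borel_prod[symmetric] by measurable
  define Q where "Q = (\<lambda>(t, x). I (t, x) * (W t x * pt (t, x) - G t x * \<phi> (t, x)))"
  define P where "P = (\<lambda>(t, x). I (t, x) * (F t x * px (t, x) + G t x * \<phi> (t, x)))"
  have mQ: "Q \<in> borel_measurable borel"
  proof -
    have "Q = (\<lambda>p. I p * ((\<lambda>(t, x). W t x) p * pt p - (\<lambda>(t, x). G t x) p * \<phi> p))"
      by (auto simp: Q_def fun_eq_iff)
    then show ?thesis by simp
  qed
  have mP: "P \<in> borel_measurable borel"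
  proof -
    have "P = (\<lambda>p. I p * ((\<lambda>(t, x). F t x) p * px p + (\<lambda>(t, x). G t x) p * \<phi> p))"
      by (auto simp: P_def fun_eq_iff)
    then show ?thesis by simp
  qed
  have I1: "\<bar>I p\<bar> \<le> 1" for p by (auto simp: I_def indicator_def split: prod.splits)
  have bd: "\<bar>I p * (a * b + c * d)\<bar> \<le> 1 * (B * C + B * C)"
    if "\<bar>a\<bar> \<le> B" "\<bar>b\<bar> \<le> C" "\<bar>c\<bar> \<le> B" "\<bar>d\<bar> \<le> C" for p a b c d
    unfolding abs_mult[of "I p"]
    by (intro mult_mono I1 order_trans[OF abs_triangle_ineq] add_mono)
       (use that B R(2) in \<open>auto simp: abs_mult intro!: mult_mono\<close>)
  have iQ: "integrable lborel Q"
  proof (rule integrable_bounded_support[of _ _ "1 * (B * C + B * C)" R])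
    have "\<bar>Q (t, x)\<bar> \<le> 1 * (B * C + B * C)" for t x
      unfolding Q_def using bd[of "W t x" "pt (t, x)" "- G t x" "\<phi> (t, x)" "(t, x)"] bound R(4) by simp
    then show "AE p in lborel. \<bar>Q p\<bar> \<le> 1 * (B * C + B * C)" by (metis (mono_tags) AE_I2 surj_pair)
  qed (use R(3) mQ in \<open>auto simp: Q_def\<close>)
  have iP: "integrable lborel P"
  proof (rule integrable_bounded_support[of _ _ "1 * (B * C + B * C)" R])
    have "\<bar>P (t, x)\<bar> \<le> 1 * (B * C + B * C)" for t x
      unfolding P_def using bd[of "F t x" "px (t, x)" "G t x" "\<phi> (t, x)" "(t, x)"] bound R(4) by simp
    then show "AE p in lborel. \<bar>P p\<bar> \<le> 1 * (B * C + B * C)" by (metis (mono_tags) AE_I2 surj_pair)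
  qed (use R(3) mP in \<open>auto simp: P_def\<close>)
  have sec: "(\<lambda>t. G t x) \<in> borel_measurable borel" "(\<lambda>x. G t x) \<in> borel_measurable borel" for t x
    using measurable_compose[OF measurable_Pair1'[of x borel borel] meas(3)[unfolded borel_prod[symmetric]]]
      measurable_compose[OF measurable_Pair2'[of x borel borel] meas(3)[unfolded borel_prod[symmetric]]]
      measurable_compose[OF measurable_Pair1'[of t borel borel] meas(3)[unfolded borel_prod[symmetric]]]
    by (simp_all add: borel_prod)
  have Qint: "(LBINT t. Q (t, x)) = - (W 0 x * \<phi> (0, x))" for x
  proof -
    obtain X where X: "finite X" "\<And>t. 0 < t \<Longrightarrow> t \<notin> X \<Longrightarrow> ((\<lambda>t. W t x) has_real_derivative - G t x) (at t)"
      using W(2)[of x] by blast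
    have cpt: "continuous_on UNIV (\<lambda>t. pt (t, x))"
      by (rule continuous_on_compose2[OF basic(4)[folded pt_def]]) (auto intro!: continuous_intros)
    have "(LBINT t:{0..R+1}. W t x * pt (t, x) + (- G t x) * \<phi> (t, x)) = W (R+1) x * \<phi> (R+1, x) - W 0 x * \<phi> (0, x)"
    proof (rule ibp_1d[OF _ _ X(1), where B = B])
      show "continuous_on {0..R+1} (\<lambda>t. W t x)" by (rule continuous_on_subset[OF W(1)]) auto
      show "((\<lambda>a. \<phi> (a, x)) has_real_derivative pt (t, x)) (at t)" for t
        using basic(2) by (simp add: pt_def)
    qed (use R(1) X(2) cpt sec bound(3) in auto)
    moreover have "\<phi> (R+1, x) = 0" using R(3)[of "R+1" x] R(1) by simp
    moreover have "(LBINT t. Q (t, x)) = (LBINT t:{0..R+1}. W t x * pt (t, x) + (- G t x) * \<phi> (t, x))"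
      unfolding set_lebesgue_integral_def
    proof (rule integral_cong_AE)
      show "(\<lambda>t. Q (t, x)) \<in> borel_measurable lborel"
        using measurable_compose[OF measurable_Pair2'[of x borel borel] mQ[unfolded borel_prod[symmetric]]] by simp
      have "(\<lambda>t. indicator {0..R+1} t * ((\<lambda>(t, x). W t x) (t, x) * pt (t, x) + (- (\<lambda>(t, x). G t x) (t, x)) * \<phi> (t, x))) \<in> borel_measurable borel"
        by measurable
      then show "(\<lambda>t. indicator {0..R+1} t *\<^sub>R (W t x * pt (t, x) + - G t x * \<phi> (t, x))) \<in> borel_measurable lborel"
        by simp
      \<comment> \<open>At \<open>t = 0\<close> the two indicators disagree; beyond \<open>R\<close>
        the test function vanishes.\<close>
      show "AE t in lborel. Q (t, x) = indicator {0..R+1} t *\<^sub>R (W t x * pt (t, x) + - G t x * \<phi> (t, x))"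
        using AE_lborel_singleton[of "0::real"]
      proof eventually_elim
        case (elim t)
        then show ?case
          using R(3)[of t x] R(1) by (auto simp: Q_def I_def indicator_def)
      qed
    qed
    ultimately show ?thesis by simp
  qed
  have Pint: "(LBINT x. P (t, x)) = 0" for t
  proof (cases "t > 0")
    case True
    obtain X where X: "finite X" "\<And>x. x \<notin> X \<Longrightarrow> ((\<lambda>x. F t x) has_real_derivative G t x) (at x)"
      using F(2)[OF True] by blast
    have cpx: "continuous_on UNIV (\<lambda>x. px (t, x))"
      by (rule continuous_on_compose2[OF basic(5)[folded px_def]]) (auto intro!: continuous_intros)
    have "(LBINT x:{-(R+1)..R+1}. F t x * px (t, x) + G t x * \<phi> (t, x))
        = F t (R+1) * \<phi> (t, R+1) - F t (-(R+1)) * \<phi> (t, -(R+1))"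
    proof (rule ibp_1d[OF _ _ X(1), where B = B])
      show "continuous_on {-(R+1)..R+1} (\<lambda>x. F t x)" by (rule continuous_on_subset[OF F(1)[OF True]]) auto
      show "((\<lambda>a. \<phi> (t, a)) has_real_derivative px (t, x)) (at x)" for x
        using basic(3) by (simp add: px_def)
    qed (use R(1) X(2) cpx sec bound(3) in auto)
    moreover have "\<phi> (t, R+1) = 0" "\<phi> (t, -(R+1)) = 0" using R(3)[of t "R+1"] R(3)[of t "-(R+1)"] R(1) by auto
    moreover have "(LBINT x. P (t, x)) = (LBINT x:{-(R+1)..R+1}. F t x * px (t, x) + G t x * \<phi> (t, x))"
      unfolding set_lebesgue_integral_def
    proof (intro Bochner_Integration.integral_cong refl)
      fix x
      show "P (t, x) = indicator {-(R+1)..R+1} x *\<^sub>R (F t x * px (t, x) + G t x * \<phi> (t, x))"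
        using R(3)[of t x] R(1) True
        by (cases "x \<in> {-(R+1)..R+1}") (auto simp: P_def I_def abs_if split: if_splits)
    qed
    ultimately show ?thesis by simp
  next
    case False
    then show ?thesis by (simp add: P_def I_def)
  qed
  have "integral\<^sup>L lebesgue Q = - (LBINT x. W 0 x * \<phi> (0, x))"
    unfolding integral_lebesgue_plane(2)[OF mQ iQ] Qint by simp
  moreover have "integral\<^sup>L lebesgue P = 0"
    unfolding integral_lebesgue_plane(1)[OF mP iP] Pint by simp
  moreover have "integral\<^sup>L lebesgue (\<lambda>p. Q p + P p) = integral\<^sup>L lebesgue Q + integral\<^sup>L lebesgue P"
    using iQ iP mQ mP by (intro Bochner_Integration.integral_add) (auto simp: integrable_completion)
  moreover have "(LINT (t, x):({0<..} \<times> UNIV)|lebesgue.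
      W t x * dt \<phi> t x + F t x * dx \<phi> t x) = integral\<^sup>L lebesgue (\<lambda>p. Q p + P p)"
    unfolding set_lebesgue_integral_def
  proof (intro Bochner_Integration.integral_cong refl)
    fix p :: "real \<times> real"
    obtain t x where p: "p = (t, x)" by (cases p)
    show "indicator ({0<..} \<times> UNIV) p *\<^sub>R (case p of (t, x) \<Rightarrow>
        W t x * dt \<phi> t x + F t x * dx \<phi> t x) = Q p + P p"
      by (cases "0 < t") (simp_all add: p Q_def P_def I_def pt_def px_def)
  qed
  moreover have "(LINT x|lebesgue. W 0 x * \<phi> (0, x)) = (LBINT x. W 0 x * \<phi> (0, x))"
  proof -
    have "(\<lambda>x. (\<lambda>(t, x). W t x) (0, x) * \<phi> (0, x)) \<in> borel_measurable borel" by measurable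
    then show ?thesis by (simp add: integral_completion)
  qed
  ultimately show ?thesis by simp
qed


section \<open>Monotonicity of the flux level and the passage to real time\<close>

lemma nn_pos: "s > 0 \<Longrightarrow> nn s x > 0"
  unfolding nn_eq using nn_factor[of s x] by (intro mult_pos_pos) linarith+

lemma al_ds: "x > 0 \<Longrightarrow> ((\<lambda>s. al s x) has_real_derivative x^2 * nn s x) (at s)"
  unfolding al_def nn_def ee_def
  by (auto intro!: derivative_eq_intros h1_deriv simp: algebra_simps power2_eq_square)

lemma al_dx: "x > 0 \<Longrightarrow> ((\<lambda>x. al s x) has_real_derivative s^2 * x * pp s x) (at x)"
  unfolding al_def pp_def
  by (auto intro!: derivative_eq_intros ee_deriv simp: dd_def algebra_simps power2_eq_square)

lemma al_mono_s:
  assumes "x > 0" "0 < s" "s < s'" shows "al s x < al s' x"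
  by (rule DERIV_pos_imp_increasing[OF assms(3), of "\<lambda>s. al s x"])
     (use assms in \<open>auto intro!: exI al_ds mult_pos_pos nn_pos\<close>)

lemma al_mono_x:
  assumes "0 < x" "x < y" "0 < s" shows "al s x < al s y"
  by (rule DERIV_pos_imp_increasing[OF assms(2), of "\<lambda>x. al s x"])
     (use assms in \<open>auto intro!: exI al_dx mult_pos_pos pp_pos\<close>)

lemma al_bounds: "s^2 * x^2 / 4 \<le> al s x" "al s x \<le> s^2 * x^2"
proof -
  have e: "al s x = s^2 * x^2 * (1 / 2 + h1 s * sg x)"
    by (simp add: al_def ee_def algebra_simps)
  have "\<bar>h1 s * sg x\<bar> \<le> 1 / 500" by (rule small_prod[OF h_bounds(5) sg_bound'])
  then have "s^2 * x^2 * (1 / 4) \<le> al s x" "al s x \<le> s^2 * x^2 * 1"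
    unfolding e by (intro mult_left_mono; simp)+ 
  then show "s^2 * x^2 / 4 \<le> al s x" "al s x \<le> s^2 * x^2" by simp_all
qed

lemma Us_zero: "Us 0 x = 0"
  by (simp add: Us_def h_def)

lemma Us_nonneg: "x > 0 \<Longrightarrow> 0 \<le> s \<Longrightarrow> 0 \<le> Us s x"
  using Us_strict_mono[of x 0 s] Us_zero[of x] by (cases "s = 0") auto

lemma Us_Lipschitz:
  assumes "x > 0" shows "\<bar>Us s x - Us s' x\<bar> \<le> 2 * x * \<bar>s - s'\<bar>"
proof -
  have "norm (Us s x - Us s' x) \<le> 2 * x * norm (s - s')"
  proof (rule field_differentiable_bound[of UNIV _ "\<lambda>s. x * pp s x"])
    fix z
    have "\<bar>pp z x\<bar> \<le> 2" using pp_bounds[of z x] by linarith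
    then show "norm (x * pp z x) \<le> 2 * x" using assms by (simp add: abs_mult)
  qed (use Us_ds in auto)
  then show ?thesis by simp
qed

text \<open>Clamping at \<open>t = 0\<close> keeps the values in \<open>(0, 1]\<close> and makes the
  function continuous and measurable on the whole line. Where smoothness across \<open>t = 0\<close>
  matters, the unclamped \<open>sg0\<close> takes its place.\<close>

definition tau :: "real \<Rightarrow> real" where "tau t = inverse (1 + max 0 t)"

lemma tau_bounds: "0 < tau t" "tau t \<le> 1"
  by (auto simp: tau_def inverse_le_1_iff)

lemma tau_deriv: "t > 0 \<Longrightarrow> (tau has_real_derivative - (tau t ^ 2)) (at t)"
proof -
  assume t: "t > 0"
  have "((\<lambda>t. inverse (1 + t)) has_real_derivative - (tau t ^ 2)) (at t)"
    using t by (auto intro!: derivative_eq_intros simp: tau_def power2_eq_square)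
  then show ?thesis
    by (rule has_field_derivative_transform_within_open[where S = "{0<..}"])
       (use t in \<open>auto simp: tau_def\<close>)
qed

lemma tau_continuous: "continuous_on T tau"
  unfolding tau_def by (intro continuous_intros) (auto simp: max_def add_pos_nonneg)

lemma tau_measurable [measurable]: "tau \<in> borel_measurable borel"
  by (intro borel_measurable_continuous_onI tau_continuous)

lemma tau_inj: "0 < t \<Longrightarrow> 0 < t' \<Longrightarrow> tau t = tau t' \<longleftrightarrow> t = t'"
  by (auto simp: tau_def)

section \<open>Stationary states\<close>

lemma upper_state_ex1:
  assumes "0 \<le> \<alpha>" shows "\<exists>!u. 0 \<le> u \<and> A x u = \<alpha>"
proof -
  have "\<alpha> \<le> A x (2 * sqrt \<alpha>)" using A_lower[of "2 * sqrt \<alpha>" x] assms by (simp add: power_mult_distrib)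
  then obtain u where "0 \<le> u" "A x u = \<alpha>"
    using IVT'[of "A x" 0 \<alpha> "2 * sqrt \<alpha>"] assms A_continuous_u[of _ x] by (auto simp: A_zero)
  moreover have "v = u" if "0 \<le> v" "A x v = \<alpha>" for v
    using A_strict_mono[of u v x] A_strict_mono[of v u x] that \<open>0 \<le> u\<close> \<open>A x u = \<alpha>\<close> by (metis less_irrefl neqE)
  ultimately show ?thesis by blast
qed

definition kp :: "real \<Rightarrow> real \<Rightarrow> real" where "kp \<alpha> x = (THE u. 0 \<le> u \<and> A x u = \<alpha>)"

lemma kp: "0 \<le> \<alpha> \<Longrightarrow> 0 \<le> kp \<alpha> x" "0 \<le> \<alpha> \<Longrightarrow> A x (kp \<alpha> x) = \<alpha>"
  using theI'[OF upper_state_ex1[of \<alpha> x]] by (auto simp: kp_def)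

lemma kp_eqI: "0 \<le> u \<Longrightarrow> A x u = \<alpha> \<Longrightarrow> kp \<alpha> x = u"
  using upper_state_ex1[of \<alpha> x] kp[of \<alpha> x] A_nonneg[of x u] by blast

lemma A_mono_iff: "0 \<le> u \<Longrightarrow> 0 \<le> v \<Longrightarrow> A x u \<le> A x v \<longleftrightarrow> u \<le> v"
  using A_strict_mono[of u v x] A_strict_mono[of v u x] by (cases u v rule: linorder_cases) auto

lemma state_bound: "A x u = \<alpha> \<Longrightarrow> \<bar>u\<bar> \<le> 2 * sqrt \<alpha>"
proof -
  assume "A x u = \<alpha>"
  then have "(\<bar>u\<bar> / 2)^2 \<le> \<alpha>" using A_lower[of u x] by (simp add: power_divide)
  then show ?thesis using real_le_rsqrt[of "\<bar>u\<bar> / 2" \<alpha>] by simp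
qed

lemma A_measurable: "(\<lambda>(x, u). A x u) \<in> borel_measurable borel"
proof -
  have "(\<lambda>p. indicator ((- {0}) \<times> UNIV) p *\<^sub>R (\<lambda>(x, u). A x u) p) \<in> borel_measurable borel"
    by (rule borel_measurable_continuous_on_indicator[OF _ A_continuous])
       (auto intro!: borel_open open_Times)
  moreover have "(\<lambda>p::real\<times>real. indicator ({0} \<times> UNIV) p *\<^sub>R ((snd p)^2 / 2)) \<in> borel_measurable borel"
    by (rule borel_measurable_continuous_on_indicator)
       (auto intro!: borel_closed closed_Times continuous_intros)
  ultimately have m: "(\<lambda>p. indicator ((- {0}) \<times> UNIV) p *\<^sub>R (\<lambda>(x, u). A x u) p
      + indicator ({0} \<times> UNIV) p *\<^sub>R ((snd p)^2 / 2)) \<in> borel_measurable borel"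
    by (rule borel_measurable_add)
  have eq: "(\<lambda>(x, u). A x u) = (\<lambda>p. indicator ((- {0}) \<times> UNIV) p *\<^sub>R (\<lambda>(x, u). A x u) p
      + indicator ({0} \<times> UNIV) p *\<^sub>R ((snd p)^2 / 2))"
    by (auto simp: fun_eq_iff indicator_def A_def)
  show ?thesis by (subst eq) (rule m)
qed

lemma A_measurable_x: "(\<lambda>x. A x u) \<in> borel_measurable borel"
  using measurable_compose[OF measurable_Pair2'[of u borel borel], of "\<lambda>(x, u). A x u" borel] A_measurable
  by (simp add: borel_prod)

text \<open>At \<open>\<alpha> = 0\<close> the zero function is the only state, and it is filed
  under the lower branch; this merges the two cases of the definition.\<close>

lemma stationary_states_iff:
  assumes "\<alpha> \<ge> 0" "k \<in> stationary_states A (\<lambda>_. 0) (\<lambda>_. 0) \<alpha>"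
  shows "k = kp \<alpha> \<or> (\<forall>x. k x \<le> 0 \<and> A x (k x) = \<alpha>)"
proof (cases "\<alpha> = 0")
  case True
  then have "k x = 0" for x using assms(2) by (auto simp: stationary_states_def intro: antisym)
  then show ?thesis using True by (simp add: A_zero)
next
  case False
  then consider "\<forall>x. 0 \<le> k x \<and> A x (k x) = \<alpha>" | "\<forall>x. k x \<le> 0 \<and> A x (k x) = \<alpha>"
    using assms(2) unfolding stationary_states_def by auto
  then show ?thesis
  proof cases
    case 1
    then have "k x = kp \<alpha> x" for x using kp_eqI[of "k x" x \<alpha>] by simp
    then show ?thesis by (simp add: fun_eq_iff)
  qed simp
qed

lemma kp_stationary: "\<alpha> > 0 \<Longrightarrow> kp \<alpha> \<in> stationary_states A (\<lambda>_. 0) (\<lambda>_. 0) \<alpha>"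
  by (simp add: stationary_states_def kp)

text \<open>A state is given implicitly, but since \<open>A x\<close> is strictly monotone on each
  branch, comparing \<open>k x\<close> with a constant \<open>c\<close> amounts to comparing
  \<open>A x c\<close> with \<open>\<alpha>\<close>, and \<open>A x c\<close> is measurable in
  \<open>x\<close>.\<close>

lemma state_measurable:
  assumes "k = kp \<alpha> \<or> (\<forall>x. k x \<le> 0 \<and> A x (k x) = \<alpha>)" "0 \<le> \<alpha>"
  shows "k \<in> borel_measurable borel"
  using assms(1)
proof
  assume k: "k = kp \<alpha>"
  show ?thesis
  proof (rule borel_measurableI_le)
    fix c
    have m: "{x \<in> space borel. \<alpha> \<le> A x c} \<in> sets borel"
      using A_measurable_x[of c, unfolded borel_measurable_iff_ge] by blast
    show "{x \<in> space borel. k x \<le> c} \<in> sets borel"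
    proof (cases "c < 0")
      case True
      have "\<not> kp \<alpha> x \<le> c" for x using True kp(1)[OF assms(2), of x] by linarith
      then have "{x \<in> space borel. k x \<le> c} = {}" by (simp add: k)
      then show ?thesis by (simp only: sets.empty_sets)
    next
      case False
      then have "kp \<alpha> x \<le> c \<longleftrightarrow> \<alpha> \<le> A x c" for x
        using A_mono_iff[of "kp \<alpha> x" c x] kp[OF assms(2), of x] by simp
      then show ?thesis unfolding k using m by (simp only:)
    qed
  qed
next
  assume k: "\<forall>x. k x \<le> 0 \<and> A x (k x) = \<alpha>"
  show ?thesis
  proof (rule borel_measurableI_ge)
    fix c
    have m: "{x \<in> space borel. \<alpha> \<le> A x c} \<in> sets borel"
      using A_measurable_x[of c, unfolded borel_measurable_iff_ge] by blast
    show "{x \<in> space borel. c \<le> k x} \<in> sets borel"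
    proof (cases "c > 0")
      case True
      have "\<not> c \<le> k x" for x using True k[rule_format, of x] by linarith
      then have "{x \<in> space borel. c \<le> k x} = {}" by simp
      then show ?thesis by (simp only: sets.empty_sets)
    next
      case False
      have "c \<le> k x \<longleftrightarrow> \<alpha> \<le> A x c" for x
        using A_strict_antimono[of "k x" c x] A_strict_antimono[of c "k x" x] k[rule_format, of x] False
        by (cases "k x" c rule: linorder_cases) auto
      then show ?thesis using m by (simp only:)
    qed
  qed
qed

section \<open>The truncated explicit solution\<close>

definition U :: "real \<Rightarrow> real \<Rightarrow> real" where
  "U t x = (if x \<le> 0 then 0 else min (Us (tau t) x) (kp 1 x))"
text \<open>\<open>zz\<close> is the flux along \<open>U\<close>, as \<open>A_U\<close> shows. Away
  from \<open>x = 0\<close> and from the curve where the level is 1, \<open>zx\<close> is both the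
  \<open>x\<close>-derivative of \<open>zz\<close> and \<open>- U_t\<close>. In the truncated region
  \<open>U\<close> is the stationary state \<open>kp 1\<close> and \<open>zx\<close>
  vanishes.\<close>

definition zz :: "real \<Rightarrow> real \<Rightarrow> real" where
  "zz t x = (if x \<le> 0 then 0 else min (al (tau t) x) 1)"
definition zx :: "real \<Rightarrow> real \<Rightarrow> real" where
  "zx t x = (if x > 0 \<and> al (tau t) x < 1 then (tau t)^2 * x * pp (tau t) x else 0)"

lemma kp1_bound: "kp 1 x \<le> 2"
  using state_bound[OF kp(2)[of 1 x]] by simp

lemma U_nonneg: "0 \<le> U t x"
  using Us_nonneg[of x "tau t"] kp(1)[of 1 x] tau_bounds(1)[of t] by (auto simp: U_def)

lemma U_bound: "\<bar>U t x\<bar> \<le> 2"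
  using U_nonneg[of t x] kp1_bound[of x] by (auto simp: U_def)

lemma A_U: "A x (U t x) = zz t x"
proof (cases "x \<le> 0")
  case False
  then have "0 \<le> Us (tau t) x" using Us_nonneg[of x "tau t"] tau_bounds(1)[of t] by auto
  moreover have "A x (Us (tau t) x) = al (tau t) x" using False by (simp add: A_Us)
  ultimately show ?thesis
    using False A_mono_iff[of "Us (tau t) x" "kp 1 x" x] kp[of 1 x]
    by (auto simp: U_def zz_def min_def)
qed (simp add: U_def zz_def A_zero)

lemma zz_bounds: "0 \<le> zz t x" "zz t x \<le> 1"
  using A_nonneg[of x "U t x"] by (auto simp: A_U zz_def)

lemma U_eq_Us: "x > 0 \<Longrightarrow> al (tau t) x \<le> 1 \<Longrightarrow> U t x = Us (tau t) x"
  using A_mono_iff[of "Us (tau t) x" "kp 1 x" x] kp[of 1 x] Us_nonneg[of x "tau t"] tau_bounds(1)[of t]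
  by (simp add: U_def A_Us)

lemma U_eq_kp: "x > 0 \<Longrightarrow> 1 \<le> al (tau t) x \<Longrightarrow> U t x = kp 1 x"
  using A_mono_iff[of "kp 1 x" "Us (tau t) x" x] kp[of 1 x] Us_nonneg[of x "tau t"] tau_bounds(1)[of t]
  by (simp add: U_def A_Us)

lemma zx_bound: "\<bar>zx t x\<bar> \<le> 4"
proof (cases "x > 0 \<and> al (tau t) x < 1")
  case True
  define s where "s = tau t"
  have s: "0 < s" "s \<le> 1" using tau_bounds by (auto simp: s_def)
  \<comment> \<open>Before truncation the level is below 1, and this confines \<open>s * x\<close>
    to at most 2.\<close>
  have "(s * x)^2 < 2^2" using al_bounds(1)[of s x] True by (simp add: s_def power_mult_distrib)
  then have "s * x \<le> 2" using power2_less_imp_less[of "s * x" 2] by simp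
  then have "s * ((s * x) * pp s x) \<le> 1 * (2 * 2)"
    using s True pp_pos[of s x] pp_bounds[of s x] by (intro mult_mono) (linarith | simp)+
  moreover have "0 \<le> s * ((s * x) * pp s x)" using s True pp_pos[of s x] by simp
  ultimately show ?thesis using True by (simp add: zx_def s_def[symmetric] power2_eq_square mult.assoc)
qed (auto simp: zx_def)

lemma U_measurable: "(\<lambda>(t, x). U t x) \<in> borel_measurable borel"
proof -
  have [measurable]: "kp 1 \<in> borel_measurable borel" by (rule state_measurable[of _ 1]) auto
  show ?thesis
    unfolding U_def Us_def h_def dd_def dl_def borel_prod[symmetric] by measurable
qed

lemma zz_measurable: "(\<lambda>(t, x). zz t x) \<in> borel_measurable borel"
  unfolding zz_def al_def h1_def ee_def sg_def borel_prod[symmetric] by measurable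

lemma zx_measurable: "(\<lambda>(t, x). zx t x) \<in> borel_measurable borel"
  unfolding zx_def pp_def dl_def al_def h1_def ee_def sg_def borel_prod[symmetric] by measurable

lemma U_continuous_t: "continuous_on {0..} (\<lambda>t. U t x)"
proof (cases "x \<le> 0")
  case False
  have "continuous_on UNIV (\<lambda>s. Us s x)"
    using Us_ds by (meson DERIV_isCont continuous_at_imp_continuous_on)
  then have "continuous_on {0..} (\<lambda>t. Us (tau t) x)"
    by (rule continuous_on_compose2[OF _ tau_continuous]) auto
  then show ?thesis using False by (auto simp: U_def intro!: continuous_intros)
qed (simp add: U_def)

lemma Us_tau_deriv:
  assumes "x > 0" "t > 0"
  shows "((\<lambda>t. Us (tau t) x) has_real_derivative - ((tau t)^2 * x * pp (tau t) x)) (at t)"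
  using DERIV_chain2[OF Us_ds tau_deriv[OF assms(2)], of x] by (simp add: algebra_simps)

lemma al_tau_deriv:
  assumes "x > 0" "t > 0"
  shows "((\<lambda>t. al (tau t) x) has_real_derivative - ((tau t)^2 * (x^2 * nn (tau t) x))) (at t)"
  using DERIV_chain2[OF al_ds[OF assms(1)] tau_deriv[OF assms(2)]] by (simp add: algebra_simps)

text \<open>Strict monotonicity in \<open>s\<close> allows each level at most once along a line.
  These one-point sets, and the analogous ones in \<open>x\<close>, are the exceptional sets for
  \<open>conservation\<close>.\<close>

lemma al_level_finite_t:
  assumes "x > 0" shows "finite {t. 0 < t \<and> al (tau t) x = c}"
proof (rule finite_subset)
  define t0 where "t0 = (THE t. 0 < t \<and> al (tau t) x = c)"
  show "{t. 0 < t \<and> al (tau t) x = c} \<subseteq> {t0}"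
  proof
    fix t assume t: "t \<in> {t. 0 < t \<and> al (tau t) x = c}"
    have "t' = t" if "0 < t'" "al (tau t') x = c" for t'
      using al_mono_s[OF assms, of "tau t" "tau t'"] al_mono_s[OF assms, of "tau t'" "tau t"]
        tau_bounds(1)[of t] tau_bounds(1)[of t'] t that tau_inj[of t t']
      by (cases "tau t" "tau t'" rule: linorder_cases) auto
    then have "t0 = t" unfolding t0_def using t by (intro the_equality) auto
    then show "t \<in> {t0}" by simp
  qed
qed simp

lemma al_level_finite_x: "finite {x. 0 < x \<and> al (tau t) x = c}"
proof (rule finite_subset)
  define x0 where "x0 = (THE x. 0 < x \<and> al (tau t) x = c)"
  show "{x. 0 < x \<and> al (tau t) x = c} \<subseteq> {x0}"
  proof
    fix x assume x: "x \<in> {x. 0 < x \<and> al (tau t) x = c}"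
    have "x' = x" if "0 < x'" "al (tau t) x' = c" for x'
      using al_mono_x[of x x' "tau t"] al_mono_x[of x' x "tau t"] tau_bounds(1)[of t] x that
      by (cases x x' rule: linorder_cases) auto
    then have "x0 = x" unfolding x0_def using x by (intro the_equality) auto
    then show "x \<in> {x0}" by simp
  qed
qed simp

lemma U_deriv_t:
  assumes "0 < t" "x > 0 \<Longrightarrow> al (tau t) x \<noteq> 1"
  shows "((\<lambda>t. U t x) has_real_derivative - zx t x) (at t)"
proof (cases "x \<le> 0")
  case True
  then show ?thesis by (simp add: U_def zx_def)
next
  case x: False
  have c: "continuous_on {0<..} (\<lambda>t. al (tau t) x)"
    using al_tau_deriv[of x] x by (meson DERIV_isCont continuous_at_imp_continuous_on greaterThan_iff not_le)
  show ?thesis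
  proof (cases "al (tau t) x < 1")
    case True
    have o: "open {t \<in> {0<..}. al (tau t) x < 1}"
      using continuous_open_preimage[OF c, of "{..<1}"] by (simp add: vimage_def Int_def)
    have "((\<lambda>t. Us (tau t) x) has_real_derivative - zx t x) (at t)"
      using Us_tau_deriv[of x t] x True assms(1) by (simp add: zx_def)
    then show ?thesis
      by (rule has_field_derivative_transform_within_open[OF _ o]) (use True x assms(1) in \<open>auto simp: U_eq_Us\<close>)
  next
    case False
    have o: "open {t \<in> {0<..}. al (tau t) x > 1}"
      using continuous_open_preimage[OF c, of "{1<..}"] by (simp add: vimage_def Int_def)
    have "((\<lambda>t. kp 1 x) has_real_derivative - zx t x) (at t)"
      using False by (simp add: zx_def)
    then show ?thesis
      by (rule has_field_derivative_transform_within_open[OF _ o]) (use False x assms in \<open>auto simp: U_eq_kp\<close>)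
  qed
qed

lemma al_continuous_x: "continuous_on {0<..} (\<lambda>x. al s x)"
  using al_dx by (meson DERIV_isCont continuous_at_imp_continuous_on greaterThan_iff)

lemma zz_deriv_x:
  assumes "x \<noteq> 0" "x > 0 \<Longrightarrow> al (tau t) x \<noteq> 1"
  shows "((\<lambda>x. zz t x) has_real_derivative zx t x) (at x)"
proof -
  consider "x < 0" | "x > 0" "al (tau t) x < 1" | "x > 0" "al (tau t) x > 1"
    using assms by fastforce
  then show ?thesis
  proof cases
    case 1
    have "((\<lambda>x. 0) has_real_derivative zx t x) (at x)" using 1 by (simp add: zx_def)
    then show ?thesis
      by (rule has_field_derivative_transform_within_open[of _ _ _ "{..<0}"]) (use 1 in \<open>auto simp: zz_def\<close>)
  next
    case 2
    have o: "open {x \<in> {0<..}. al (tau t) x < 1}"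
      using continuous_open_preimage[OF al_continuous_x, of "{..<1}"] by (simp add: vimage_def Int_def)
    have "((\<lambda>x. al (tau t) x) has_real_derivative zx t x) (at x)"
      using al_dx[of x "tau t"] 2 by (simp add: zx_def)
    then show ?thesis
      by (rule has_field_derivative_transform_within_open[OF _ o]) (use 2 in \<open>auto simp: zz_def\<close>)
  next
    case 3
    have o: "open {x \<in> {0<..}. al (tau t) x > 1}"
      using continuous_open_preimage[OF al_continuous_x, of "{1<..}"] by (simp add: vimage_def Int_def)
    have "((\<lambda>x. 1) has_real_derivative zx t x) (at x)" using 3 by (simp add: zx_def)
    then show ?thesis
      by (rule has_field_derivative_transform_within_open[OF _ o]) (use 3 in \<open>auto simp: zz_def\<close>)
  qed
qed

lemma zz_continuous_x: "continuous_on UNIV (\<lambda>x. zz t x)"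
proof -
  have "isCont (\<lambda>x. zz t x) x" for x
  proof -
    consider "x < 0" | "x > 0" | "x = 0" by linarith
    then show ?thesis
    proof cases
      case 1
      then show ?thesis using zz_deriv_x[of x t] DERIV_isCont by force
    next
      case 2
      have "continuous_on {0<..} (\<lambda>x. min (al (tau t) x) 1)"
        by (intro continuous_intros al_continuous_x)
      then have "continuous_on {0<..} (\<lambda>x. zz t x)"
        by (rule continuous_on_eq) (auto simp: zz_def)
      then show ?thesis using 2 by (simp add: continuous_on_eq_continuous_at)
    next
      case 3
      have "((\<lambda>x. zz t x) \<longlongrightarrow> 0) (at 0)"
      proof (rule Lim_null_comparison)
        have "\<bar>zz t x\<bar> \<le> x^2" for x
        proof -
          have "(tau t)^2 * x^2 \<le> 1 * x^2"
            using tau_bounds[of t] by (intro mult_right_mono) (auto simp: power_le_one)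
          then have "min (al (tau t) x) 1 \<le> x^2"
            using al_bounds(2)[of "tau t" x] by linarith
          then show ?thesis
            using zz_bounds(1)[of t x] by (simp add: zz_def)
        qed
        then show "\<forall>\<^sub>F x in at 0. norm (zz t x) \<le> x^2" by simp
        have "((\<lambda>x::real. x^2) \<longlongrightarrow> 0^2) (at 0)" by (intro tendsto_intros)
        then show "((\<lambda>x::real. x^2) \<longlongrightarrow> 0) (at 0)" by simp
      qed
      then show ?thesis using 3 by (simp add: isCont_def zz_def)
    qed
  qed
  then show ?thesis by (simp add: continuous_at_imp_continuous_on)
qed

section \<open>Entropy equality for the explicit solution\<close>

lemma DERIV_abs:
  fixes f :: "real \<Rightarrow> real"
  assumes "(f has_real_derivative D) (at t)" "f t \<noteq> 0"
  shows "((\<lambda>t. \<bar>f t\<bar>) has_real_derivative sgn (f t) * D) (at t)"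
proof -
  have "(abs has_real_derivative sgn (f t)) (at (f t))"
  proof (cases "f t > 0")
    case True
    then have "((\<lambda>y. y) has_real_derivative sgn (f t)) (at (f t))" by (simp add: DERIV_ident)
    then show ?thesis
      by (rule has_field_derivative_transform_within_open[where S = "{0<..}"]) (use True in auto)
  next
    case False
    then have "((\<lambda>y. - y) has_real_derivative sgn (f t)) (at (f t))"
      using assms(2) by (auto intro!: derivative_eq_intros)
    then show ?thesis
      by (rule has_field_derivative_transform_within_open[where S = "{..<0}"]) (use False assms(2) in auto)
  qed
  from DERIV_chain2[OF this assms(1)] show ?thesis .
qed

text \<open>\<open>U\<close> has no shocks, so each Kruzhkov inequality is an equality. Against an
  upper state both \<open>U\<close> and \<open>k\<close> lie on the increasing branch of the flux;
  the entropy flux is then \<open>\<bar>zz - \<alpha>\<bar>\<close>, with the same sign factor as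
  the entropy. Against a lower state, \<open>k \<le> 0 \<le> U\<close> removes the modulus. Both
  cases are instances of \<open>conservation\<close>.\<close>

lemma U_entropy:
  assumes \<alpha>: "0 \<le> \<alpha>" and k: "k \<in> stationary_states A (\<lambda>_. 0) (\<lambda>_. 0) \<alpha>" and \<phi>: "\<phi> \<in> test_functions"
  shows "(LINT (t, x):({0<..} \<times> UNIV)|lebesgue.
                \<bar>U t x - k x\<bar> * dt \<phi> t x
                + sgn (U t x - k x) * (A x (U t x) - \<alpha>) * dx \<phi> t x)
            + (LINT x|lebesgue. \<bar>U 0 x - k x\<bar> * \<phi> (0, x)) = 0"
proof -
  note ks = stationary_states_iff[OF \<alpha> k]
  have mk: "k \<in> borel_measurable borel" by (rule state_measurable[OF ks \<alpha>])
  have kA: "A x (k x) = \<alpha>" for x using ks kp[OF \<alpha>] by auto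
  have kb: "\<bar>k x\<bar> \<le> 2 * sqrt \<alpha>" for x by (rule state_bound[OF kA])
  have mW: "(\<lambda>(t, x). \<bar>U t x - k x\<bar>) \<in> borel_measurable borel"
  proof -
    note [measurable] = mk U_measurable[unfolded borel_prod[symmetric]]
    have "(\<lambda>p. \<bar>(\<lambda>(t, x). U t x) p - k (snd p)\<bar>) \<in> borel_measurable (borel \<Otimes>\<^sub>M borel)"
      by measurable
    then show ?thesis by (simp add: case_prod_beta borel_prod)
  qed
  have bW: "\<bar>\<bar>U t x - k x\<bar>\<bar> \<le> 2 + 2 * sqrt \<alpha>" for t x
    using U_bound[of t x] kb[of x] by linarith
  from ks show ?thesis
  proof
    assume k_eq: "k = kp \<alpha>"
    have k0: "0 \<le> k x" for x using k_eq kp(1)[OF \<alpha>] by simp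
    have sg: "sgn (U t x - k x) = sgn (zz t x - \<alpha>)" for t x
    proof -
      have "zz t x \<le> \<alpha> \<longleftrightarrow> U t x \<le> k x" "\<alpha> \<le> zz t x \<longleftrightarrow> k x \<le> U t x"
        using A_mono_iff[of "U t x" "k x" x] A_mono_iff[of "k x" "U t x" x] k0[of x] U_nonneg[of t x]
        unfolding kA A_U by simp_all
      then show ?thesis by (auto simp: sgn_if)
    qed
    have "(LINT (t, x):({0<..} \<times> UNIV)|lebesgue.
                \<bar>U t x - k x\<bar> * dt \<phi> t x
                + \<bar>zz t x - \<alpha>\<bar> * dx \<phi> t x)
            + (LINT x|lebesgue. \<bar>U 0 x - k x\<bar> * \<phi> (0, x)) = 0"
    proof (rule conservation[OF \<phi> mW, where G = "\<lambda>t x. sgn (zz t x - \<alpha>) * zx t x" and B = "4 + \<alpha> + 2 * sqrt \<alpha>"])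
      have "(\<lambda>p. \<bar>(\<lambda>(t, x). zz t x) p - \<alpha>\<bar>) \<in> borel_measurable borel"
        using zz_measurable by simp
      then show "(\<lambda>(t, x). \<bar>zz t x - \<alpha>\<bar>) \<in> borel_measurable borel" by (simp add: case_prod_beta)
      have "(\<lambda>p. sgn ((\<lambda>(t, x). zz t x) p - \<alpha>) * (\<lambda>(t, x). zx t x) p) \<in> borel_measurable borel"
        using zz_measurable zx_measurable by measurable
      then show "(\<lambda>(t, x). sgn (zz t x - \<alpha>) * zx t x) \<in> borel_measurable borel"
        by (simp add: case_prod_beta)
      fix t x :: real
      show "\<bar>\<bar>U t x - k x\<bar>\<bar> \<le> 4 + \<alpha> + 2 * sqrt \<alpha>" using bW[of t x] \<alpha> by linarith
      show "\<bar>\<bar>zz t x - \<alpha>\<bar>\<bar> \<le> 4 + \<alpha> + 2 * sqrt \<alpha>"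
        using zz_bounds[of t x] \<alpha> real_sqrt_ge_zero[OF \<alpha>] by linarith
      have "\<bar>sgn (zz t x - \<alpha>) * zx t x\<bar> \<le> \<bar>zx t x\<bar>" by (simp add: abs_mult abs_sgn_eq)
      then show "\<bar>sgn (zz t x - \<alpha>) * zx t x\<bar> \<le> 4 + \<alpha> + 2 * sqrt \<alpha>"
        using zx_bound[of t x] \<alpha> real_sqrt_ge_zero[OF \<alpha>] by linarith
      show "continuous_on {0..} (\<lambda>t. \<bar>U t x - k x\<bar>)" by (intro continuous_intros U_continuous_t)
      show "continuous_on UNIV (\<lambda>x. \<bar>zz t x - \<alpha>\<bar>)" by (intro continuous_intros zz_continuous_x)
      show "\<exists>X. finite X \<and> (\<forall>t. 0 < t \<and> t \<notin> X \<longrightarrow>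
          ((\<lambda>t. \<bar>U t x - k x\<bar>) has_real_derivative - (sgn (zz t x - \<alpha>) * zx t x)) (at t))"
      proof (cases "x > 0")
        case True
        have D: "((\<lambda>t. \<bar>U t x - k x\<bar>) has_real_derivative - (sgn (zz t x - \<alpha>) * zx t x)) (at t)"
          if t: "0 < t" "al (tau t) x \<noteq> 1" "al (tau t) x \<noteq> \<alpha>" for t
        proof (cases "U t x - k x = 0")
          case False
          have "((\<lambda>t. U t x - k x) has_real_derivative - zx t x) (at t)"
            using DERIV_diff[OF U_deriv_t[of t x] DERIV_const[of "k x"]] t by simp
          from DERIV_abs[OF this False] show ?thesis by (simp add: sg)
        next
          case eq: True
          \<comment> \<open>With \<open>al\<close> different from \<open>\<alpha>\<close>, equality
            of \<open>U\<close> and \<open>k\<close> is possible only inside the truncated region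
            and for \<open>\<alpha> = 1\<close>. There \<open>U = k\<close> holds on an open set of
            times and both sides are 0.\<close>
          then have "zz t x = \<alpha>" using sg[of t x] by (simp add: sgn_eq_0_iff)
          then have gt: "1 < al (tau t) x" "\<alpha> = 1" using t True by (auto simp: zz_def min_def split: if_splits)
          have c: "continuous_on {0<..} (\<lambda>t. al (tau t) x)"
            using al_tau_deriv[of x] True by (meson DERIV_isCont continuous_at_imp_continuous_on greaterThan_iff)
          have o: "open {t \<in> {0<..}. al (tau t) x > 1}"
            using continuous_open_preimage[OF c, of "{1<..}"] by (simp add: vimage_def Int_def)
          have "((\<lambda>t. 0) has_real_derivative - (sgn (zz t x - \<alpha>) * zx t x)) (at t)"
            using gt by (simp add: zx_def)
          then show ?thesis
            by (rule has_field_derivative_transform_within_open[OF _ o])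
               (use gt t True eq in \<open>auto simp: U_eq_kp kp\<close>)
        qed
        show ?thesis
          using D al_level_finite_t[OF True, of 1] al_level_finite_t[OF True, of \<alpha>]
          by (intro exI[of _ "{t. 0 < t \<and> al (tau t) x = 1} \<union> {t. 0 < t \<and> al (tau t) x = \<alpha>}"]) auto
      qed (auto simp: U_def zx_def intro!: exI[of _ "{}"])
      show "\<exists>X. finite X \<and> (\<forall>x. x \<notin> X \<longrightarrow>
          ((\<lambda>x. \<bar>zz t x - \<alpha>\<bar>) has_real_derivative sgn (zz t x - \<alpha>) * zx t x) (at x))"
      proof -
        have D: "((\<lambda>x. \<bar>zz t x - \<alpha>\<bar>) has_real_derivative sgn (zz t x - \<alpha>) * zx t x) (at x)"
          if x: "x \<noteq> 0" "x > 0 \<Longrightarrow> al (tau t) x \<noteq> 1" "x > 0 \<Longrightarrow> al (tau t) x \<noteq> \<alpha>" for x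
        proof (cases "zz t x - \<alpha> = 0")
          case False
          have "((\<lambda>x. zz t x - \<alpha>) has_real_derivative zx t x) (at x)"
            using DERIV_diff[OF zz_deriv_x[of x t] DERIV_const[of \<alpha>]] x by simp
          from DERIV_abs[OF this False] show ?thesis .
        next
          case True
          \<comment> \<open>Off the level \<open>\<alpha>\<close> the flux equals
            \<open>\<alpha>\<close> only on its plateaus: the left half-line, and the truncated
            region.\<close>
          consider "x < 0" "\<alpha> = 0" | "x > 0" "al (tau t) x > 1" "\<alpha> = 1"
            using x True by (fastforce simp: zz_def min_def split: if_splits)
          then show ?thesis
          proof cases
            case 1
            have "((\<lambda>x. 0) has_real_derivative sgn (zz t x - \<alpha>) * zx t x) (at x)" using 1 by (simp add: zx_def)
            then show ?thesis
              by (rule has_field_derivative_transform_within_open[of _ _ _ "{..<0}"]) (use 1 in \<open>auto simp: zz_def\<close>)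
          next
            case 2
            have o: "open {x \<in> {0<..}. al (tau t) x > 1}"
              using continuous_open_preimage[OF al_continuous_x, of "{1<..}"] by (simp add: vimage_def Int_def)
            have "((\<lambda>x. 0) has_real_derivative sgn (zz t x - \<alpha>) * zx t x) (at x)" using 2 by (simp add: zx_def)
            then show ?thesis
              by (rule has_field_derivative_transform_within_open[OF _ o]) (use 2 in \<open>auto simp: zz_def\<close>)
          qed
        qed
        show ?thesis
          using D al_level_finite_x[of t 1] al_level_finite_x[of t \<alpha>]
          by (intro exI[of _ "insert 0 ({x. 0 < x \<and> al (tau t) x = 1} \<union> {x. 0 < x \<and> al (tau t) x = \<alpha>})"]) auto
      qed
    qed
    then show ?thesis
      by (simp add: sg A_U abs_sgn[symmetric] mult.commute[of "sgn _"])
  next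
    assume km: "\<forall>x. k x \<le> 0 \<and> A x (k x) = \<alpha>"
    have ge: "\<bar>U t x - k x\<bar> = U t x - k x" for t x using km U_nonneg[of t x] by (auto simp: abs_if) (smt (verit))
    have fl: "sgn (U t x - k x) * (A x (U t x) - \<alpha>) = zz t x - \<alpha>" for t x
    proof (cases "U t x = k x")
      case True
      then show ?thesis using kA[of x] A_U[of x t] by simp
    next
      case False
      then have "U t x - k x > 0" using km U_nonneg[of t x] by (smt (verit))
      then show ?thesis by (simp add: A_U)
    qed
    have "(LINT (t, x):({0<..} \<times> UNIV)|lebesgue.
                \<bar>U t x - k x\<bar> * dt \<phi> t x
                + (zz t x - \<alpha>) * dx \<phi> t x)
            + (LINT x|lebesgue. \<bar>U 0 x - k x\<bar> * \<phi> (0, x)) = 0"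
    proof (rule conservation[OF \<phi> mW, where G = zx and B = "4 + \<alpha> + 2 * sqrt \<alpha>"])
      have "(\<lambda>p. (\<lambda>(t, x). zz t x) p - \<alpha>) \<in> borel_measurable borel"
        using zz_measurable by simp
      then show "(\<lambda>(t, x). zz t x - \<alpha>) \<in> borel_measurable borel" by (simp add: case_prod_beta)
      show "(\<lambda>(t, x). zx t x) \<in> borel_measurable borel" by (rule zx_measurable)
      fix t x :: real
      show "\<bar>\<bar>U t x - k x\<bar>\<bar> \<le> 4 + \<alpha> + 2 * sqrt \<alpha>" using bW[of t x] \<alpha> by linarith
      show "\<bar>zz t x - \<alpha>\<bar> \<le> 4 + \<alpha> + 2 * sqrt \<alpha>"
        using zz_bounds[of t x] \<alpha> real_sqrt_ge_zero[OF \<alpha>] by linarith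
      show "\<bar>zx t x\<bar> \<le> 4 + \<alpha> + 2 * sqrt \<alpha>"
        using zx_bound[of t x] \<alpha> real_sqrt_ge_zero[OF \<alpha>] by linarith
      show "continuous_on {0..} (\<lambda>t. \<bar>U t x - k x\<bar>)" by (intro continuous_intros U_continuous_t)
      show "continuous_on UNIV (\<lambda>x. zz t x - \<alpha>)" by (intro continuous_intros zz_continuous_x)
      have fin: "finite {t. 0 < t \<and> x > 0 \<and> al (tau t) x = 1}"
        using al_level_finite_t[of x 1] by (cases "x > 0") auto
      have D: "((\<lambda>t. U t x - k x) has_real_derivative - zx t x) (at t)"
        if "0 < t" "x > 0 \<Longrightarrow> al (tau t) x \<noteq> 1" for t
        using DERIV_diff[OF U_deriv_t[of t x] DERIV_const[of "k x"]] that by simp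
      show "\<exists>X. finite X \<and> (\<forall>t. 0 < t \<and> t \<notin> X \<longrightarrow>
          ((\<lambda>t. \<bar>U t x - k x\<bar>) has_real_derivative - zx t x) (at t))"
        unfolding ge using fin D by (intro exI[of _ "{t. 0 < t \<and> x > 0 \<and> al (tau t) x = 1}"]) auto
      have "((\<lambda>x. zz t x - \<alpha>) has_real_derivative zx t x) (at x)"
        if "x \<noteq> 0" "x > 0 \<Longrightarrow> al (tau t) x \<noteq> 1" for x
        using DERIV_diff[OF zz_deriv_x[of x t] DERIV_const[of \<alpha>]] that by simp
      then show "\<exists>X. finite X \<and> (\<forall>x. x \<notin> X \<longrightarrow> ((\<lambda>x. zz t x - \<alpha>) has_real_derivative zx t x) (at x))"
        using al_level_finite_x[of t 1]
        by (intro exI[of _ "insert 0 {x. 0 < x \<and> al (tau t) x = 1}"]) auto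
    qed
    then show ?thesis by (simp only: fl)
  qed
qed

section \<open>One-sided entropy inequalities\<close>

lemma lborel_lebesgue_measurable: "f \<in> borel_measurable borel \<Longrightarrow> f \<in> borel_measurable lebesgue"
  by (simp add: measurable_completion)

lemma U_solution: "adapted_entropy_solution A (\<lambda>_. 0) (\<lambda>_. 0) (U 0) U"
  unfolding adapted_entropy_solution_def
proof (intro conjI allI impI ballI)
  show "(\<lambda>(t, x). U t x) \<in> borel_measurable (lebesgue_on ({0<..} \<times> UNIV))"
    by (intro measurable_restrict_space1 lborel_lebesgue_measurable U_measurable)
  show "\<exists>M. AE (t, x) in lebesgue_on ({0<..} \<times> UNIV). \<bar>U t x\<bar> \<le> M"
    using U_bound by (intro exI[of _ 2] AE_I2) auto
next
  fix T :: real assume "0 < T"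
  show "continuous_in_L1loc U T"
    unfolding continuous_in_L1loc_def
  proof (intro allI impI ballI conjI)
    fix K :: "real set" and t assume K: "compact K" and t: "t \<in> {0..T}"
    have Km: "K \<in> lmeasurable" using K by (rule lmeasurable_compact)
    have mU: "(\<lambda>x. U t x) \<in> borel_measurable borel" for t
      using measurable_compose[OF measurable_Pair1'[of t borel borel] U_measurable[unfolded borel_prod[symmetric]]]
      by simp
    have Ki: "set_integrable lebesgue K (\<lambda>x. c)" for c :: real
      unfolding set_integrable_def using Km by (simp add: lmeasurable_iff_integrable)
    have int: "set_integrable lebesgue K f" if "f \<in> borel_measurable borel" "\<And>x. x \<in> K \<Longrightarrow> \<bar>f x\<bar> \<le> c" for f :: "real \<Rightarrow> real" and c
    proof (rule set_integrable_bound[OF Ki[of c]])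
      show "set_borel_measurable lebesgue K f"
        unfolding set_borel_measurable_def using lborel_lebesgue_measurable[OF that(1)] Km by (simp add: fmeasurableD)
      show "AE x in lebesgue. x \<in> K \<longrightarrow> norm (f x) \<le> norm c"
        using that(2) by (intro AE_I2) force
    qed
    show "set_integrable lebesgue K (U t)"
      by (rule int[OF mU, of _ 2]) (rule U_bound)
    obtain D where D: "0 < D" "\<And>x. x \<in> K \<Longrightarrow> \<bar>x\<bar> \<le> D"
      using compact_imp_bounded[OF K] by (auto simp: bounded_pos)
    have dU: "\<bar>U s x - U t x\<bar> \<le> 2 * D * \<bar>tau s - tau t\<bar>" if "x \<in> K" for s x
    proof (cases "x \<le> 0")
      case True
      then show ?thesis using D(1) by (simp add: U_def)
    next
      case False
      \<comment> \<open>Both times are truncated by the same \<open>kp 1 x\<close>, and truncation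
        does not increase distances.\<close>
      have "\<bar>U s x - U t x\<bar> \<le> \<bar>Us (tau s) x - Us (tau t) x\<bar>"
        using False by (auto simp: U_def min_def)
      also have "\<dots> \<le> 2 * x * \<bar>tau s - tau t\<bar>" using False by (intro Us_Lipschitz) auto
      also have "\<dots> \<le> 2 * D * \<bar>tau s - tau t\<bar>" using D(2)[OF that] False by (intro mult_right_mono) auto
      finally show ?thesis .
    qed
    have bound: "\<bar>LINT x:K|lebesgue. \<bar>U s x - U t x\<bar>\<bar> \<le> 2 * D * \<bar>tau s - tau t\<bar> * measure lebesgue K" for s
    proof -
      have "(LINT x:K|lebesgue. \<bar>U s x - U t x\<bar>) \<le> (LINT x:K|lebesgue. 2 * D * \<bar>tau s - tau t\<bar>)"
        by (rule set_integral_mono[OF int[of _ 4] Ki])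
           (use dU mU order_trans[OF abs_triangle_ineq4 add_mono[OF U_bound[of s] U_bound[of t]]] in auto)
      also have "\<dots> = 2 * D * \<bar>tau s - tau t\<bar> * measure lebesgue K"
        using Km unfolding set_lebesgue_integral_def by (simp add: fmeasurableD)
      finally have "(LINT x:K|lebesgue. \<bar>U s x - U t x\<bar>) \<le> 2 * D * \<bar>tau s - tau t\<bar> * measure lebesgue K" .
      moreover have "0 \<le> (LINT x:K|lebesgue. \<bar>U s x - U t x\<bar>)"
        unfolding set_lebesgue_integral_def by (intro integral_nonneg_AE AE_I2) auto
      ultimately show ?thesis by simp
    qed
    show "((\<lambda>s. LINT x:K|lebesgue. \<bar>U s x - U t x\<bar>) \<longlongrightarrow> 0) (at t within {0..T})"
    proof (rule Lim_null_comparison)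
      show "\<forall>\<^sub>F s in at t within {0..T}. norm (LINT x:K|lebesgue. \<bar>U s x - U t x\<bar>) \<le> 2 * D * \<bar>tau s - tau t\<bar> * measure lebesgue K"
        using bound by simp
      have "(tau \<longlongrightarrow> tau t) (at t within {0..T})"
        using tau_continuous[of "{0..T}"] t by (simp add: continuous_on_def)
      then have "((\<lambda>s. 2 * D * \<bar>tau s - tau t\<bar> * measure lebesgue K) \<longlongrightarrow> 2 * D * \<bar>tau t - tau t\<bar> * measure lebesgue K) (at t within {0..T})"
        by (intro tendsto_intros)
      then show "((\<lambda>s. 2 * D * \<bar>tau s - tau t\<bar> * measure lebesgue K) \<longlongrightarrow> 0) (at t within {0..T})"
        by simp
    qed
  qed
qed (use U_entropy in simp)

text \<open>By \<open>A_upper\<close> the state is at least 1, where \<open>A_u \<ge> 1/2\<close>; a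
  change of the flux by \<open>d\<close> therefore moves the state by at most \<open>2 * d\<close>.
  As the state is at most 2, the constant in \<open>A_variation\<close> is 32 * (1 + 8) = 288, and
  doubling gives 576.\<close>

lemma kp1_variation: "\<bar>kp 1 x - kp 1 y\<bar> \<le> 576 * \<bar>aa x - aa y\<bar>"
proof -
  have "kp 1 x \<le> kp 1 y + 576 * \<bar>aa x - aa y\<bar>" for x y
  proof (cases "kp 1 y < kp 1 x")
    case True
    have 1: "1 \<le> kp 1 y" using A_upper[of y "kp 1 y"] kp[of 1 y] power_le_one_iff[of "kp 1 y" 2] by (cases "kp 1 y < 1") (auto simp: power_strict_mono dest: power_strict_mono[of "kp 1 y" 1 2])
    have "\<bar>kp 1 x\<bar> ^ 3 \<le> 2 ^ 3" using kp1_bound[of x] kp(1)[of 1 x] by (intro power_mono) auto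
    then have "32 * (1 + \<bar>kp 1 x\<bar> ^ 3) * \<bar>aa x - aa y\<bar> \<le> 288 * \<bar>aa x - aa y\<bar>" by (intro mult_right_mono) auto
    then have "A y (kp 1 x) \<le> 1 + 288 * \<bar>aa x - aa y\<bar>"
      using A_variation[of x "kp 1 x" y] kp(2)[of 1 x] by linarith
    moreover have "1 + 1/2 * (kp 1 x - kp 1 y) \<le> A y (kp 1 x)"
    proof -
      have "1/2 * (kp 1 x - kp 1 y) \<le> Au y (kp 1 y) * (kp 1 x - kp 1 y)"
        using Au_bounds(1)[of "kp 1 y" y] 1 True by (intro mult_right_mono) auto
      then show ?thesis using A_tangent[of y "kp 1 y" "kp 1 x"] kp(2)[of 1 y] by linarith
    qed
    moreover have "a \<le> b + 576 * d" if "c \<le> 1 + 288 * d" "1 + 1/2 * (a - b) \<le> c" for a b c d :: real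
      using that by (simp add: field_simps)
    ultimately show ?thesis by blast
  qed (simp add: add_increasing2)
  from this[of x y] this[of y x] show ?thesis by (simp add: abs_le_iff abs_minus_commute)
qed

lemma U0_BV: "U 0 \<in> BV"
proof (rule BV_dominated)
  define p where "p x = min (max 0 x) 2 + 576 * aa x" for x
  show "mono p" using aa_mono by (auto simp: p_def mono_def intro!: add_mono)
  show "\<bar>p x\<bar> \<le> 2 + 576 * 2" for x using aa_bound[of x] by (auto simp: p_def abs_le_iff)
  have t0: "tau 0 = 1" by (simp add: tau_def)
  have "Us 1 x = x" for x by (simp add: Us_def h_def)
  \<comment> \<open>Cutting \<open>x\<close> at 2 does not change the minimum, because
    \<open>kp 1\<close> never exceeds 2, and it makes the dominating function bounded.\<close>
  then have U0: "U 0 x = min (min (max 0 x) 2) (kp 1 x)" for x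
    using kp1_bound[of x] kp(1)[of 1 x] by (auto simp: U_def t0 min_def max_def)
  fix x y :: real
  have "\<bar>U 0 x - U 0 y\<bar> \<le> \<bar>p x - p y\<bar>" if "x \<le> y" for x y
  proof -
    have "\<bar>U 0 x - U 0 y\<bar> \<le> \<bar>min (max 0 x) 2 - min (max 0 y) 2\<bar> + \<bar>kp 1 x - kp 1 y\<bar>"
      unfolding U0 min_def by auto
    also have "\<dots> \<le> (min (max 0 y) 2 - min (max 0 x) 2) + 576 * (aa y - aa x)"
      using kp1_variation[of x y] monoD[OF aa_mono that] that by (auto simp: min_def max_def)
    finally show ?thesis by (simp add: p_def)
  qed
  from this[of x y] this[of y x] show "\<bar>U 0 x - U 0 y\<bar> \<le> \<bar>p x - p y\<bar>"
    unfolding abs_minus_commute[of "U 0 y"] abs_minus_commute[of "p y"] by (cases "x \<le> y") simp_all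
qed

section \<open>Smooth cutoffs that move with the characteristics\<close>

definition sg0 :: "real \<Rightarrow> real" where "sg0 t = inverse (1 + t)"

text \<open>A function of the flux level alone, hence constant along the characteristics of the
  explicit solution. \<open>sg0\<close> is used because test functions must be smooth across
  \<open>t = 0\<close>.\<close>

definition Th :: "real \<Rightarrow> real \<times> real \<Rightarrow> real" where
  "Th a p = (if snd p > 0 then f0 (al (sg0 (fst p)) (snd p) - a) else 0)"

lemma smooth_al: "smooth_on ({-1<..} \<times> {0<..}) (\<lambda>p. al (sg0 (fst p)) (snd p))"
proof -
  let ?S = "{-1<..} \<times> {0::real<..} :: (real \<times> real) set"
  have o: "open ?S" by (intro open_Times) auto
  have f: "smooth_on ?S fst" "smooth_on ?S snd"
    by (rule smooth_on_linear[OF o bounded_linear_fst] smooth_on_linear[OF o bounded_linear_snd])+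
  note c = smooth_on_const[OF o]
  have s: "smooth_on ?S (\<lambda>p. sg0 (fst p))"
    unfolding sg0_def
    by (rule smooth_on_compose[OF smooth_on_inverse smooth_on_add[OF c f(1)]]) auto
  have "smooth_on ?S (\<lambda>p. exp (0 - sg0 (fst p) ^ 2))"
    by (rule smooth_on_compose[OF smooth_on_exp smooth_on_diff[OF c smooth_on_power[OF s]]]) auto
  then have h: "smooth_on ?S (\<lambda>p. h1 (sg0 (fst p)))"
    unfolding h1_def by (intro smooth_on_mult smooth_on_diff smooth_on_add smooth_on_power s c) simp
  have "smooth_on ?S (\<lambda>p. inverse (snd p))"
    by (rule smooth_on_compose[OF smooth_on_inverse f(2)]) auto
  then have "smooth_on ?S (\<lambda>p. cos (inverse (snd p)))"
    by (rule smooth_on_compose[OF smooth_on_cos]) auto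
  then have "smooth_on ?S (\<lambda>p. ee (snd p))"
    unfolding ee_def sg_def by (intro smooth_on_mult smooth_on_diff smooth_on_power f c) (simp add: inverse_eq_divide)
  then have "smooth_on ?S (\<lambda>p. sg0 (fst p) ^ 2 * (snd p ^ 2 * (1/2) + h1 (sg0 (fst p)) * ee (snd p)))"
    by (intro smooth_on_mult smooth_on_add smooth_on_power f c s h)
  then show ?thesis by (simp add: al_def)
qed

text \<open>Three open pieces cover the strip: \<open>x > 0\<close>, where all ingredients are
  smooth; \<open>x < 0\<close>, where the function is 0; and the set where
  \<open>(s * x)^2 < a\<close>. The last one contains the line \<open>x = 0\<close>, and the level
  is below \<open>a\<close> on its part with \<open>x > 0\<close>, so the function vanishes there
  and the singularity of \<open>e\<close> at 0 is never met.\<close>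

lemma smooth_Th:
  assumes "a > 0" shows "smooth_on ({-1<..} \<times> UNIV) (Th a)"
proof -
  let ?P = "{-1<..} \<times> {0::real<..} :: (real \<times> real) set"
  let ?N = "{-1<..} \<times> {..<0::real} :: (real \<times> real) set"
  let ?Z = "{p \<in> {-1<..} \<times> (UNIV :: real set). (sg0 (fst p) * snd p)^2 < a}"
  have oT: "open ({-1<..} \<times> (UNIV :: real set) :: (real \<times> real) set)" by (intro open_Times) auto
  have 1: "smooth_on ?P (Th a)"
  proof (rule smooth_on_cong)
    show "smooth_on ?P (\<lambda>p. f0 (al (sg0 (fst p)) (snd p) - a))"
      by (rule smooth_on_compose[OF smooth_on_flat smooth_on_diff[OF smooth_al smooth_on_const]])
         (auto intro!: open_Times)
  qed (auto simp: Th_def)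
  have 2: "smooth_on ?N (Th a)"
    by (rule smooth_on_cong[OF smooth_on_const[of _ 0]]) (auto simp: Th_def intro!: open_Times)
  have oZ: "open ?Z"
  proof -
    have "continuous_on ({-1<..} \<times> (UNIV :: real set)) (\<lambda>p. (sg0 (fst p) * snd p)^2)"
      unfolding sg0_def by (intro continuous_intros) auto
    from continuous_open_preimage[OF this oT, of "{..<a}"] show ?thesis
      by (simp add: vimage_def Int_def)
  qed
  have 3: "smooth_on ?Z (Th a)"
  proof (rule smooth_on_cong[OF smooth_on_const[OF oZ, of 0]])
    fix p assume "p \<in> ?Z"
    then have "al (sg0 (fst p)) (snd p) \<le> a"
      using al_bounds(2)[of "sg0 (fst p)" "snd p"] by (simp add: power_mult_distrib)
    then show "0 = Th a p" by (simp add: Th_def flat_zero_iff)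
  qed
  have "?P \<union> ?N \<union> ?Z = {-1<..} \<times> (UNIV :: real set)"
  proof (intro equalityI subsetI)
    fix p :: "real \<times> real" assume "p \<in> {-1<..} \<times> (UNIV :: real set)"
    then show "p \<in> ?P \<union> ?N \<union> ?Z"
      using assms by (cases p; cases "snd p > 0"; cases "snd p < 0") auto
  qed auto
  then show ?thesis using smooth_on_Un[OF smooth_on_Un[OF 1 2] 3] by simp
qed

lemma sg0_eq: "0 \<le> t \<Longrightarrow> sg0 t = tau t"
  by (simp add: sg0_def tau_def)

definition alt :: "real \<Rightarrow> real \<Rightarrow> real" where
  "alt t x = (if x > 0 then - ((tau t)^2 * (x^2 * nn (tau t) x)) else 0)"
definition alx :: "real \<Rightarrow> real \<Rightarrow> real" where
  "alx t x = (if x > 0 then (tau t)^2 * x * pp (tau t) x else 0)"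

text \<open>For \<open>z = A(x, u)\<close> the conservation law gives
  \<open>z_t = A_u * u_t = - A_u * z_x\<close>: the flux level is transported with the
  characteristic speed. Functions of the level inherit this equation, which is what qualifies them
  as moving cutoffs.\<close>

lemma alt_eq: "alt t x = - spd (tau t) x * alx t x"
  using pp_pos[of "tau t" x] by (simp add: alt_def alx_def spd_def field_simps power2_eq_square)

lemma Th_deriv:
  assumes "a > 0" "t > 0"
  shows "((\<lambda>t. Th a (t, x)) has_real_derivative flat 2 (al (tau t) x - a) * alt t x) (at t)"
    "((\<lambda>x. Th a (t, x)) has_real_derivative flat 2 (al (tau t) x - a) * alx t x) (at x)"
proof -
  show "((\<lambda>t. Th a (t, x)) has_real_derivative flat 2 (al (tau t) x - a) * alt t x) (at t)"
  proof (cases "x > 0")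
    case True
    have "((\<lambda>t. f0 (al (tau t) x - a)) has_real_derivative flat 2 (al (tau t) x - a) * alt t x) (at t)"
      using DERIV_chain2[OF f0_has_derivative DERIV_diff[OF al_tau_deriv[OF True assms(2)] DERIV_const[of a]]] True
      by (simp add: alt_def)
    then show ?thesis
      by (rule has_field_derivative_transform_within_open[of _ _ _ "{0<..}"])
         (use assms True in \<open>auto simp: Th_def sg0_eq\<close>)
  qed (simp add: Th_def alt_def)
  show "((\<lambda>x. Th a (t, x)) has_real_derivative flat 2 (al (tau t) x - a) * alx t x) (at x)"
  proof (cases "x > 0")
    case True
    have "((\<lambda>x. f0 (al (tau t) x - a)) has_real_derivative flat 2 (al (tau t) x - a) * alx t x) (at x)"
      using DERIV_chain2[OF f0_has_derivative DERIV_diff[OF al_dx[OF True] DERIV_const[of a]]] True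
      by (simp add: alx_def)
    then show ?thesis
      by (rule has_field_derivative_transform_within_open[of _ _ _ "{0<..}"])
         (use assms True in \<open>auto simp: Th_def sg0_eq\<close>)
  next
    case False
    have z: "((\<lambda>x. 0) has_real_derivative flat 2 (al (tau t) x - a) * alx t x) (at x)"
      using False by (simp add: alx_def)
    show ?thesis
    proof (rule has_field_derivative_transform_within_open[OF z])
      show "open {..<sqrt a}" "x \<in> {..<sqrt a}"
        using False le_less_trans[of x 0 "sqrt a"] assms(1) by simp_all
      fix y assume y: "y \<in> {..<sqrt a}"
      have "al (tau t) y \<le> a" if "y > 0"
      proof -
        have "y^2 \<le> (sqrt a)^2" using y that by (intro power_mono) auto
        then have "y^2 \<le> a" using assms(1) by simp
        moreover have "(tau t)^2 * y^2 \<le> 1 * y^2"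
          using tau_bounds[of t] by (intro mult_right_mono) (auto simp: power_le_one)
        ultimately show ?thesis using al_bounds(2)[of "tau t" y] by linarith
      qed
      then show "0 = Th a (t, y)" using assms(2) by (simp add: Th_def flat_zero_iff sg0_eq)
    qed
  qed
qed

text \<open>Since the bump \<open>gg\<close> is centred at a negative time, it decreases for positive times.\<close>

definition gg :: "real \<Rightarrow> real" where "gg t = f0 (1/2 - t) * f0 (3/4 + t)"
definition gg' :: "real \<Rightarrow> real" where
  "gg' t = f0 (1/2 - t) * flat 2 (3/4 + t) - flat 2 (1/2 - t) * f0 (3/4 + t)"

lemma gg_deriv: "(gg has_real_derivative gg' t) (at t)"
proof -
  have 1: "((\<lambda>t. f0 (1/2 - t)) has_real_derivative flat 2 (1/2 - t) * (0 - 1)) (at t)"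
    by (rule DERIV_chain2[OF f0_has_derivative DERIV_diff[OF DERIV_const DERIV_ident]])
  have 2: "((\<lambda>t. f0 (3/4 + t)) has_real_derivative flat 2 (3/4 + t) * (0 + 1)) (at t)"
    by (rule DERIV_chain2[OF f0_has_derivative DERIV_add[OF DERIV_const DERIV_ident]])
  show ?thesis
    unfolding gg_def[abs_def] gg'_def using DERIV_mult[OF 1 2] by (rule DERIV_cong) (simp add: algebra_simps)
qed

lemma gg_nonneg: "0 \<le> gg t"
  by (simp add: gg_def flat_nonneg)

lemma gg_support: "gg t \<noteq> 0 \<Longrightarrow> -3/4 < t \<and> t < 1/2"
  by (auto simp: gg_def flat_zero_iff)

lemma gg'_neg: "0 < t \<Longrightarrow> t < 1/2 \<Longrightarrow> gg' t < 0"
proof -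
  assume t: "0 < t" "t < 1/2"
  have "inverse (3/4 + t) < inverse (1/2 - t)" using t by (intro less_imp_inverse_less) auto
  then have "inverse (3/4 + t) ^ 2 < inverse (1/2 - t) ^ 2" using t by (intro power_strict_mono) auto
  then have "f0 (1/2 - t) * f0 (3/4 + t) * (inverse (3/4 + t) ^ 2 - inverse (1/2 - t) ^ 2) < 0"
    using t by (intro mult_pos_neg mult_pos_pos) (auto simp: flat_pos_iff)
  then show ?thesis using t by (simp add: gg'_def flat_def algebra_simps)
qed

lemma gg'_nonpos: "0 < t \<Longrightarrow> gg' t \<le> 0"
  using gg'_neg[of t] by (cases "t < 1/2") (auto simp: gg'_def flat_def)

lemma smooth_gg: "smooth_on UNIV (\<lambda>p::real\<times>real. gg (fst p))"
proof -
  note f = smooth_on_linear[OF open_UNIV bounded_linear_fst] and c = smooth_on_const[OF open_UNIV]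
  show ?thesis unfolding gg_def
    by (intro smooth_on_mult smooth_on_compose[OF smooth_on_flat] smooth_on_diff smooth_on_add f c) auto
qed

section \<open>One-sided inequalities for an arbitrary solution\<close>

lemma plane_state_measurable:
  assumes "k \<in> borel_measurable borel"
  shows "(\<lambda>p :: real \<times> real. k (snd p)) \<in> borel_measurable lebesgue"
proof -
  have m: "(\<lambda>p :: real \<times> real. k (snd p)) \<in> borel_measurable (borel \<Otimes>\<^sub>M borel)"
    by (rule measurable_compose[OF measurable_snd assms])
  show ?thesis by (rule lborel_lebesgue_measurable[OF m[unfolded borel_prod]])
qed

lemma integrable_half_entropy:
  fixes a b :: "real \<times> real \<Rightarrow> real"
  assumes \<phi>: "\<phi> \<in> test_functions" and m: "a \<in> borel_measurable lebesgue" "b \<in> borel_measurable lebesgue"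
    and bd: "AE p in lebesgue. \<bar>a p\<bar> \<le> C \<and> \<bar>b p\<bar> \<le> C"
  shows "integrable lebesgue (\<lambda>p. indicator ({0<..} \<times> UNIV) p *\<^sub>R
    (\<lambda>(t, x). a (t, x) * dt \<phi> t x + b (t, x) * dx \<phi> t x) p)"
proof -
  obtain R B where R: "0 < R" "0 \<le> B"
    "\<And>t x. \<bar>t\<bar> > R \<or> \<bar>x\<bar> > R \<Longrightarrow>
      \<phi> (t, x) = 0 \<and> dt \<phi> t x = 0 \<and> dx \<phi> t x = 0"
    "\<And>t x. \<bar>\<phi> (t, x)\<bar> \<le> B \<and> \<bar>dt \<phi> t x\<bar> \<le> B \<and> \<bar>dx \<phi> t x\<bar> \<le> B"
    by (rule test_function_support[OF \<phi>]) auto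
  let ?pt = "\<lambda>(t, x). dt \<phi> t x" and ?px = "\<lambda>(t, x). dx \<phi> t x"
  have eq: "(\<lambda>p. indicator ({0<..} \<times> UNIV) p *\<^sub>R
    (\<lambda>(t, x). a (t, x) * dt \<phi> t x + b (t, x) * dx \<phi> t x) p)
    = (\<lambda>p. indicator ({0<..} \<times> UNIV) p * (a p * ?pt p + b p * ?px p))"
    by (auto simp: fun_eq_iff)
  have "({0::real<..} \<times> (UNIV :: real set)) \<in> sets borel" by (intro borel_open open_Times) auto
  then have i: "(indicator ({0<..} \<times> UNIV) :: real \<times> real \<Rightarrow> real) \<in> borel_measurable lebesgue"
    by (intro lborel_lebesgue_measurable borel_measurable_indicator)
  show ?thesis
    unfolding eq
  proof (rule integrable_bounded_support[where R = R and C = "\<bar>C\<bar> * B + \<bar>C\<bar> * B"])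
    show "(\<lambda>p. indicator ({0<..} \<times> UNIV) p * (a p * ?pt p + b p * ?px p)) \<in> borel_measurable lebesgue"
      by (rule borel_measurable_times[OF i borel_measurable_add[OF
            borel_measurable_times[OF m(1) lborel_lebesgue_measurable[OF test_function_measurable(2)[OF \<phi>]]]
            borel_measurable_times[OF m(2) lborel_lebesgue_measurable[OF test_function_measurable(3)[OF \<phi>]]]]])
    show "AE p in lebesgue. \<bar>indicator ({0<..} \<times> UNIV) p * (a p * ?pt p + b p * ?px p)\<bar> \<le> \<bar>C\<bar> * B + \<bar>C\<bar> * B"
      using bd
    proof eventually_elim
      case (elim p)
      obtain t x where p: "p = (t, x)" by (cases p)
      have "\<bar>a p * ?pt p\<bar> \<le> \<bar>C\<bar> * B" "\<bar>b p * ?px p\<bar> \<le> \<bar>C\<bar> * B"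
        unfolding abs_mult using elim R(4)[of t x] R(2) by (auto intro!: mult_mono simp: p)
      then have "\<bar>a p * ?pt p + b p * ?px p\<bar> \<le> \<bar>C\<bar> * B + \<bar>C\<bar> * B" by linarith
      then show ?case using R(2) by (auto simp: indicator_def)
    qed
  qed (use R(3) in auto)
qed

lemma integrable_initial:
  fixes w :: "real \<Rightarrow> real"
  assumes \<phi>: "\<phi> \<in> test_functions" and m: "w \<in> borel_measurable borel" and bd: "\<And>x. \<bar>w x\<bar> \<le> C"
  shows "integrable lebesgue (\<lambda>x. w x * \<phi> (0, x))"
proof -
  obtain R B where R: "0 < R" "0 \<le> B"
    "\<And>t x. \<bar>t\<bar> > R \<or> \<bar>x\<bar> > R \<Longrightarrow>
      \<phi> (t, x) = 0 \<and> dt \<phi> t x = 0 \<and> dx \<phi> t x = 0"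
    "\<And>t x. \<bar>\<phi> (t, x)\<bar> \<le> B \<and> \<bar>dt \<phi> t x\<bar> \<le> B \<and> \<bar>dx \<phi> t x\<bar> \<le> B"
    by (rule test_function_support[OF \<phi>]) auto
  have m\<phi>: "(\<lambda>x. \<phi> (0, x)) \<in> borel_measurable borel"
    using measurable_compose[OF measurable_Pair1'[of 0 borel borel] test_function_measurable(1)[OF \<phi>, unfolded borel_prod[symmetric]]]
    by simp
  have "integrable lborel (\<lambda>x. w x * \<phi> (0, x))"
  proof (rule Bochner_Integration.integrable_bound[where f = "\<lambda>x. (\<bar>C\<bar> * B) * indicator {-R..R} x"])
    show "integrable lborel (\<lambda>x. (\<bar>C\<bar> * B) * indicator {-R..R} x :: real)"
      by (intro integrable_mult_right integrable_real_indicator) (auto simp: emeasure_lborel_Icc_eq)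
    show "(\<lambda>x. w x * \<phi> (0, x)) \<in> borel_measurable lborel" using m m\<phi> by simp
    show "AE x in lborel. norm (w x * \<phi> (0, x)) \<le> norm ((\<bar>C\<bar> * B) * indicator {-R..R} x)"
    proof (rule AE_I2)
      fix x
      have "\<bar>w x\<bar> \<le> \<bar>C\<bar>" using bd[of x] by linarith
      then have "\<bar>w x * \<phi> (0, x)\<bar> \<le> \<bar>C\<bar> * B"
        unfolding abs_mult using R(2) R(4)[of 0 x] by (intro mult_mono) auto
      then show "norm (w x * \<phi> (0, x)) \<le> norm ((\<bar>C\<bar> * B) * indicator {-R..R} x)"
        using R(2) R(3)[of 0 x] by (cases "\<bar>x\<bar> > R") (auto simp: indicator_def abs_mult)
    qed
  qed
  then show ?thesis using m m\<phi> by (simp add: integrable_completion)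
qed

lemma U0_measurable: "U 0 \<in> borel_measurable borel"
  using measurable_compose[OF measurable_Pair1'[of 0 borel borel] U_measurable[unfolded borel_prod[symmetric]]]
  by simp

lemma lower_state_exists:
  assumes "0 \<le> \<alpha>" obtains k where "\<And>x. k x \<le> 0 \<and> A x (k x) = \<alpha>"
proof -
  have "\<exists>u. u \<le> 0 \<and> A x u = \<alpha>" for x
  proof -
    have "\<alpha> \<le> A x (- 2 * sqrt \<alpha>)" using A_lower[of "- 2 * sqrt \<alpha>" x] assms by (simp add: power_mult_distrib)
    then show ?thesis
      using IVT2'[of "A x" 0 \<alpha> "- 2 * sqrt \<alpha>"] assms A_continuous_u[of _ x] by (auto simp: A_zero)
  qed
  then show ?thesis using that by metis
qed

lemma state_lower_bound: "A x u = M^2 \<Longrightarrow> M \<le> \<bar>u\<bar>"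
  using A_upper[of x u] power2_le_iff_abs_le[of "\<bar>u\<bar>" M] abs_le_square_iff[of M u] by auto

definition kruzhkov :: "(real \<times> real \<Rightarrow> real) \<Rightarrow> bool" where
  "kruzhkov v \<longleftrightarrow> (\<forall>\<alpha>\<ge>0. \<forall>k\<in>stationary_states A (\<lambda>_. 0) (\<lambda>_. 0) \<alpha>. \<forall>\<phi>\<in>test_functions.
      0 \<le> (LINT (t, x):({0<..} \<times> UNIV)|lebesgue. \<bar>v (t, x) - k x\<bar> * dt \<phi> t x
            + sgn (v (t, x) - k x) * (A x (v (t, x)) - \<alpha>) * dx \<phi> t x)
          + (LINT x|lebesgue. \<bar>U 0 x - k x\<bar> * \<phi> (0, x)))"

abbreviation pos_dist :: "real \<Rightarrow> real \<Rightarrow> (real \<times> real \<Rightarrow> real) \<Rightarrow> real \<times> real \<Rightarrow> real" where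
  "pos_dist \<sigma> \<alpha> v p \<equiv> max 0 (\<sigma> * (v p - kp \<alpha> (snd p)))"
abbreviation pos_flux :: "real \<Rightarrow> real \<Rightarrow> (real \<times> real \<Rightarrow> real) \<Rightarrow> real \<times> real \<Rightarrow> real" where
  "pos_flux \<sigma> \<alpha> v p \<equiv> if \<sigma> * (v p - kp \<alpha> (snd p)) > 0 then \<sigma> * (A (snd p) (v p) - \<alpha>) else 0"

text \<open>Adding the Kruzhkov inequality for a stationary state outside the range of the solution,
  on which the modulus is linear, leaves the one-sided inequality.\<close>

lemma half_entropy:
  fixes v :: "real \<times> real \<Rightarrow> real"
  assumes v: "v \<in> borel_measurable lebesgue" "AE p in lebesgue. \<bar>v p\<bar> \<le> M"
    and ent: "kruzhkov v"
    and \<sigma>: "\<sigma> = 1 \<or> \<sigma> = -1" and \<alpha>: "0 < \<alpha>" and \<phi>: "\<phi> \<in> test_functions"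
  shows "integrable lebesgue (\<lambda>p. indicator ({0<..} \<times> UNIV) p *\<^sub>R (\<lambda>(t, x).
        pos_dist \<sigma> \<alpha> v (t, x) * dt \<phi> t x + pos_flux \<sigma> \<alpha> v (t, x) * dx \<phi> t x) p)"
    "0 \<le> (LINT (t, x):({0<..} \<times> UNIV)|lebesgue.
        pos_dist \<sigma> \<alpha> v (t, x) * dt \<phi> t x + pos_flux \<sigma> \<alpha> v (t, x) * dx \<phi> t x)
      + (LINT x|lebesgue. max 0 (\<sigma> * (U 0 x - kp \<alpha> x)) * \<phi> (0, x))"
proof -
  \<comment> \<open>By \<open>A_upper\<close> a state at level \<open>N^2\<close> has modulus at
    least \<open>N\<close>, which exceeds both \<open>\<bar>v\<bar>\<close> and the bound 2 for
    \<open>U\<close>.\<close>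
  define N where "N = \<bar>M\<bar> + 3"
  define \<beta> where "\<beta> = N^2"
  have N: "N \<ge> 3" by (simp add: N_def)
  have \<beta>: "0 < \<beta>" using N by (simp add: \<beta>_def)
  obtain kl where kl: "\<And>x. kl x \<le> 0 \<and> A x (kl x) = \<beta>" using lower_state_exists[of \<beta>] \<beta> by auto
  \<comment> \<open>The state lies below the solution for \<open>\<sigma> = 1\<close> and above it
    for \<open>\<sigma> = -1\<close>; in both cases \<open>\<sigma> * (v - K)\<close> is
    positive.\<close>
  define K where "K = (if \<sigma> = 1 then kl else kp \<beta>)"
  have KA: "A x (K x) = \<beta>" for x using kl kp(2)[of \<beta> x] \<beta> by (auto simp: K_def)
  have Kst: "K \<in> stationary_states A (\<lambda>_. 0) (\<lambda>_. 0) \<beta>"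
    using kl kp_stationary[OF \<beta>] \<beta> by (auto simp: K_def stationary_states_def)
  have Kb: "\<sigma> * K x \<le> - N" for x
    using state_lower_bound[of x "K x" N] KA[of x] kl[of x] kp(1)[of \<beta> x] \<beta> \<sigma>
    by (auto simp: K_def \<beta>_def abs_if split: if_splits)
  have Ku: "\<bar>K x\<bar> \<le> 2 * N" for x using state_bound[OF KA[of x]] N by (simp add: \<beta>_def)
  let ?k = "kp \<alpha>"
  have kb: "\<bar>?k x\<bar> \<le> 2 * sqrt \<alpha>" for x using state_bound[OF kp(2)[of \<alpha> x]] \<alpha> by simp
  have mk: "?k \<in> borel_measurable borel" by (rule state_measurable[of _ \<alpha>]) (use \<alpha> in auto)
  have mK: "K \<in> borel_measurable borel"
    using stationary_states_iff[OF _ Kst] \<beta> by (intro state_measurable[of _ \<beta>]) auto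
  define a1 where "a1 p = \<bar>v p - ?k (snd p)\<bar>" for p
  define b1 where "b1 p = sgn (v p - ?k (snd p)) * (A (snd p) (v p) - \<alpha>)" for p
  define a2 where "a2 p = \<bar>v p - K (snd p)\<bar>" for p
  define b2 where "b2 p = sgn (v p - K (snd p)) * (A (snd p) (v p) - \<beta>)" for p
  define a3 where "a3 = (\<lambda>p. pos_dist \<sigma> \<alpha> v p)"
  define b3 where "b3 = (\<lambda>p. pos_flux \<sigma> \<alpha> v p)"
  define a4 where "a4 p = \<sigma> * (?k (snd p) - K (snd p))" for p :: "real \<times> real"
  define b4 where "b4 p = \<sigma> * (\<alpha> - \<beta>)" for p :: "real \<times> real"
  have mA: "(\<lambda>p. A (snd p) (v p)) \<in> borel_measurable lebesgue"
  proof -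
    have "(\<lambda>p. (snd p, v p)) \<in> lebesgue \<rightarrow>\<^sub>M borel \<Otimes>\<^sub>M borel"
      using plane_state_measurable[of "\<lambda>x. x"] v(1) by (intro measurable_Pair) auto
    from measurable_compose[OF this A_measurable[unfolded borel_prod[symmetric]]] show ?thesis by simp
  qed
  note [measurable] = v(1) plane_state_measurable[OF mk] plane_state_measurable[OF mK] mA
  have m: "a1 \<in> borel_measurable lebesgue" "b1 \<in> borel_measurable lebesgue"
    "a2 \<in> borel_measurable lebesgue" "b2 \<in> borel_measurable lebesgue"
    "a3 \<in> borel_measurable lebesgue" "b3 \<in> borel_measurable lebesgue"
    "a4 \<in> borel_measurable lebesgue" "b4 \<in> borel_measurable lebesgue"
    unfolding a1_def b1_def a2_def b2_def a3_def b3_def a4_def b4_def by measurable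
  define C where "C = \<bar>M\<bar> + 2 * sqrt \<alpha> + 2 * N + M^2 + \<alpha> + \<beta>"
  have C: "\<bar>M\<bar> + 2 * sqrt \<alpha> + 2 * N \<le> C" "M^2 + \<alpha> + \<beta> \<le> C"
    using \<alpha> \<beta> N by (auto simp: C_def)
  have bd: "AE p in lebesgue. \<bar>a1 p\<bar> \<le> C \<and> \<bar>b1 p\<bar> \<le> C \<and> \<bar>a2 p\<bar> \<le> C \<and> \<bar>b2 p\<bar> \<le> C \<and>
     \<bar>a3 p\<bar> \<le> C \<and> \<bar>b3 p\<bar> \<le> C \<and> \<bar>a4 p\<bar> \<le> C \<and> \<bar>b4 p\<bar> \<le> C"
    using v(2)
  proof eventually_elim
    case (elim p)
    have Av: "0 \<le> A (snd p) (v p)" "A (snd p) (v p) \<le> M^2"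
      using A_nonneg[of "snd p" "v p"] A_upper[of "snd p" "v p"] elim abs_le_square_iff[of "v p" M] by auto
    have s: "\<bar>sgn y * z\<bar> \<le> \<bar>z\<bar>" for y z :: real by (simp add: abs_mult abs_sgn_eq)
    have \<sigma>1: "\<bar>\<sigma> * y\<bar> = \<bar>y\<bar>" for y using \<sigma> by auto
    have A1: "\<bar>A (snd p) (v p) - \<alpha>\<bar> \<le> C" "\<bar>A (snd p) (v p) - \<beta>\<bar> \<le> C" "\<bar>\<alpha> - \<beta>\<bar> \<le> C"
      using Av C(2) \<alpha> \<beta> by (auto simp: abs_le_iff)
    have V: "\<bar>v p - ?k (snd p)\<bar> \<le> C" "\<bar>v p - K (snd p)\<bar> \<le> C" "\<bar>?k (snd p) - K (snd p)\<bar> \<le> C"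
      using elim kb[of "snd p"] Ku[of "snd p"] C(1) N real_sqrt_ge_zero[of \<alpha>] \<alpha> by linarith+
    have "0 \<le> C" using A1(1) by linarith
    moreover have "\<sigma> * (v p - ?k (snd p)) \<le> C" using \<sigma> V(1) by auto
    ultimately have "\<bar>a3 p\<bar> \<le> C" by (simp add: a3_def max_def)
    with \<open>0 \<le> C\<close> show ?case
      unfolding a1_def b1_def a2_def b2_def b3_def a4_def b4_def
      using order_trans[OF s A1(1)] order_trans[OF s A1(2)] A1 V
      by (auto simp: \<sigma>1)
  qed
  define g where "g a b = (\<lambda>p. indicator ({0<..} \<times> UNIV) p *\<^sub>R
    (\<lambda>(t, x). a (t, x) * dt \<phi> t x + b (t, x) * dx \<phi> t x) p)"
    for a b :: "real \<times> real \<Rightarrow> real"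
  define J where "J a b = (LINT (t, x):({0<..} \<times> UNIV)|lebesgue.
      a (t, x) * dt \<phi> t x + b (t, x) * dx \<phi> t x)" for a b :: "real \<times> real \<Rightarrow> real"
  have Jg: "J a b = integral\<^sup>L lebesgue (g a b)" for a b
    by (simp add: J_def g_def set_lebesgue_integral_def)
  have int: "integrable lebesgue (g a b)" if "(a, b) \<in> {(a1, b1), (a2, b2), (a3, b3), (a4, b4)}" for a b
    unfolding g_def
    by (rule integrable_half_entropy[OF \<phi>, of _ _ C]) (use that m bd in \<open>auto elim: eventually_mono\<close>)
  have i: "integrable lebesgue (g a1 b1)" "integrable lebesgue (g a2 b2)"
    "integrable lebesgue (g a3 b3)" "integrable lebesgue (g a4 b4)"
    by (rule int; simp)+
  \<comment> \<open>Pointwise, \<open>\<bar>v - k\<bar> + \<sigma> * (v - K)\<close> is twice the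
    positive part of \<open>\<sigma> * (v - k)\<close> plus \<open>\<sigma> * (k - K)\<close>, and
    the fluxes satisfy the corresponding identity.\<close>
  have J12: "J a1 b1 + J a2 b2 = J a3 b3 + J a3 b3 + J a4 b4"
  proof -
    have "J a1 b1 + J a2 b2 = (\<integral>p. g a1 b1 p + g a2 b2 p \<partial>lebesgue)"
      unfolding Jg by (rule Bochner_Integration.integral_add[OF i(1,2), symmetric])
    also have "\<dots> = (\<integral>p. (g a3 b3 p + g a3 b3 p) + g a4 b4 p \<partial>lebesgue)"
    proof (rule integral_cong_AE)
      show "AE p in lebesgue. g a1 b1 p + g a2 b2 p = (g a3 b3 p + g a3 b3 p) + g a4 b4 p"
        using v(2)
      proof eventually_elim
        case (elim p)
        obtain t x where p: "p = (t, x)" by (cases p)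
        have pos: "0 < \<sigma> * (v p - K x)" using Kb[of x] elim \<sigma> N_def by (auto simp: algebra_simps)
        have A: "a1 p + a2 p = a3 p + a3 p + a4 p"
          using \<sigma> pos unfolding a1_def a2_def a3_def a4_def by (auto simp: p abs_if max_def)
        have B: "b1 p + b2 p = b3 p + b3 p + b4 p"
        proof (cases "v p = ?k x")
          case True
          then have "A x (v p) = \<alpha>" using kp(2)[of \<alpha> x] \<alpha> by simp
          then show ?thesis using \<sigma> pos True unfolding b1_def b2_def b3_def b4_def
            by (auto simp: p sgn_if)
        next
          case False
          then show ?thesis using \<sigma> pos unfolding b1_def b2_def b3_def b4_def
            by (auto simp: p sgn_if)
        qed
        have "(a1 p * y + b1 p * z) + (a2 p * y + b2 p * z)
          = ((a3 p * y + b3 p * z) + (a3 p * y + b3 p * z)) + (a4 p * y + b4 p * z)" for y z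
        proof -
          have "(a1 p * y + b1 p * z) + (a2 p * y + b2 p * z) = (a1 p + a2 p) * y + (b1 p + b2 p) * z"
            by (simp add: algebra_simps)
          then show ?thesis unfolding A B by (simp add: algebra_simps)
        qed
        then show ?case by (cases "p \<in> {0<..} \<times> UNIV") (simp_all add: p g_def)
      qed
    qed (intro borel_measurable_integrable Bochner_Integration.integrable_add i)+
    also have "\<dots> = J a3 b3 + J a3 b3 + J a4 b4"
      unfolding Jg
      using Bochner_Integration.integral_add[OF Bochner_Integration.integrable_add[OF i(3,3)] i(4)]
        Bochner_Integration.integral_add[OF i(3,3)] by simp
    finally show ?thesis .
  qed
  \<comment> \<open>The density does not depend on time and the flux is constant, so together with
    the initial term this remainder contributes exactly 0.\<close>
  have k4: "J a4 b4 + (LINT x|lebesgue. \<sigma> * (?k x - K x) * \<phi> (0, x)) = 0"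
  proof -
    have "(LINT (t, x):({0<..} \<times> UNIV)|lebesgue.
        \<sigma> * (?k x - K x) * dt \<phi> t x + \<sigma> * (\<alpha> - \<beta>) * dx \<phi> t x)
      + (LINT x|lebesgue. \<sigma> * (?k x - K x) * \<phi> (0, x)) = 0"
    proof (rule conservation[OF \<phi>, where G = "\<lambda>t x. 0" and B = C and W = "\<lambda>t x. \<sigma> * (?k x - K x)" and F = "\<lambda>t x. \<sigma> * (\<alpha> - \<beta>)"])
      have "(\<lambda>p::real\<times>real. \<sigma> * (?k (snd p) - K (snd p))) \<in> borel_measurable (borel \<Otimes>\<^sub>M borel)"
        using mk mK by measurable
      then show "(\<lambda>(t::real, x). \<sigma> * (?k x - K x)) \<in> borel_measurable borel"
        by (simp add: borel_prod case_prod_beta)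
      fix t x :: real
      have \<sigma>1: "\<bar>\<sigma> * y\<bar> = \<bar>y\<bar>" for y using \<sigma> by auto
      show "\<bar>\<sigma> * (?k x - K x)\<bar> \<le> C"
        unfolding \<sigma>1 using kb[of x] Ku[of x] C(1) by linarith
      have "0 \<le> M^2" by simp
      then show "\<bar>\<sigma> * (\<alpha> - \<beta>)\<bar> \<le> C" "\<bar>0\<bar> \<le> C"
        unfolding \<sigma>1 using C(2) \<alpha> \<beta> by linarith+
    qed (auto intro: exI[of _ "{}"])
    then show ?thesis by (simp add: J_def a4_def b4_def)
  qed
  have init: "(LINT x|lebesgue. \<bar>U 0 x - ?k x\<bar> * \<phi> (0, x)) + (LINT x|lebesgue. \<bar>U 0 x - K x\<bar> * \<phi> (0, x))
     = (LINT x|lebesgue. max 0 (\<sigma> * (U 0 x - ?k x)) * \<phi> (0, x)) + (LINT x|lebesgue. max 0 (\<sigma> * (U 0 x - ?k x)) * \<phi> (0, x))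
     + (LINT x|lebesgue. \<sigma> * (?k x - K x) * \<phi> (0, x))"
  proof -
    note [measurable] = U0_measurable mk mK
    define D where "D = 2 + 2 * sqrt \<alpha> + 2 * N"
    have D: "\<bar>U 0 x - ?k x\<bar> \<le> D" "\<bar>U 0 x - K x\<bar> \<le> D" "\<bar>?k x - K x\<bar> \<le> D" for x
      using U_bound[of 0 x] kb[of x] Ku[of x] N real_sqrt_ge_zero[of \<alpha>] \<alpha> unfolding D_def by linarith+
    have D3: "\<bar>max 0 (\<sigma> * (U 0 x - ?k x))\<bar> \<le> D" "\<bar>\<sigma> * (?k x - K x)\<bar> \<le> D" for x
      using D[of x] \<sigma> by (auto simp: max_def)
    have i: "integrable lebesgue (\<lambda>x. \<bar>U 0 x - ?k x\<bar> * \<phi> (0, x))" "integrable lebesgue (\<lambda>x. \<bar>U 0 x - K x\<bar> * \<phi> (0, x))"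
      "integrable lebesgue (\<lambda>x. max 0 (\<sigma> * (U 0 x - ?k x)) * \<phi> (0, x))"
      "integrable lebesgue (\<lambda>x. \<sigma> * (?k x - K x) * \<phi> (0, x))"
      by (rule integrable_initial[OF \<phi>, of _ D]; use D D3 in simp)+
    have "\<bar>U 0 x - ?k x\<bar> * \<phi> (0, x) + \<bar>U 0 x - K x\<bar> * \<phi> (0, x) =
      (max 0 (\<sigma> * (U 0 x - ?k x)) * \<phi> (0, x) + max 0 (\<sigma> * (U 0 x - ?k x)) * \<phi> (0, x)) + \<sigma> * (?k x - K x) * \<phi> (0, x)" for x
    proof -
      have "0 < \<sigma> * (U 0 x - K x)" using Kb[of x] U_bound[of 0 x] \<sigma> N by (auto simp: algebra_simps)
      then have "\<bar>U 0 x - ?k x\<bar> + \<bar>U 0 x - K x\<bar> = max 0 (\<sigma> * (U 0 x - ?k x)) + max 0 (\<sigma> * (U 0 x - ?k x)) + \<sigma> * (?k x - K x)"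
        using \<sigma> by (auto simp: abs_if max_def)
      then show ?thesis by (metis distrib_right)
    qed
    then show ?thesis
      using Bochner_Integration.integral_add[OF i(1,2)]
        Bochner_Integration.integral_add[OF Bochner_Integration.integrable_add[OF i(3,3)] i(4)]
        Bochner_Integration.integral_add[OF i(3,3)] by simp
  qed
  have "0 \<le> J a1 b1 + (LINT x|lebesgue. \<bar>U 0 x - ?k x\<bar> * \<phi> (0, x))"
    using ent[unfolded kruzhkov_def, rule_format, OF _ kp_stationary[OF \<alpha>] \<phi>] \<alpha> by (simp add: J_def a1_def b1_def)
  moreover have "0 \<le> J a2 b2 + (LINT x|lebesgue. \<bar>U 0 x - K x\<bar> * \<phi> (0, x))"
    using ent[unfolded kruzhkov_def, rule_format, OF _ Kst \<phi>] \<beta> by (simp add: J_def a2_def b2_def)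
  ultimately have "0 \<le> J a3 b3 + (LINT x|lebesgue. max 0 (\<sigma> * (U 0 x - ?k x)) * \<phi> (0, x))"
    using J12 k4 init by linarith
  then show "0 \<le> (LINT (t, x):({0<..} \<times> UNIV)|lebesgue.
        pos_dist \<sigma> \<alpha> v (t, x) * dt \<phi> t x + pos_flux \<sigma> \<alpha> v (t, x) * dx \<phi> t x)
      + (LINT x|lebesgue. max 0 (\<sigma> * (U 0 x - kp \<alpha> x)) * \<phi> (0, x))"
    unfolding J_def a3_def b3_def .
  show "integrable lebesgue (\<lambda>p. indicator ({0<..} \<times> UNIV) p *\<^sub>R (\<lambda>(t, x).
        pos_dist \<sigma> \<alpha> v (t, x) * dt \<phi> t x + pos_flux \<sigma> \<alpha> v (t, x) * dx \<phi> t x) p)"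
    using i(3) unfolding g_def a3_def b3_def .
qed

section \<open>Uniqueness and infinite variation\<close>

text \<open>Along the characteristics of \<open>U\<close> convexity of the flux gives the moving cutoff a favourable sign.\<close>

lemma flux_sign:
  assumes x: "x > 0" and \<alpha>: "0 < \<alpha>" and \<sigma>: "\<sigma> = 1 \<or> \<sigma> = (-1::real)"
    and s: "0 < s" "\<sigma> * (\<alpha> - al s x) > 0" and u: "\<sigma> * (u - kp \<alpha> x) > 0"
  shows "0 \<le> \<sigma> * (\<sigma> * (A x u - \<alpha>) - spd s x * (\<sigma> * (u - kp \<alpha> x)))"
proof -
  define k where "k = kp \<alpha> x"
  define y where "y = Us s x"
  have k: "0 \<le> k" "A x k = \<alpha>" using kp[of \<alpha> x] \<alpha> by (auto simp: k_def)
  have y: "0 \<le> y" "A x y = al s x" using Us_nonneg[OF x] s(1) A_Us[OF x] by (auto simp: y_def)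
  have spd: "spd s x = Au x y" using x by (simp add: Au_def y_def S_Us)
  have "\<sigma> * (k - y) > 0"
    using \<sigma> s(2) A_mono_iff[OF k(1) y(1), of x] A_mono_iff[OF y(1) k(1), of x] k(2) y(2) by auto
  then have "\<sigma> * (Au x k - Au x y) \<ge> 0"
    using Au_diff(1)[of y k x] Au_diff(1)[of k y x] \<sigma> by auto
  then have "0 \<le> (\<sigma> * (Au x k - Au x y)) * (\<sigma> * (u - k))" using u by (simp add: k_def)
  also have "\<dots> = (Au x k - Au x y) * (u - k)" using \<sigma> by auto
  finally have "Au x y * (u - k) \<le> Au x k * (u - k)" by (simp add: algebra_simps)
  also have "\<dots> \<le> A x u - \<alpha>" using A_tangent[of x k u] k(2) by simp
  finally show ?thesis unfolding spd k_def[symmetric] using \<sigma> by (auto simp: algebra_simps)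
qed

text \<open>The test function is \<open>gg * X * Y\<close>. By \<open>flux_sign\<close> the
  derivatives of \<open>X\<close>, which moves with the characteristics, contribute with a
  favourable sign. \<open>Y\<close> cuts off along an edge moving at the speed \<open>L\<close>, and
  its time derivative absorbs the flux. \<open>gg\<close> decreases for positive times. So the
  integrand is nonpositive, while the entropy inequality makes its integral nonnegative because the
  initial term vanishes. The integrand is therefore 0 almost everywhere, and strict decrease of
  \<open>gg\<close> removes the excess wherever \<open>X\<close> is nonzero.\<close>

lemma cutoff_comparison:
  fixes v :: "real \<times> real \<Rightarrow> real"
  assumes v: "v \<in> borel_measurable lebesgue" "AE p in lebesgue. \<bar>v p\<bar> \<le> M"
    and ent: "kruzhkov v"
    and \<sigma>: "\<sigma> = 1 \<or> \<sigma> = (-1::real)" and \<alpha>: "0 < \<alpha>"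
    and X: "smooth_on ({-1<..} \<times> UNIV) X" "\<And>p. 0 \<le> X p"
      "\<And>t x. 0 < t \<Longrightarrow> ((\<lambda>t. X (t, x)) has_real_derivative m t x * alt t x) (at t)"
      "\<And>t x. 0 < t \<Longrightarrow> ((\<lambda>x. X (t, x)) has_real_derivative m t x * alx t x) (at x)"
    and sign: "\<And>t x. 0 < t \<Longrightarrow> \<sigma> * m t x \<le> 0"
      "\<And>t x. 0 < t \<Longrightarrow> 0 < x \<Longrightarrow> m t x \<noteq> 0 \<Longrightarrow> \<sigma> * (\<alpha> - al (tau t) x) > 0"
    and init: "\<And>x. X (0, x) \<noteq> 0 \<Longrightarrow> \<sigma> * (U 0 x - kp \<alpha> x) \<le> 0"
    and supp: "\<And>t x. - 3/4 < t \<Longrightarrow> t < 1/2 \<Longrightarrow> X (t, x) \<noteq> 0 \<Longrightarrow> \<sigma> * x \<le> B"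
  shows "AE p in lebesgue. 0 < fst p \<longrightarrow> fst p < 1/2 \<longrightarrow> \<bar>snd p\<bar> < 1 \<longrightarrow> X p \<noteq> 0 \<longrightarrow> \<sigma> * (v p - kp \<alpha> (snd p)) \<le> 0"
proof -
  \<comment> \<open>\<open>L\<close> is a Lipschitz constant of the flux on a range containing the
    values of \<open>v\<close> and of \<open>kp \<alpha>\<close>. The margin 2 in \<open>R\<close>
    keeps \<open>Y\<close> positive for \<open>\<bar>x\<bar> < 1\<close> and
    \<open>0 < t < 1/2\<close>.\<close>
  define L where "L = 2 * (\<bar>M\<bar> + 2 * sqrt \<alpha>)"
  define R where "R = L + 2"
  have L: "0 \<le> L" using \<alpha> by (simp add: L_def)
  define Y where "Y p = f0 (R + \<sigma> * snd p - L * fst p)" for p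
  define Y' where "Y' p = flat 2 (R + \<sigma> * snd p - L * fst p)" for p
  have YY: "0 \<le> Y p" "0 \<le> Y' p" for p by (simp_all add: Y_def Y'_def flat_nonneg)
  define \<phi> where "\<phi> p = gg (fst p) * (X p * Y p)" for p
  have Ysm: "smooth_on UNIV Y"
    unfolding Y_def
    by (intro smooth_on_compose[OF smooth_on_flat] smooth_on_diff smooth_on_add smooth_on_mult
          smooth_on_const smooth_on_linear bounded_linear_fst bounded_linear_snd open_UNIV UNIV_I)
  have o1: "open ({-1<..} \<times> (UNIV :: real set) :: (real \<times> real) set)"
    and o2: "open ({..<-3/4} \<times> (UNIV :: real set) :: (real \<times> real) set)"
    by (intro open_Times; simp)+
  have "smooth_on UNIV \<phi>"
  proof -
    have "smooth_on ({-1<..} \<times> UNIV) \<phi>"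
      unfolding \<phi>_def
      by (intro smooth_on_mult X(1) smooth_on_subset[OF Ysm o1] smooth_on_subset[OF smooth_gg o1]) auto
    moreover have "smooth_on ({..<-3/4} \<times> UNIV) \<phi>"
      by (rule smooth_on_cong[OF smooth_on_const[OF o2, of 0]]) (use gg_support in \<open>force simp: \<phi>_def\<close>)
    ultimately have "smooth_on (({-1<..} \<times> UNIV) \<union> ({..<-3/4} \<times> UNIV)) \<phi>" by (rule smooth_on_Un)
    moreover have "({-1::real<..} \<times> (UNIV :: real set)) \<union> ({..<-3/4} \<times> UNIV) = UNIV" by auto
    ultimately show ?thesis by simp
  qed
  \<comment> \<open>\<open>X\<close> bounds \<open>\<sigma> * x\<close> from above and
    \<open>Y\<close> bounds it from below.\<close>
  moreover have "bounded {p. \<phi> p \<noteq> 0}"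
  proof (rule bounded_subset[OF bounded_cbox])
    define D where "D = \<bar>B\<bar> + R + L"
    show "{p. \<phi> p \<noteq> 0} \<subseteq> cbox (-1, -D) (1, D)"
    proof
      fix p assume "p \<in> {p. \<phi> p \<noteq> 0}"
      then obtain t x where p: "p = (t, x)" "gg t \<noteq> 0" "X (t, x) \<noteq> 0" "Y (t, x) \<noteq> 0"
        by (cases p) (auto simp: \<phi>_def)
      have t: "-3/4 < t" "t < 1/2" using gg_support[OF p(2)] by auto
      have "\<sigma> * x \<le> B" using supp[OF _ _ p(3)] t by simp
      moreover have "0 < R + \<sigma> * x - L * t" using p(4) by (simp add: Y_def flat_zero_iff)
      moreover have "L * (- t) \<le> L * 1" using L t by (intro mult_left_mono) auto
      ultimately have "\<bar>\<sigma> * x\<bar> \<le> D"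
        using L abs_ge_self[of B] abs_ge_zero[of B] unfolding D_def R_def by (intro abs_leI) linarith+
      then have "\<bar>x\<bar> \<le> D" using \<sigma> by auto
      then show "p \<in> cbox (-1, -D) (1, D)" using t by (auto simp: p(1) cbox_Pair_eq)
    qed
  qed
  ultimately have \<phi>: "\<phi> \<in> test_functions"
    unfolding test_functions_def smooth_on_def
    using X(2) YY(1) gg_nonneg by (auto simp: \<phi>_def intro!: Ck_on_UNIV)
  let ?P = "\<lambda>p. max 0 (\<sigma> * (v p - kp \<alpha> (snd p)))"
  let ?Q = "\<lambda>p. if \<sigma> * (v p - kp \<alpha> (snd p)) > 0 then \<sigma> * (A (snd p) (v p) - \<alpha>) else 0"
  have dt: "dt \<phi> t x = gg' t * (X (t, x) * Y (t, x))
      + gg t * (m t x * alt t x * Y (t, x) + X (t, x) * (Y' (t, x) * (- L)))" if "0 < t" for t x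
  proof -
    have "((\<lambda>t. Y (t, x)) has_real_derivative Y' (t, x) * (0 - L)) (at t)"
      unfolding Y_def Y'_def fst_conv snd_conv
      by (rule DERIV_chain2[OF f0_has_derivative])
         (auto intro!: derivative_eq_intros)
    from DERIV_mult[OF gg_deriv DERIV_mult[OF X(3)[OF that, of x] this]]
    show ?thesis unfolding \<phi>_def fst_conv
      by (intro DERIV_imp_deriv) (elim DERIV_cong, simp add: algebra_simps)
  qed
  have dx: "dx \<phi> t x = gg t * (m t x * alx t x * Y (t, x) + X (t, x) * (Y' (t, x) * \<sigma>))"
    if "0 < t" for t x
  proof -
    have "((\<lambda>x. Y (t, x)) has_real_derivative Y' (t, x) * \<sigma>) (at x)"
      unfolding Y_def Y'_def fst_conv snd_conv
      by (rule DERIV_chain2[OF f0_has_derivative])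
         (auto intro!: derivative_eq_intros)
    from DERIV_cmult[OF DERIV_mult[OF X(4)[OF that, of x] this], of "gg t"]
    show ?thesis unfolding \<phi>_def fst_conv
      by (intro DERIV_imp_deriv) (elim DERIV_cong, simp add: algebra_simps)
  qed
  have key: "?P (t, x) * dt \<phi> t x + ?Q (t, x) * dx \<phi> t x
      \<le> gg' t * (X (t, x) * Y (t, x)) * ?P (t, x)" if t: "0 < t" and vM: "\<bar>v (t, x)\<bar> \<le> M" for t x
  proof -
    define u where "u = v (t, x)"
    define P where "P = ?P (t, x)"
    define Q where "Q = ?Q (t, x)"
    \<comment> \<open>Substituting \<open>alt = - spd * alx\<close> turns the bracket into
      \<open>alx * (Q - spd * P)\<close>, whose sign \<open>flux_sign\<close> controls.\<close>
    have 1: "m t x * (P * alt t x + Q * alx t x) \<le> 0"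
    proof (cases "0 < x \<and> m t x \<noteq> 0 \<and> 0 < \<sigma> * (u - kp \<alpha> x)")
      case True
      have "0 \<le> \<sigma> * (Q - spd (tau t) x * P)"
        using flux_sign[of x \<alpha> \<sigma> "tau t" u] True \<alpha> \<sigma> tau_bounds(1) sign(2)[OF t]
        unfolding P_def Q_def u_def by auto
      moreover have "0 \<le> alx t x" using pp_pos[of "tau t" x] by (simp add: alx_def)
      ultimately have "(\<sigma> * m t x) * (alx t x * (\<sigma> * (Q - spd (tau t) x * P))) \<le> 0"
        by (rule mult_nonpos_nonneg[OF sign(1)[OF t] mult_nonneg_nonneg[rotated]])
      moreover have "(\<sigma> * m t x) * (alx t x * (\<sigma> * (Q - spd (tau t) x * P))) = m t x * (P * alt t x + Q * alx t x)"
        using \<sigma> unfolding alt_eq by (auto simp: algebra_simps)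
      ultimately show ?thesis by simp
    qed (auto simp: P_def Q_def u_def alt_def alx_def)
    have 2: "\<sigma> * Q \<le> L * P"
    proof (cases "0 < \<sigma> * (u - kp \<alpha> x)")
      case True
      have "\<bar>A x u - A x (kp \<alpha> x)\<bar> \<le> L * \<bar>u - kp \<alpha> x\<bar>"
        unfolding L_def
        by (rule A_Lipschitz)
           (use vM state_bound[OF kp(2)[of \<alpha> x]] \<alpha> in \<open>auto simp: u_def intro: add_increasing order_trans\<close>)
      then have "A x u - \<alpha> \<le> L * \<bar>u - kp \<alpha> x\<bar>" using kp(2)[of \<alpha> x] \<alpha> by simp
      moreover have "\<bar>u - kp \<alpha> x\<bar> = P" "\<sigma> * Q = A x u - \<alpha>"
        using \<sigma> True by (auto simp: P_def Q_def u_def)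
      ultimately show ?thesis by simp
    qed (simp add: P_def Q_def u_def)
    have "P * dt \<phi> t x + Q * dx \<phi> t x
      = gg' t * (X (t, x) * Y (t, x)) * P + gg t * Y (t, x) * (m t x * (P * alt t x + Q * alx t x))
        + gg t * X (t, x) * Y' (t, x) * (\<sigma> * Q - L * P)"
      unfolding dt[OF t] dx[OF t] by (simp add: algebra_simps)
    also have "\<dots> \<le> gg' t * (X (t, x) * Y (t, x)) * P + 0 + 0"
      using 2 X(2) YY gg_nonneg
      by (intro add_mono order_refl mult_nonneg_nonpos[OF _ 1] mult_nonneg_nonpos[of "gg t * X (t, x) * Y' (t, x)"]
            mult_nonneg_nonneg) auto
    finally show ?thesis by (simp add: P_def Q_def)
  qed
  let ?g = "\<lambda>p. indicator ({0<..} \<times> UNIV) p *\<^sub>R (\<lambda>(t, x).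
        pos_dist \<sigma> \<alpha> v (t, x) * dt \<phi> t x + pos_flux \<sigma> \<alpha> v (t, x) * dx \<phi> t x) p"
  note he = half_entropy[OF v ent \<sigma> \<alpha> \<phi>]
  have gle: "AE p in lebesgue. ?g p \<le> (if 0 < fst p then gg' (fst p) * (X p * Y p) * ?P p else 0)"
    using v(2)
  proof eventually_elim
    case (elim p)
    obtain t x where p: "p = (t, x)" by (cases p)
    show ?case using key[of t x] elim by (cases "0 < t") (auto simp: p)
  qed
  have "AE p in lebesgue. 0 \<le> - ?g p"
    using gle
  proof eventually_elim
    case (elim p)
    have "(if 0 < fst p then gg' (fst p) * (X p * Y p) * ?P p else 0) \<le> 0"
      using gg'_nonpos[of "fst p"] X(2)[of p] YY(1)[of p]
      by (auto intro!: mult_nonpos_nonneg mult_nonneg_nonneg)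
    then show ?case using elim by linarith
  qed
  moreover have "integrable lebesgue (\<lambda>p. - ?g p)" using he(1) by (rule Bochner_Integration.integrable_minus)
  moreover have "integral\<^sup>L lebesgue (\<lambda>p. - ?g p) = 0"
  proof -
    have z: "max 0 (\<sigma> * (U 0 x - kp \<alpha> x)) * \<phi> (0, x) = 0" for x
      using init[of x] by (cases "X (0, x) = 0") (auto simp: \<phi>_def)
    have "(LINT x|lebesgue. max 0 (\<sigma> * (U 0 x - kp \<alpha> x)) * \<phi> (0, x)) = 0"
      unfolding z by simp
    then have "0 \<le> integral\<^sup>L lebesgue ?g"
      using he(2) unfolding set_lebesgue_integral_def by linarith
    moreover have "0 \<le> integral\<^sup>L lebesgue (\<lambda>p. - ?g p)"
      using \<open>AE p in lebesgue. 0 \<le> - ?g p\<close> by (rule integral_nonneg_AE)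
    moreover have "integral\<^sup>L lebesgue (\<lambda>p. - ?g p) = - integral\<^sup>L lebesgue ?g"
      by (rule Bochner_Integration.integral_minus)
    ultimately show ?thesis by linarith
  qed
  ultimately have "AE p in lebesgue. - ?g p = 0"
    using integral_nonneg_eq_0_iff_AE by blast
  with gle show ?thesis
  proof eventually_elim
    case (elim p)
    show ?case
    proof (intro impI, rule ccontr)
      assume a: "0 < fst p" "fst p < 1/2" "\<bar>snd p\<bar> < 1" "X p \<noteq> 0" "\<not> \<sigma> * (v p - kp \<alpha> (snd p)) \<le> 0"
      have "L * fst p \<le> L * 1" using L a by (intro mult_left_mono) auto
      moreover have "\<bar>\<sigma> * snd p\<bar> < 1" using \<sigma> a by auto
      ultimately have "0 < R + \<sigma> * snd p - L * fst p" unfolding R_def by linarith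
      then have "0 < Y p" by (simp add: Y_def flat_pos_iff)
      moreover have "0 < X p" using X(2)[of p] a(4) by linarith
      moreover have "gg' (fst p) < 0" using a gg'_neg by auto
      ultimately have "gg' (fst p) * (X p * Y p) * ?P p < 0"
        using a(5) by (intro mult_neg_pos mult_pos_pos) auto
      then show False using elim a(1) by auto
    qed
  qed
qed

lemma Th_cases:
  assumes "- 1 < t" "0 < a" "a < b"
  shows "Th a (t, x) < f0 (b - a) \<longleftrightarrow> x \<le> 0 \<or> al (sg0 t) x < b"
proof (cases "x \<le> 0")
  case True
  then show ?thesis using assms by (simp add: Th_def flat_pos_iff)
next
  case False
  then show ?thesis
    using f0_less[of "al (sg0 t) x - a" "b - a"] f0_mono[of "b - a" "al (sg0 t) x - a"] assms
    by (auto simp: Th_def not_less) (meson not_less)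
qed

text \<open>The upper bound uses a cutoff that for \<open>t > -1\<close> is positive exactly at
  levels below \<open>\<alpha>\<close> and on \<open>x \<le> 0\<close>. Built from
  \<open>Th (\<alpha> / 2)\<close>, it is constant at levels below \<open>\<alpha> / 2\<close> and
  thus smooth through \<open>x = 0\<close>. The lower bound uses \<open>Th \<alpha>\<close>; here
  \<open>\<alpha> < 1\<close> ensures that truncation leaves the initial datum above
  \<open>kp \<alpha>\<close> where the level exceeds \<open>\<alpha>\<close>.\<close>

lemma sandwich:
  fixes v :: "real \<times> real \<Rightarrow> real"
  assumes v: "v \<in> borel_measurable lebesgue" "AE p in lebesgue. \<bar>v p\<bar> \<le> M"
    and ent: "kruzhkov v"
    and \<alpha>: "0 < \<alpha>" "\<alpha> < 1"
  shows "AE p in lebesgue. 0 < fst p \<longrightarrow> fst p < 1/2 \<longrightarrow> \<bar>snd p\<bar> < 1 \<longrightarrow> 0 < snd p \<longrightarrow>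
      (al (tau (fst p)) (snd p) < \<alpha> \<longrightarrow> v p \<le> kp \<alpha> (snd p)) \<and>
      (\<alpha> < al (tau (fst p)) (snd p) \<longrightarrow> kp \<alpha> (snd p) \<le> v p)"
proof -
  let ?q = "f0 (\<alpha> - \<alpha> / 2)"
  let ?X = "\<lambda>p. f0 (?q - Th (\<alpha> / 2) p)"
  have o: "open ({-1<..} \<times> (UNIV :: real set) :: (real \<times> real) set)" by (intro open_Times) auto
  have X0: "?X (t, x) \<noteq> 0 \<longleftrightarrow> x \<le> 0 \<or> al (sg0 t) x < \<alpha>" if "-1 < t" for t x
    using Th_cases[OF that, of "\<alpha>/2" \<alpha> x] \<alpha> by (simp add: flat_zero_iff not_le)
  have U0: "A x (U 0 x) \<le> al (sg0 0) x" if "0 < x" for x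
    using that unfolding A_U by (simp add: zz_def sg0_eq)
  have 1: "AE p in lebesgue. 0 < fst p \<longrightarrow> fst p < 1/2 \<longrightarrow> \<bar>snd p\<bar> < 1 \<longrightarrow> ?X p \<noteq> 0 \<longrightarrow> 1 * (v p - kp \<alpha> (snd p)) \<le> 0"
  proof (rule cutoff_comparison[OF v ent disjI1[OF refl] \<alpha>(1), where X = ?X and B = "1 + 9 * \<alpha>" and
        m = "\<lambda>t x. - (flat 2 (?q - Th (\<alpha> / 2) (t, x)) * flat 2 (al (tau t) x - \<alpha> / 2))"])
    show "smooth_on ({-1<..} \<times> UNIV) ?X"
      by (rule smooth_on_compose[OF smooth_on_flat smooth_on_diff[OF smooth_on_const[OF o] smooth_Th]]) (use \<alpha> in auto)
    show "0 \<le> ?X p" for p by (rule flat_nonneg)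
    fix t x :: real
    show "((\<lambda>t. ?X (t, x)) has_real_derivative - (flat 2 (?q - Th (\<alpha> / 2) (t, x)) * flat 2 (al (tau t) x - \<alpha> / 2)) * alt t x) (at t)"
      if "0 < t"
      using DERIV_chain2[OF f0_has_derivative DERIV_diff[OF DERIV_const[of ?q] Th_deriv(1)[of "\<alpha>/2" t x]]] \<alpha> that
      by (simp add: mult.assoc)
    show "((\<lambda>x. ?X (t, x)) has_real_derivative - (flat 2 (?q - Th (\<alpha> / 2) (t, x)) * flat 2 (al (tau t) x - \<alpha> / 2)) * alx t x) (at x)"
      if "0 < t"
      using DERIV_chain2[OF f0_has_derivative DERIV_diff[OF DERIV_const[of ?q] Th_deriv(2)[of "\<alpha>/2" t x]]] \<alpha> that
      by (simp add: mult.assoc)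
    show "1 * - (flat 2 (?q - Th (\<alpha> / 2) (t, x)) * flat 2 (al (tau t) x - \<alpha> / 2)) \<le> 0"
      by (simp add: flat_nonneg)
    show "0 < 1 * (\<alpha> - al (tau t) x)"
      if "0 < t" "0 < x" "- (flat 2 (?q - Th (\<alpha> / 2) (t, x)) * flat 2 (al (tau t) x - \<alpha> / 2)) \<noteq> 0"
    proof -
      have "?X (t, x) \<noteq> 0" using that(3) by (auto simp: flat_zero_iff)
      then show ?thesis using X0[of t x] that by (simp add: sg0_eq)
    qed
    show "1 * (U 0 x - kp \<alpha> x) \<le> 0" if "?X (0, x) \<noteq> 0"
    proof (cases "x \<le> 0")
      case True
      then show ?thesis using kp(1)[of \<alpha> x] \<alpha> by (simp add: U_def)
    next
      case False
      then have "A x (U 0 x) \<le> \<alpha>" using X0[of 0 x] that U0[of x] by auto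
      then show ?thesis using A_mono_iff[of "U 0 x" "kp \<alpha> x" x] kp[of \<alpha> x] \<alpha> U_nonneg[of 0 x] by simp
    qed
    \<comment> \<open>For \<open>t < 1/2\<close> the factor \<open>sg0 t\<close> is at least 2/3, so
      \<open>x^2 / 9 \<le> al < \<alpha>\<close>, and \<open>2 * x \<le> 1 + x^2\<close> bounds
      \<open>x\<close>.\<close>
    show "1 * x \<le> 1 + 9 * \<alpha>" if "- 3 / 4 < t" "t < 1 / 2" "?X (t, x) \<noteq> 0"
    proof (cases "x \<le> 0")
      case False
      have "2 / 3 \<le> sg0 t" using that by (simp add: sg0_def field_simps)
      then have "(2 / 3)^2 * x^2 \<le> (sg0 t)^2 * x^2" by (intro mult_right_mono power_mono) auto
      then have "4 / 9 * x^2 \<le> (sg0 t)^2 * x^2" by (simp only: power_divide) simp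
      moreover have "al (sg0 t) x < \<alpha>" using X0[of t x] that False by simp
      ultimately have "x^2 \<le> 9 * \<alpha>" using al_bounds(1)[of "sg0 t" x] by linarith
      moreover have "0 \<le> (x - 1)^2" by simp
      then have "2 * x \<le> 1 + x^2" by (simp add: power2_eq_square algebra_simps)
      ultimately show ?thesis using False \<alpha> by linarith
    qed (use \<alpha> in auto)
  qed
  have 2: "AE p in lebesgue. 0 < fst p \<longrightarrow> fst p < 1/2 \<longrightarrow> \<bar>snd p\<bar> < 1 \<longrightarrow> Th \<alpha> p \<noteq> 0 \<longrightarrow> - 1 * (v p - kp \<alpha> (snd p)) \<le> 0"
  proof (rule cutoff_comparison[OF v ent disjI2[OF refl] \<alpha>(1), where X = "Th \<alpha>" and B = 0 and
        m = "\<lambda>t x. flat 2 (al (tau t) x - \<alpha>)"])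
    show "smooth_on ({-1<..} \<times> UNIV) (Th \<alpha>)" by (rule smooth_Th[OF \<alpha>(1)])
    show "0 \<le> Th \<alpha> p" for p by (simp add: Th_def flat_nonneg)
    fix t x :: real
    show "((\<lambda>t. Th \<alpha> (t, x)) has_real_derivative flat 2 (al (tau t) x - \<alpha>) * alt t x) (at t)"
      "((\<lambda>x. Th \<alpha> (t, x)) has_real_derivative flat 2 (al (tau t) x - \<alpha>) * alx t x) (at x)" if "0 < t"
      using Th_deriv \<alpha>(1) that by blast+
    show "- 1 * flat 2 (al (tau t) x - \<alpha>) \<le> 0" by (simp add: flat_nonneg)
    show "0 < - 1 * (\<alpha> - al (tau t) x)" if "flat 2 (al (tau t) x - \<alpha>) \<noteq> 0"
      using that by (simp add: flat_zero_iff)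
    show "- 1 * (U 0 x - kp \<alpha> x) \<le> 0" if "Th \<alpha> (0, x) \<noteq> 0"
    proof -
      have "0 < x" "\<alpha> < al (tau 0) x" using that by (auto simp: Th_def flat_zero_iff sg0_eq split: if_splits)
      then have "\<alpha> \<le> A x (U 0 x)" using \<alpha> unfolding A_U by (simp add: zz_def)
      then show ?thesis using A_mono_iff[of "kp \<alpha> x" "U 0 x" x] kp[of \<alpha> x] \<alpha> U_nonneg[of 0 x] by simp
    qed
    show "- 1 * x \<le> 0" if "Th \<alpha> (t, x) \<noteq> 0"
      using that by (auto simp: Th_def split: if_splits)
  qed
  from 1 2 show ?thesis
  proof eventually_elim
    case (elim p)
    obtain t x where p: "p = (t, x)" by (cases p)
    show ?case
      using elim X0[of t x] by (auto simp: p Th_def flat_zero_iff sg0_eq)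
  qed
qed

text \<open>For \<open>0 < x < 1\<close> the level lies strictly between 0 and 1, so rational
  \<open>\<alpha>\<close> approach it from both sides and the two bounds of \<open>sandwich\<close>
  close up. Restricting to rationals keeps the exceptional set null.\<close>

lemma uniqueness:
  fixes v :: "real \<times> real \<Rightarrow> real"
  assumes v: "v \<in> borel_measurable lebesgue" "AE p in lebesgue. \<bar>v p\<bar> \<le> M"
    and ent: "kruzhkov v"
  shows "AE p in lebesgue. 0 < fst p \<longrightarrow> fst p < 1/2 \<longrightarrow> 0 < snd p \<longrightarrow> snd p < 1 \<longrightarrow>
    v p = Us (tau (fst p)) (snd p)"
proof -
  have "AE p in lebesgue. \<forall>\<alpha>\<in>\<rat> \<inter> {0<..<1}. 0 < fst p \<longrightarrow> fst p < 1/2 \<longrightarrow> \<bar>snd p\<bar> < 1 \<longrightarrow> 0 < snd p \<longrightarrow>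
      (al (tau (fst p)) (snd p) < \<alpha> \<longrightarrow> v p \<le> kp \<alpha> (snd p)) \<and>
      (\<alpha> < al (tau (fst p)) (snd p) \<longrightarrow> kp \<alpha> (snd p) \<le> v p)"
  proof (subst AE_ball_countable[OF countable_Int1[OF countable_rat]], rule ballI)
    fix \<alpha> :: real assume "\<alpha> \<in> \<rat> \<inter> {0<..<1}"
    then have a: "0 < \<alpha>" "\<alpha> < 1" by simp_all
    show "AE p in lebesgue. 0 < fst p \<longrightarrow> fst p < 1/2 \<longrightarrow> \<bar>snd p\<bar> < 1 \<longrightarrow> 0 < snd p \<longrightarrow>
      (al (tau (fst p)) (snd p) < \<alpha> \<longrightarrow> v p \<le> kp \<alpha> (snd p)) \<and>
      (\<alpha> < al (tau (fst p)) (snd p) \<longrightarrow> kp \<alpha> (snd p) \<le> v p)"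
      by (rule sandwich[OF v ent a])
  qed
  then show ?thesis
  proof eventually_elim
    case (elim p)
    obtain t x where p: "p = (t, x)" by (cases p)
    show ?case
    proof (intro impI)
      assume "0 < fst p" "fst p < 1/2" "0 < snd p" "snd p < 1"
      then have tx: "0 < t" "t < 1/2" "0 < x" "x < 1" by (auto simp: p)
      define s where "s = tau t"
      have s: "0 < s" "s \<le> 1" using tau_bounds by (auto simp: s_def)
      have bnd: "al s x < r \<Longrightarrow> v p \<le> kp r x" "r < al s x \<Longrightarrow> kp r x \<le> v p"
        if "r \<in> \<rat>" "0 < r" "r < 1" for r
        using elim that tx by (auto simp: p s_def)
      have "s * x < 1" using mult_left_le_one_le[of x s] s tx by linarith
      then have "(s * x)^2 < 1" using s tx by (intro power_less_one_iff[THEN iffD2] | simp)+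
      then have "s^2 * x^2 < 1" by (simp add: power_mult_distrib)
      then have a1: "al s x < 1" using al_bounds(2)[of s x] by linarith
      have a0: "0 < al s x"
      proof -
        have "0 < s^2 * x^2" using s tx by simp
        then show ?thesis using al_bounds(1)[of s x] by linarith
      qed
      have y: "0 \<le> Us s x" "A x (Us s x) = al s x" using Us_nonneg[of x s] A_Us[of x s] tx s by auto
      have "\<not> Us s x < v p"
      proof
        assume lt: "Us s x < v p"
        then have "al s x < A x (v p)" using A_strict_mono[OF y(1) lt, of x] y(2) by simp
        then obtain r where r: "r \<in> \<rat>" "al s x < r" "r < min (A x (v p)) 1"
          using Rats_dense_in_real[of "al s x" "min (A x (v p)) 1"] a1 by auto
        then have "v p \<le> kp r x" using bnd(1)[of r] a0 by auto
        then have "A x (v p) \<le> r" using A_mono_iff[of "v p" "kp r x" x] kp[of r x] r a0 y(1) lt by simp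
        then show False using r by simp
      qed
      moreover have "\<not> v p < Us s x"
      proof
        assume lt: "v p < Us s x"
        \<comment> \<open>The flux increases on nonnegative values only. If \<open>v p\<close> is
          negative, 0 replaces its flux, and the bound below by \<open>kp r x \<ge> 0\<close>
          refutes that case.\<close>
        have "max 0 (if 0 \<le> v p then A x (v p) else 0) < al s x"
          using A_strict_mono[of "v p" "Us s x" x] y(2) lt a0 by auto
        then obtain r where r: "r \<in> \<rat>" "max 0 (if 0 \<le> v p then A x (v p) else 0) < r" "r < al s x"
          using Rats_dense_in_real by blast
        then have le: "kp r x \<le> v p" using bnd(2)[of r] a1 by auto
        then have "0 \<le> v p" using kp(1)[of r x] r by simp
        then have "r \<le> A x (v p)" using A_mono_iff[of "kp r x" "v p" x] kp[of r x] r le by simp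
        then show False using r \<open>0 \<le> v p\<close> by simp
      qed
      ultimately show "v p = Us (tau (fst p)) (snd p)" by (simp add: p s_def)
    qed
  qed
qed

section \<open>From almost every time to a fixed time\<close>

lemma not_null_interval:
  fixes a b :: real
  assumes "AE t in lborel. P t" "a < b"
  shows "\<exists>t. a < t \<and> t < b \<and> P t"
proof (rule ccontr)
  assume "\<not> ?thesis"
  then have "AE t in lborel. t \<notin> {a<..<b}" using assms(1) by (auto elim: eventually_mono)
  then have "{a<..<b} \<in> null_sets lborel" by (subst AE_iff_null_sets) auto
  then show False using assms(2) by (simp add: null_sets_def)
qed

text \<open>Uniqueness identifies the solution at almost every time only. The \<open>L1\<close>
  distance \<open>c\<close> at the time 1/4 is at most the distance from that slice to the slice at
  a good time \<open>t\<close> plus \<open>2 * \<bar>tau t - tau T\<bar>\<close>; good times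
  accumulate at 1/4, and continuity in \<open>L1\<close> forces \<open>c = 0\<close>.\<close>

lemma solution_slice:
  assumes u: "adapted_entropy_solution A (\<lambda>_. 0) (\<lambda>_. 0) (U 0) u"
  shows "AE x in lebesgue. x \<in> {0<..<1} \<longrightarrow> u (1/4) x = Us (tau (1/4)) x"
proof -
  let ?O = "{0<..} \<times> UNIV :: (real \<times> real) set"
  \<comment> \<open>Values at nonpositive times are arbitrary; extension by 0 gives a function that
    is measurable and essentially bounded on the whole plane.\<close>
  define v where "v p = (if p \<in> ?O then (\<lambda>(t, x). u t x) p else 0)" for p
  have "open ?O" by (intro open_Times) auto
  then have O: "?O \<in> sets lebesgue" by auto
  note u' = u[unfolded adapted_entropy_solution_def]
  obtain M where M: "AE (t, x) in lebesgue_on ?O. \<bar>u t x\<bar> \<le> M"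
    using u' by (elim conjE exE)
  have m: "(\<lambda>(t, x). u t x) \<in> borel_measurable (lebesgue_on ?O)"
    using u' by (elim conjE)
  have "\<forall>T>0. continuous_in_L1loc u T"
    using u' by (elim conjE)
  then have cont: "continuous_in_L1loc u (1/2)" by simp
  have ent: "\<And>\<alpha> k \<phi>. 0 \<le> \<alpha> \<Longrightarrow> k \<in> stationary_states A (\<lambda>_. 0) (\<lambda>_. 0) \<alpha> \<Longrightarrow> \<phi> \<in> test_functions \<Longrightarrow>
      0 \<le> (LINT (t, x):?O|lebesgue. \<bar>u t x - k x\<bar> * dt \<phi> t x
            + sgn (u t x - k x) * (A x (u t x) - \<alpha>) * dx \<phi> t x)
          + (LINT x|lebesgue. \<bar>U 0 x - k x\<bar> * \<phi> (0, x))"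
    using u'[THEN conjunct2, THEN conjunct2, THEN conjunct2] by blast
  have vm: "v \<in> borel_measurable lebesgue"
    unfolding v_def using borel_measurable_if[OF O] m by blast
  have "AE p in lebesgue. p \<in> ?O \<longrightarrow> (\<lambda>(t, x). \<bar>u t x\<bar> \<le> M) p"
    using M O by (subst (asm) AE_restrict_space_iff) auto
  then have vb: "AE p in lebesgue. \<bar>v p\<bar> \<le> \<bar>M\<bar>"
    by eventually_elim (auto simp: v_def)
  have "0 \<le> (LINT (t, x):?O|lebesgue. \<bar>v (t, x) - k x\<bar> * dt \<phi> t x
            + sgn (v (t, x) - k x) * (A x (v (t, x)) - \<alpha>) * dx \<phi> t x)
          + (LINT x|lebesgue. \<bar>U 0 x - k x\<bar> * \<phi> (0, x))"
    if "0 \<le> \<alpha>" "k \<in> stationary_states A (\<lambda>_. 0) (\<lambda>_. 0) \<alpha>" "\<phi> \<in> test_functions" for \<alpha> k \<phi>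
  proof -
    have "(LINT (t, x):?O|lebesgue. \<bar>v (t, x) - k x\<bar> * dt \<phi> t x
            + sgn (v (t, x) - k x) * (A x (v (t, x)) - \<alpha>) * dx \<phi> t x)
        = (LINT (t, x):?O|lebesgue. \<bar>u t x - k x\<bar> * dt \<phi> t x
            + sgn (u t x - k x) * (A x (u t x) - \<alpha>) * dx \<phi> t x)"
      by (rule set_lebesgue_integral_cong[OF O]) (auto simp: v_def)
    then show ?thesis using ent[OF that] by simp
  qed
  then have vent: "kruzhkov v" by (simp add: kruzhkov_def)
  have "AE p in lborel. 0 < fst p \<longrightarrow> fst p < 1/2 \<longrightarrow> 0 < snd p \<longrightarrow> snd p < 1 \<longrightarrow>
    v p = Us (tau (fst p)) (snd p)"
    by (rule AE_completion_iff[THEN iffD1, OF uniqueness[OF vm vb vent]])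
  then have "AE p in lborel \<Otimes>\<^sub>M lborel. 0 < fst p \<longrightarrow> fst p < 1/2 \<longrightarrow> 0 < snd p \<longrightarrow> snd p < 1 \<longrightarrow>
    v p = Us (tau (fst p)) (snd p)"
    by (simp only: lborel_prod)
  from lborel_pair.AE_pair[OF this]
  have good: "AE t in lborel. AE x in lborel. 0 < t \<longrightarrow> t < 1/2 \<longrightarrow> 0 < x \<longrightarrow> x < 1 \<longrightarrow> u t x = Us (tau t) x"
    by (auto simp: v_def elim!: eventually_mono)
  define K where "K = {0..1::real}"
  define T where "T = (1/4 :: real)"
  have K: "compact K" "K \<in> lmeasurable" "measure lebesgue K = 1" by (auto simp: K_def)
  have T: "T \<in> {0..1/2}" by (simp add: T_def)
  have iu: "set_integrable lebesgue K (u t)" if "t \<in> {0..1/2}" for t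
    using cont K(1) that unfolding continuous_in_L1loc_def by blast
  have iUs: "set_integrable lebesgue K (Us s)" for s
  proof -
    have "continuous_on K (\<lambda>x. Us s x)"
    proof -
      have "\<bar>y * dl y\<bar> \<le> \<bar>y\<bar>" for y
        using dl_bound[of y] unfolding abs_mult by (intro mult_left_le) auto
      then have "norm (dd y) \<le> \<bar>y\<bar>" for y by (simp add: dd_def)
      then have "\<forall>\<^sub>F y in at 0. norm (dd y) \<le> \<bar>y\<bar>" by (intro always_eventually allI)
      moreover have "((\<lambda>y::real. \<bar>y\<bar>) \<longlongrightarrow> 0) (at 0)" by (rule tendsto_rabs_zero[OF tendsto_ident_at])
      ultimately have "(dd \<longlongrightarrow> 0) (at 0)" by (rule Lim_null_comparison)
      then have "isCont dd 0" by (simp add: isCont_def dd_def)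
      then have "isCont dd y" if "0 \<le> y" for y
        using dd_deriv[of y] DERIV_isCont that by (cases "y = 0") auto
      then have "continuous_on K dd" by (intro continuous_at_imp_continuous_on) (auto simp: K_def)
      then show ?thesis unfolding Us_def by (intro continuous_intros)
    qed
    from borel_integrable_compact[OF K(1) this] show ?thesis
      using borel_measurable_integrable integrable_completion unfolding set_integrable_def by blast
  qed
  define c where "c = (LINT x:K|lebesgue. \<bar>u T x - Us (tau T) x\<bar>)"
  have c0: "0 \<le> c" unfolding c_def set_lebesgue_integral_def by (intro integral_nonneg_AE AE_I2) auto
  have step: "c \<le> (LINT x:K|lebesgue. \<bar>u t x - u T x\<bar>) + 2 * \<bar>tau t - tau T\<bar>"
    if t: "t \<in> {0..1/2}" and ae: "AE x in lborel. 0 < x \<longrightarrow> x < 1 \<longrightarrow> u t x = Us (tau t) x" for t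
  proof -
    have i1: "set_integrable lebesgue K (\<lambda>x. \<bar>u t x - u T x\<bar>)"
      by (intro set_integrable_abs set_integral_diff(1) iu t T)
    have i2: "set_integrable lebesgue K (\<lambda>x. \<bar>u T x - Us (tau T) x\<bar>)"
      by (intro set_integrable_abs set_integral_diff(1) iu iUs T)
    have i3: "set_integrable lebesgue K (\<lambda>x. 2 * \<bar>tau t - tau T\<bar>)"
      unfolding set_integrable_def using K(2) by (simp add: lmeasurable_iff_integrable)
    have "c \<le> (LINT x:K|lebesgue. \<bar>u t x - u T x\<bar> + 2 * \<bar>tau t - tau T\<bar>)"
      unfolding c_def
    proof (rule set_integral_mono_AE[OF i2 set_integral_add(1)[OF i1 i3]])
      have "AE x in lebesgue. 0 < x \<longrightarrow> x < 1 \<longrightarrow> u t x = Us (tau t) x"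
        by (rule AE_completion_iff[THEN iffD2, OF ae])
      moreover have "AE x in lebesgue. x \<noteq> (0::real)" "AE x in lebesgue. x \<noteq> (1::real)"
        by (rule AE_completion_iff[THEN iffD2, OF AE_lborel_singleton])+
      ultimately show "AE x\<in>K in lebesgue. \<bar>u T x - Us (tau T) x\<bar> \<le> \<bar>u t x - u T x\<bar> + 2 * \<bar>tau t - tau T\<bar>"
      proof eventually_elim
        case (elim x)
        show ?case
        proof
          assume "x \<in> K"
          then have x: "0 < x" "x < 1" using elim by (auto simp: K_def)
          have "\<bar>Us (tau t) x - Us (tau T) x\<bar> \<le> 2 * x * \<bar>tau t - tau T\<bar>" by (rule Us_Lipschitz[OF x(1)])
          also have "\<dots> \<le> 2 * \<bar>tau t - tau T\<bar>" using x by (intro mult_right_mono) auto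
          finally show "\<bar>u T x - Us (tau T) x\<bar> \<le> \<bar>u t x - u T x\<bar> + 2 * \<bar>tau t - tau T\<bar>"
            using elim(1) x by auto
        qed
      qed
    qed
    also have "\<dots> = (LINT x:K|lebesgue. \<bar>u t x - u T x\<bar>) + (LINT x:K|lebesgue. 2 * \<bar>tau t - tau T\<bar>)"
      by (rule set_integral_add(2)[OF i1 i3])
    also have "(LINT x:K|lebesgue. 2 * \<bar>tau t - tau T\<bar>) = 2 * \<bar>tau t - tau T\<bar>"
      using K unfolding set_lebesgue_integral_def by (simp add: fmeasurableD)
    finally show ?thesis .
  qed
  have "c = 0"
  proof (rule ccontr)
    assume "c \<noteq> 0"
    then have c: "0 < c" using c0 by simp
    have "(tau \<longlongrightarrow> tau T) (at T within {0..1/2})"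
      using tau_continuous[of "{0..1/2}"] T by (simp add: continuous_on_def)
    then have "((\<lambda>t. 2 * \<bar>tau t - tau T\<bar>) \<longlongrightarrow> 2 * \<bar>tau T - tau T\<bar>) (at T within {0..1/2})"
      by (intro tendsto_intros)
    moreover have "((\<lambda>t. LINT x:K|lebesgue. \<bar>u t x - u T x\<bar>) \<longlongrightarrow> 0) (at T within {0..1/2})"
      using cont K(1) T unfolding continuous_in_L1loc_def by blast
    ultimately have "((\<lambda>t. (LINT x:K|lebesgue. \<bar>u t x - u T x\<bar>) + 2 * \<bar>tau t - tau T\<bar>) \<longlongrightarrow> 0) (at T within {0..1/2})"
      using tendsto_add by fastforce
    then have "\<forall>\<^sub>F t in at T within {0..1/2}. (LINT x:K|lebesgue. \<bar>u t x - u T x\<bar>) + 2 * \<bar>tau t - tau T\<bar> < c"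
      using c by (rule order_tendstoD(2))
    then obtain d where d: "0 < d" "\<And>t. t \<in> {0..1/2} \<Longrightarrow> t \<noteq> T \<Longrightarrow> dist t T < d \<Longrightarrow>
        (LINT x:K|lebesgue. \<bar>u t x - u T x\<bar>) + 2 * \<bar>tau t - tau T\<bar> < c"
      unfolding eventually_at by auto
    obtain t where t: "T < t" "t < T + min d (1/4)"
      "AE x in lborel. 0 < t \<longrightarrow> t < 1/2 \<longrightarrow> 0 < x \<longrightarrow> x < 1 \<longrightarrow> u t x = Us (tau t) x"
      using not_null_interval[OF good, of T "T + min d (1/4)"] d(1) by auto
    have t': "t \<in> {0..1/2}" "0 < t" "t < 1/2" using t(1,2) by (auto simp: T_def)
    have "AE x in lborel. 0 < x \<longrightarrow> x < 1 \<longrightarrow> u t x = Us (tau t) x"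
      using t(3) t' by simp
    from step[OF t'(1) this] d(2)[OF t'(1)] t(1,2) show False
      by (auto simp: dist_real_def min_def split: if_splits)
  qed
  have i: "integrable lebesgue (\<lambda>x. indicator K x *\<^sub>R \<bar>u T x - Us (tau T) x\<bar>)"
    using set_integrable_abs[OF set_integral_diff(1)[OF iu[OF T] iUs]] by (simp add: set_integrable_def)
  have "AE x in lebesgue. indicator K x *\<^sub>R \<bar>u T x - Us (tau T) x\<bar> = 0"
    using \<open>c = 0\<close> unfolding c_def set_lebesgue_integral_def
    by (subst (asm) integral_nonneg_eq_0_iff_AE[OF i]) auto
  then show ?thesis
    by eventually_elim (auto simp: K_def T_def indicator_def split: if_splits)
qed

section \<open>Infinite variation of the slice\<close>

lemma oscillation_bound:
  assumes "0 < x" "0 < y"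
  shows "\<bar>h s\<bar> * eps * \<bar>x * sin (1/x) - y * sin (1/y)\<bar> - (\<bar>s\<bar> + 9 * \<bar>h s\<bar> * eps) * \<bar>x - y\<bar>
    \<le> \<bar>Us s x - Us s y\<bar>"
proof -
  \<comment> \<open>\<open>w\<close> is all of \<open>Us\<close> except the summand
    \<open>h s * eps * (x * sin (1/x))\<close>. It is Lipschitz, since the derivative of
    \<open>3 * x^2 * (cos (1/x) - 1)\<close> is bounded by 3 * (2 + 1) = 9.\<close>
  define w where "w x = s * x + h s * eps * (3 * (x^2 * (cos (1/x) - 1)))" for x
  have e: "0 < eps" by (simp add: eps_def)
  have U: "Us s x = w x + h s * eps * (x * sin (1/x))" for x
    by (simp add: Us_def dd_def dl_def w_def algebra_simps power2_eq_square)
  have "norm (w x - w y) \<le> (\<bar>s\<bar> + 9 * \<bar>h s\<bar> * eps) * norm (x - y)"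
  proof (rule field_differentiable_bound[of "{0<..}" _ "\<lambda>x. s + h s * eps * (3 * (2 * (x * (cos (1/x) - 1)) + sin (1/x)))"])
    fix z :: real assume z: "z \<in> {0<..}"
    show "(w has_field_derivative s + h s * eps * (3 * (2 * (z * (cos (1/z) - 1)) + sin (1/z)))) (at z within {0<..})"
      unfolding w_def[abs_def]
      using z by (auto intro!: derivative_eq_intros simp: power2_eq_square field_simps)
    have "\<bar>3 * (2 * a + b)\<bar> \<le> 9" if "\<bar>a\<bar> \<le> 1" "\<bar>b\<bar> \<le> 1" for a b :: real
      using that by (simp add: abs_le_iff)
    from this[OF x_cos_bound abs_sin_le_one]
    have "\<bar>3 * (2 * (z * (cos (1/z) - 1)) + sin (1/z))\<bar> \<le> 9" .
    then have "\<bar>h s * eps\<bar> * \<bar>3 * (2 * (z * (cos (1/z) - 1)) + sin (1/z))\<bar> \<le> \<bar>h s * eps\<bar> * 9"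
      by (intro mult_left_mono) auto
    then have "\<bar>h s * eps * (3 * (2 * (z * (cos (1/z) - 1)) + sin (1/z)))\<bar> \<le> 9 * \<bar>h s\<bar> * eps"
      unfolding abs_mult[of "h s * eps"] using e by (simp add: abs_mult)
    then show "norm (s + h s * eps * (3 * (2 * (z * (cos (1/z) - 1)) + sin (1/z)))) \<le> \<bar>s\<bar> + 9 * \<bar>h s\<bar> * eps"
      by (simp only: real_norm_def)
  qed (use assms in auto)
  moreover have "Us s x - Us s y = (w x - w y) + h s * eps * (x * sin (1/x) - y * sin (1/y))"
    by (simp add: U algebra_simps)
  moreover have "\<bar>h s * eps * (x * sin (1/x) - y * sin (1/y))\<bar> = \<bar>h s\<bar> * eps * \<bar>x * sin (1/x) - y * sin (1/y)\<bar>"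
    using e by (simp add: abs_mult)
  moreover have "\<bar>q\<bar> - \<bar>p\<bar> \<le> \<bar>p + q\<bar>" for p q :: real by linarith
  ultimately show ?thesis by (smt (verit) real_norm_def)
qed

text \<open>Between consecutive extrema of \<open>sin (1/x)\<close> the function
  \<open>x * sin (1/x)\<close> changes by the order of \<open>1/n\<close>, so its variation
  dominates a harmonic series, while the Lipschitz part only costs a telescoping sum of at most
  \<open>C * y 0\<close>. As \<open>g\<close> is known almost everywhere only, the nodes are picked
  from intervals around the extrema.\<close>

lemma infinite_variation:
  assumes ae: "AE x in lebesgue. x \<in> {0<..<1} \<longrightarrow> g x = Us s x" and hs: "h s \<noteq> 0"
  shows "total_variation g = \<infinity>"
proof -
  \<comment> \<open>The extrema of the sine from \<open>3 * pi / 2\<close> on: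
    \<open>c n > 4\<close> places the nodes inside \<open>(0, 1)\<close>, and as
    \<open>pi > 2\<close>, the windows of half-width 1 around them are disjoint.\<close>
  define c where "c n = pi / 2 + real (Suc n) * pi" for n :: nat
  have c: "4 < c n" "c (Suc n) = c n + pi" "c n + 1 \<le> 7 * real (Suc n)" for n
  proof -
    have "1 * pi \<le> real (Suc n) * pi" by (intro mult_right_mono) auto
    then show "4 < c n" using pi_gt3 unfolding c_def by linarith
    show "c (Suc n) = c n + pi" by (simp add: c_def algebra_simps)
    have "real (Suc n) * pi \<le> real (Suc n) * 4" using pi_less_4 by (intro mult_left_mono) auto
    moreover have "1 \<le> real (Suc n)" by simp
    moreover have "p / 2 + q + 1 \<le> 7 * r" if "q \<le> r * 4" "1 \<le> r" "p < 4" for p q r :: real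
      using that by (simp add: field_simps)
    ultimately show "c n + 1 \<le> 7 * real (Suc n)" using pi_less_4 unfolding c_def by blast
  qed
  have "\<exists>y. 1 / (c n + 1) < y \<and> y < 1 / (c n - 1) \<and> g y = Us s y" for n
  proof -
    have "1 / (c n + 1) < 1 / (c n - 1)" using c(1)[of n] by (intro divide_strict_left_mono) auto
    moreover have "AE x in lborel. x \<in> {0<..<1} \<longrightarrow> g x = Us s x"
      by (rule AE_completion_iff[THEN iffD1, OF ae])
    ultimately obtain y where y: "1 / (c n + 1) < y" "y < 1 / (c n - 1)" "y \<in> {0<..<1} \<longrightarrow> g y = Us s y"
      using not_null_interval by blast
    have "0 < 1 / (c n + 1)" "1 / (c n - 1) < 1" using c(1)[of n] by auto
    then have "y \<in> {0<..<1}" using y(1,2) by (auto simp del: zero_less_divide_iff divide_less_eq_1 divide_less_eq_1_pos zero_less_divide_1_iff intro: less_trans)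
    with y show ?thesis by blast
  qed
  then obtain y where y: "\<And>n. 1 / (c n + 1) < y n" "\<And>n. y n < 1 / (c n - 1)" "\<And>n. g (y n) = Us s (y n)"
    by metis
  have y0: "0 < y n" for n using y(1)[of n] c(1)[of n] by (intro less_trans[OF _ y(1)]) auto
  have dec: "y (Suc n) < y n" for n
  proof -
    have "1 / (c (Suc n) - 1) \<le> 1 / (c n + 1)"
      using c(1)[of n] c(2)[of n] pi_gt3 by (intro divide_left_mono) auto
    then show ?thesis using y(1)[of n] y(2)[of "Suc n"] by linarith
  qed
  have anti: "y n \<le> y m" if "m \<le> n" for m n
    by (rule lift_Suc_antimono_le[where f = y, OF less_imp_le[OF dec] that])
  have sn: "1 / 2 \<le> (-1) ^ Suc n * sin (1 / y n)" for n
  proof -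
    define \<theta> where "\<theta> = 1 / y n - c n"
    have "1 / y n < c n + 1" using y(1)[of n] y0[of n] c(1)[of n] by (simp add: field_simps)
    moreover have "c n - 1 < 1 / y n" using y(2)[of n] y0[of n] c(1)[of n] by (simp add: field_simps)
    ultimately have \<theta>: "\<bar>\<theta>\<bar> < 1" by (simp add: \<theta>_def abs_less_iff)
    have "sin (1 / y n) = sin (pi / 2 + (real (Suc n) * pi + \<theta>))"
      by (simp add: \<theta>_def c_def)
    also have "\<dots> = cos (real (Suc n) * pi + \<theta>)" by (simp add: sin_add)
    also have "\<dots> = (-1) ^ Suc n * cos \<theta>"
      unfolding cos_add cos_npi sin_npi by simp
    finally have "(-1) ^ Suc n * sin (1 / y n) = cos \<theta>"
      by (simp flip: power_mult_distrib mult.assoc add: power_mult_distrib[symmetric])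
    \<comment> \<open>The half-width 1 of the windows is below \<open>pi / 3\<close>, which keeps
      the sine at least 1/2 in modulus.\<close>
    moreover have "cos (pi / 3) \<le> cos \<bar>\<theta>\<bar>"
      using \<theta> pi_gt3 by (intro cos_monotone_0_pi_le) auto
    ultimately show ?thesis by (simp add: cos_60)
  qed
  define \<kappa> where "\<kappa> = \<bar>h s\<bar> * eps"
  define C where "C = \<bar>s\<bar> + 9 * \<bar>h s\<bar> * eps"
  have \<kappa>: "0 < \<kappa>" using hs by (simp add: \<kappa>_def eps_def)
  have C: "0 \<le> C" by (simp add: C_def eps_def)
  \<comment> \<open>14 = 7 * 2, from \<open>y n \<ge> 1 / (7 * (n + 1))\<close> and the lower bound
    1/2 for the sine.\<close>
  have jump: "\<kappa> / 14 * inverse (real (Suc n)) - C * (y n - y (Suc n)) \<le> \<bar>g (y n) - g (y (Suc n))\<bar>" for n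
  proof -
    have "1 / (7 * real (Suc n)) \<le> 1 / (c n + 1)" using c(1,3)[of n] by (intro divide_left_mono) auto
    then have "1 / (7 * real (Suc n)) * (1 / 2) \<le> y n * (1 / 2)"
      using y(1)[of n] by (intro mult_right_mono) auto
    moreover have "inverse (real (Suc n)) / 14 = 1 / (7 * real (Suc n)) * (1 / 2)"
      by (simp add: field_simps)
    ultimately have "inverse (real (Suc n)) / 14 \<le> y n * (1 / 2)" by (simp only:)
    also have "\<dots> \<le> y n * ((-1) ^ Suc n * sin (1 / y n)) + y (Suc n) * ((-1) ^ Suc (Suc n) * sin (1 / y (Suc n)))"
      using mult_left_mono[OF sn[of n], of "y n"] mult_left_mono[OF sn[of "Suc n"], of "y (Suc n)"] y0[of n] y0[of "Suc n"]
      by linarith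
    also have "\<dots> = (-1) ^ Suc n * (y n * sin (1 / y n) - y (Suc n) * sin (1 / y (Suc n)))"
      by (simp add: algebra_simps)
    also have "\<dots> \<le> \<bar>y n * sin (1 / y n) - y (Suc n) * sin (1 / y (Suc n))\<bar>"
      by (rule order_trans[OF abs_ge_self]) (simp add: abs_mult power_abs)
    finally have "\<kappa> * (inverse (real (Suc n)) / 14) \<le> \<kappa> * \<bar>y n * sin (1 / y n) - y (Suc n) * sin (1 / y (Suc n))\<bar>"
      using \<kappa> by (intro mult_left_mono) auto
    moreover have "\<bar>y n - y (Suc n)\<bar> = y n - y (Suc n)" using dec[of n] by simp
    ultimately show ?thesis
      using oscillation_bound[OF y0[of n] y0[of "Suc n"], of s] unfolding y(3) \<kappa>_def[symmetric] C_def[symmetric]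
      by simp
  qed
  have big: "ennreal (\<kappa> / 14 * harm N - C * y 0) \<le> total_variation g" for N
  proof -
    \<comment> \<open>The nodes decrease, whereas \<open>total_variation\<close> takes nondecreasing
      sequences. Truncated subtraction makes the reversed sequence constant from index
      \<open>N\<close> on.\<close>
    define z where "z j = y (N - j)" for j
    have "mono z" by (auto simp: mono_def z_def intro!: anti)
    have "\<kappa> / 14 * harm N - C * y 0 \<le> \<kappa> / 14 * harm N - C * (y 0 - y N)"
      using C y0[of N] by (simp add: algebra_simps)
    also have "\<dots> = (\<Sum>n<N. \<kappa> / 14 * inverse (real (Suc n)) - C * (y n - y (Suc n)))"
      by (induction N) (simp_all add: harm_altdef algebra_simps)
    also have "\<dots> \<le> (\<Sum>n<N. \<bar>g (y n) - g (y (Suc n))\<bar>)" by (rule sum_mono) (rule jump)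
    also have "\<dots> = (\<Sum>n<N. \<bar>g (y (N - Suc n)) - g (y (Suc (N - Suc n)))\<bar>)"
      by (rule sum.nat_diff_reindex[symmetric])
    also have "\<dots> = (\<Sum>n<N. \<bar>g (z (Suc n)) - g (z n)\<bar>)"
      by (intro sum.cong refl) (simp add: z_def Suc_diff_Suc)
    finally have "ennreal (\<kappa> / 14 * harm N - C * y 0) \<le> (\<Sum>n<N. ennreal \<bar>g (z (Suc n)) - g (z n)\<bar>)"
      by (simp add: ennreal_leI)
    also have "\<dots> \<le> total_variation g"
      unfolding total_variation_def using \<open>mono z\<close> by (intro SUP_upper2[of "(N, z)"]) auto
    finally show ?thesis .
  qed
  show ?thesis
  proof (rule ccontr)
    assume "total_variation g \<noteq> \<infinity>"
    then obtain r where r: "total_variation g = ennreal r" "0 \<le> r" by (cases "total_variation g") auto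
    obtain N where N: "(r + 1 + C * y 0) * (14 / \<kappa>) \<le> harm N"
      using harm_at_top unfolding filterlim_at_top eventually_sequentially by blast
    then have "(r + 1 + C * y 0) * (14 / \<kappa>) * (\<kappa> / 14) \<le> harm N * (\<kappa> / 14)"
      using \<kappa> by (intro mult_right_mono) auto
    moreover have "q * (14 / \<kappa>) * (\<kappa> / 14) = q" for q using \<kappa> by simp
    ultimately have "r + 1 + C * y 0 \<le> harm N * (\<kappa> / 14)" by (simp only:)
    then have "r + 1 \<le> \<kappa> / 14 * harm N - C * y 0" by (simp add: mult.commute)
    then have "ennreal (r + 1) \<le> ennreal r" using big[of N] r(1) by (metis ennreal_leI order_trans)
    then show False using r(2) by (simp add: ennreal_le_iff)
  qed
qed

theorem proposition4p2:
  shows "\<exists>(A :: real \<Rightarrow> real \<Rightarrow> real) \<Omega> um up C1 C2 u0 T0.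
    flux_A1 A \<Omega> \<and> flux_A2 A \<and> flux_A3 A \<Omega> um up \<and>
    flux_B1 A \<and> flux_B2 A \<and> flux_B3 A \<and> flux_B4 um up \<and>
    0 < C1 \<and> C1 < C2 \<and> flux_uu_in A C1 C2 \<and>
    u0 \<in> BV \<and> 0 < T0 \<and>
    (\<exists>u. adapted_entropy_solution A um up u0 u) \<and>
    (\<forall>u. adapted_entropy_solution A um up u0 u \<longrightarrow> ess_total_variation (u T0) = \<infinity>)"
proof -
  have "ess_total_variation (u (1/4)) = \<infinity>"
    if "adapted_entropy_solution A (\<lambda>_. 0) (\<lambda>_. 0) (U 0) u" for u
  proof -
    \<comment> \<open>\<open>tau (1/4)\<close> is 4/5, away from the zeros 0 and 1 of
      \<open>h\<close>; the time 1/4 is interior to the range \<open>0 < t < 1/2\<close> of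
      \<open>uniqueness\<close>.\<close>
    have "h (tau (1/4)) \<noteq> 0" by (simp add: h_def tau_def power2_eq_square power3_eq_cube)
    have "total_variation g = \<infinity>" if "AE x in lebesgue. g x = u (1/4) x" for g
    proof (rule infinite_variation[OF _ \<open>h (tau (1/4)) \<noteq> 0\<close>])
      show "AE x in lebesgue. x \<in> {0<..<1} \<longrightarrow> g x = Us (tau (1/4)) x"
        using solution_slice[OF \<open>adapted_entropy_solution A _ _ _ u\<close>] that
        by eventually_elim simp
    qed
    then show ?thesis
      unfolding ess_total_variation_def by (intro antisym INF_greatest) simp_all
  qed
  then show ?thesis
    using flux_conditions U0_BV U_solution
    by (rule_tac exI[of _ A], rule_tac exI[of _ "{0}"], rule_tac exI[of _ "\<lambda>_. 0"], rule_tac exI[of _ "\<lambda>_. 0"],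
        rule_tac exI[of _ "1/2"], rule_tac exI[of _ 2], rule_tac exI[of _ "U 0"], rule_tac exI[of _ "1/4"]) auto
qed

end
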